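(* Let $n\ge 1$, $s\in(0,1)$, and let $\Omega\subseteq\mathbb{R}^n$ be a bounded open set with boundary $\partial\Omega$ of class $C^1$. Let $m:=|\Omega|\in(0,\infty)$ and let $B^{(m)}$ be any Euclidean ball with volume $m$. Then $$\lambda_{\mathcal{L}}(\Omega)\ \ge\ \lambda_{\mathcal{L}}(B^{(m)}).$$ Moreover, if equality holds, then $\Omega$ is a ball.
   Context: For a bounded open set $U\subseteq\mathbb{R}^n$ with $C^1$ boundary, let $\mathbb{X}(U):=\{u\in H^1(\mathbb{R}^n): u\equiv 0 \text{ a.e. on } \mathbb{R}^n\setminus U\}$. For $u\in\mathbb{X}(U)$ set $$\mathcal{D}_{U,s}(u):=\int_U|\nabla u|^2\,dx+\iint_{\mathbb{R}^{2n}}\frac{|u(x)-u(y)|^2}{|x-y|^{n+2s}}\,dx\,dy .$$ The principal Dirichlet eigenvalue of the operator $\mathcal{L}=-\Delta+(-\Delta)^s$ in $U$ is defined as $$\lambda_{\mathcal{L}}(U):=\inf\Big\{\frac{\mathcal{D}_{U,s}(u)}{\|u\|^2_{L^2(U)}}:\ u\in\mathbb{X}(U)\setminus\{0\}\Big\}.$$ *)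

theory Defs
  imports "HOL-Analysis.Analysis"
begin

definition Cc1_test :: "('a::euclidean_space \<Rightarrow> real) \<Rightarrow> ('a \<Rightarrow> 'a) \<Rightarrow> bool" where
  "Cc1_test \<phi> \<phi>' \<longleftrightarrow>
     (\<forall>x. (\<phi> has_derivative (\<lambda>h. \<phi>' x \<bullet> h)) (at x)) \<and> continuous_on UNIV \<phi>' \<and>
     compact (closure {x. \<phi> x \<noteq> 0})"

definition weak_gradient :: "('a::euclidean_space \<Rightarrow> real) \<Rightarrow> ('a \<Rightarrow> 'a) \<Rightarrow> bool" where
  "weak_gradient u G \<longleftrightarrow>
     (\<forall>\<phi> \<phi>'. Cc1_test \<phi> \<phi>' \<longrightarrow>
        (\<forall>i\<in>Basis. (\<integral>x. u x * (\<phi>' x \<bullet> i) \<partial>lebesgue) = - (\<integral>x. (G x \<bullet> i) * \<phi> x \<partial>lebesgue)))"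

definition H1_pair :: "('a::euclidean_space \<Rightarrow> real) \<Rightarrow> ('a \<Rightarrow> 'a) \<Rightarrow> bool" where
  "H1_pair u G \<longleftrightarrow>
     u \<in> borel_measurable lebesgue \<and> integrable lebesgue (\<lambda>x. (u x)\<^sup>2) \<and>
     G \<in> borel_measurable lebesgue \<and> integrable lebesgue (\<lambda>x. (norm (G x))\<^sup>2) \<and>
     weak_gradient u G"

definition XU_pair :: "'a::euclidean_space set \<Rightarrow> ('a \<Rightarrow> real) \<Rightarrow> ('a \<Rightarrow> 'a) \<Rightarrow> bool" where
  "XU_pair U u G \<longleftrightarrow> H1_pair u G \<and> (AE x in lebesgue. x \<notin> U \<longrightarrow> u x = 0)"

definition energy :: "'a::euclidean_space set \<Rightarrow> real \<Rightarrow> ('a \<Rightarrow> real) \<Rightarrow> ('a \<Rightarrow> 'a) \<Rightarrow> ennreal" where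
  "energy U s u G =
     (\<integral>\<^sup>+x. indicator U x * ennreal ((norm (G x))\<^sup>2) \<partial>lebesgue) +
     (\<integral>\<^sup>+z. ennreal ((u (fst z) - u (snd z))\<^sup>2 /
              norm (fst z - snd z) powr (real DIM('a) + 2 * s)) \<partial>(lebesgue \<Otimes>\<^sub>M lebesgue))"

text \<open>Principal Dirichlet eigenvalue of -Delta + (-Delta)^s in U.\<close>
definition lambda_L :: "'a::euclidean_space set \<Rightarrow> real \<Rightarrow> ennreal" where
  "lambda_L U s =
     (INF p \<in> {(u, G). XU_pair U u G \<and> \<not> (AE x in lebesgue. u x = 0)}.
        energy U s (fst p) (snd p) /
        ennreal (\<integral>x. indicator U x * (fst p x)\<^sup>2 \<partial>lebesgue))"

text \<open>C^1 boundary: locally, after choosing a unit direction nu, U is the supergraph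
  of a C^1 function of the coordinates orthogonal to nu.\<close>
definition C1_boundary :: "'a::euclidean_space set \<Rightarrow> bool" where
  "C1_boundary U \<longleftrightarrow>
     (\<forall>p\<in>frontier U. \<exists>r>0. \<exists>\<nu>::'a. \<exists>\<gamma>::'a \<Rightarrow> real. \<exists>g::'a \<Rightarrow> 'a.
        norm \<nu> = 1 \<and>
        (\<forall>x t. \<gamma> (x + t *\<^sub>R \<nu>) = \<gamma> x) \<and>
        (\<forall>x. (\<gamma> has_derivative (\<lambda>h. g x \<bullet> h)) (at x)) \<and> continuous_on UNIV g \<and>
        U \<inter> ball p r = {x \<in> ball p r. x \<bullet> \<nu> > \<gamma> x})"

end

theory Submission
  imports Defs "HOL-Complex_Analysis.Great_Picard"
begin

text \<open>
  For a radial kernel \<open>k\<close> let \<open>qform k u\<close> be \<open>\<integral>\<integral> (u x - u y)\<^sup>2 * k |x - y| dx dy\<close>. The Gagliardo term is such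
  a form, and the Dirichlet integral is the supremum over \<open>\<epsilon>\<close> of the forms with kernel proportional to
  the indicator of \<open>r < \<epsilon>\<close>. Hence the whole energy is controlled by forms with nonincreasing
  kernels, each of which decreases under polarization (two-point rearrangement) by an elementary
  four-point inequality; for the strictly decreasing Gagliardo kernel equality forces
  \<open>u \<ge> u \<circ> \<sigma>\<close> or \<open>u \<le> u \<circ> \<sigma>\<close> on the half space, \<open>\<sigma>\<close> being the reflection.

  Minimize the energy over all normalized nonnegative functions supported in one large ball whose
  positivity set has volume at most \<open>m\<close>. The fractional seminorm gives compactness, so a minimizer
  exists, and by the equality case it is symmetric decreasing about some centre; its positivity set
  is a ball. Therefore the minimum is at least the eigenvalue of the ball of volume \<open>m\<close>, and it is
  at most the eigenvalue of every \<open>\<Omega>\<close> of volume \<open>m\<close>. If the eigenvalues agree, a first eigenfunction of \<open>\<Omega>\<close> is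
  itself such a minimizer; by scaling its positivity ball has the full volume \<open>m\<close>, so \<open>\<Omega>\<close> is that ball
  up to a null set, and the regularity of the boundary removes the null set.
\<close>

section \<open>Isometries of Lebesgue measure\<close>

text \<open>Polarizing a weak gradient would mean gluing it across a hyperplane. For a form with a
  nonincreasing kernel only values of the function and distances matter, and no gluing occurs. The
  price is that the Dirichlet term must be tied back to the weak gradients of the definition by two
  inequalities. On the side of the ball, a minimizer of finite form energy has to be supplied with a
  weak gradient. On the side of \<open>\<Omega>\<close>, the forms have to be bounded by the
  gradient integral over \<open>\<Omega>\<close> alone, because the energy ignores the gradient
  elsewhere; mollification gives this bound over the closure, and the boundary is shown to be null.
  Only the Gagliardo kernel is strictly decreasing, so all rigidity comes from it, both in the
  equality case of polarization and in the dilation that fixes the radius. Compactness confines the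
  admissible functions to one ball about the origin, and polarization preserves that ball only when
  the origin lies on the side receiving the larger values; exchanging the two half spaces covers the
  remaining hyperplanes.\<close>

lemma nn_integral_lborel_add:
  fixes f :: "'a::euclidean_space \<Rightarrow> ennreal"
  assumes [measurable]: "f \<in> borel_measurable borel"
  shows "(\<integral>\<^sup>+x. f (x + c) \<partial>lborel) = (\<integral>\<^sup>+x. f x \<partial>lborel)"
proof -
  have "(\<integral>\<^sup>+x. f x \<partial>lborel) = (\<integral>\<^sup>+x. f x \<partial>(distr lborel borel ((+) c)))"
    by (simp add: lborel_distr_plus)
  also have "\<dots> = (\<integral>\<^sup>+x. f (x + c) \<partial>lborel)"
    by (subst nn_integral_distr) (auto simp: add.commute)
  finally show ?thesis by simp
qed

lemma nn_integral_lborel_scale: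
  fixes f :: "'a::euclidean_space \<Rightarrow> ennreal"
  assumes [measurable]: "f \<in> borel_measurable borel" and c: "c \<noteq> 0"
  shows "(\<integral>\<^sup>+x. f x \<partial>lborel) = ennreal (\<bar>c\<bar> ^ DIM('a)) * (\<integral>\<^sup>+x. f (c *\<^sub>R x) \<partial>lborel)"
proof -
  have "(\<integral>\<^sup>+x. f x \<partial>lborel)
      = (\<integral>\<^sup>+x. f x \<partial>(density (distr lborel borel (\<lambda>x. 0 + c *\<^sub>R x)) (\<lambda>_. ennreal (\<bar>c\<bar> ^ DIM('a)))))"
    using lborel_affine[OF c, of "0::'a"] by simp
  also have "\<dots> = ennreal (\<bar>c\<bar> ^ DIM('a)) * (\<integral>\<^sup>+x. f (c *\<^sub>R x) \<partial>lborel)"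
    by (simp add: nn_integral_density nn_integral_distr nn_integral_cmult)
  finally show ?thesis .
qed

lemma nn_integral_lborel_uminus:
  fixes f :: "'a::euclidean_space \<Rightarrow> ennreal"
  assumes [measurable]: "f \<in> borel_measurable borel"
  shows "(\<integral>\<^sup>+x. f (- x) \<partial>lborel) = (\<integral>\<^sup>+x. f x \<partial>lborel)"
  using nn_integral_lborel_scale[OF assms, of "-1"] by simp

lemma nn_integral_lborel_minus:
  fixes f :: "'a::euclidean_space \<Rightarrow> ennreal"
  assumes [measurable]: "f \<in> borel_measurable borel"
  shows "(\<integral>\<^sup>+x. f (c - x) \<partial>lborel) = (\<integral>\<^sup>+x. f x \<partial>lborel)"
  using nn_integral_lborel_uminus[of "\<lambda>x. f (x + c)"] nn_integral_lborel_add[OF assms, of c]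
  by simp

text \<open>Uniqueness of Haar measure, by computing
  \<open>\<integral>\<integral> indicator A (T x) * indicator C (T x + y)\<close> for the unit ball \<open>C\<close> in both orders.\<close>
lemma distr_lborel_isometry:
  fixes T :: "'a::euclidean_space \<Rightarrow> 'a"
  assumes lin: "linear T" and iso: "\<And>x. norm (T x) = norm x"
  shows "distr lborel borel T = lborel"
proof (rule measure_eqI)
  show "sets (distr lborel borel T) = sets lborel" by simp
  have [measurable]: "T \<in> borel_measurable borel"
    using lin by (intro borel_measurable_continuous_onI linear_continuous_on linear_conv_bounded_linear[THEN iffD1])
  have "inj T"
    using lin iso by (metis linear_injective_0 norm_eq_zero)
  then have "surj T" using lin by (metis linear_injective_imp_surjective)
  fix A assume "A \<in> sets (distr lborel borel T)"
  then have A[measurable]: "A \<in> sets borel" by simp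
  define C :: "'a set" where "C = ball 0 1"
  have C[measurable]: "C \<in> sets borel" by (simp add: C_def)
  define \<mu> where "\<mu> = (\<lambda>B. \<integral>\<^sup>+x. indicator B (T x) \<partial>lborel)"
  have "\<mu> A * emeasure lborel C = (\<integral>\<^sup>+x. \<integral>\<^sup>+y. indicator A (T x) * indicator C (T x + y) \<partial>lborel \<partial>lborel)"
  proof -
    have "(\<integral>\<^sup>+y. indicator A (T x) * indicator C (T x + y) \<partial>lborel) = indicator A (T x) * emeasure lborel C" for x
      using nn_integral_lborel_add[of "indicator C" "T x"]
      by (simp add: nn_integral_cmult add.commute)
    then show ?thesis by (simp add: \<mu>_def nn_integral_multc)
  qed
  also have "\<dots> = (\<integral>\<^sup>+y. \<integral>\<^sup>+x. indicator A (T x) * indicator C (T x + y) \<partial>lborel \<partial>lborel)"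
    by (rule lborel_pair.Fubini') measurable
  also have "\<dots> = (\<integral>\<^sup>+y. \<integral>\<^sup>+x. indicator A (T x - y) * indicator C (T x) \<partial>lborel \<partial>lborel)"
  proof (rule nn_integral_cong)
    fix y
    \<comment> \<open>Surjectivity turns the shift of \<open>T x\<close> by \<open>y\<close> into a
      shift of \<open>x\<close>, to which translation invariance applies.\<close>
    obtain y' where y': "y = T y'" using \<open>surj T\<close> by (metis surjD)
    have "(\<integral>\<^sup>+x. indicator A (T x) * indicator C (T x + y) \<partial>lborel)
        = (\<integral>\<^sup>+x. (\<lambda>x. indicator A (T x - y) * indicator C (T x) :: ennreal) (x + y') \<partial>lborel)"
      using lin by (simp add: linear_add y')
    also have "\<dots> = (\<integral>\<^sup>+x. indicator A (T x - y) * indicator C (T x) \<partial>lborel)"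
      by (rule nn_integral_lborel_add) measurable
    finally show "(\<integral>\<^sup>+x. indicator A (T x) * indicator C (T x + y) \<partial>lborel)
        = (\<integral>\<^sup>+x. indicator A (T x - y) * indicator C (T x) \<partial>lborel)" .
  qed
  also have "\<dots> = (\<integral>\<^sup>+x. \<integral>\<^sup>+y. indicator A (T x - y) * indicator C (T x) \<partial>lborel \<partial>lborel)"
    by (rule lborel_pair.Fubini') measurable
  also have "\<dots> = \<mu> C * emeasure lborel A"
  proof -
    have "(\<integral>\<^sup>+y. indicator A (T x - y) * indicator C (T x) \<partial>lborel) = indicator C (T x) * emeasure lborel A" for x
      using nn_integral_lborel_minus[of "indicator A" "T x"]
      by (simp add: nn_integral_multc) (simp add: mult.commute)
    then show ?thesis by (simp add: \<mu>_def nn_integral_multc)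
  qed
  \<comment> \<open>Preservation of the norm enters here: the unit ball is its own preimage, so the
    factor between the two measures is 1.\<close>
  also have "\<mu> C = emeasure lborel C"
  proof -
    have "indicator C (T x) = (indicator C x :: ennreal)" for x
      using iso by (auto simp: C_def indicator_def)
    then show ?thesis by (simp add: \<mu>_def)
  qed
  finally have eq: "\<mu> A * emeasure lborel C = emeasure lborel C * emeasure lborel A" .
  have "emeasure lborel C \<noteq> 0" "emeasure lborel C \<noteq> top"
    using emeasure_lborel_ball_finite[of "0::'a" 1] content_ball_pos[of 1 "0::'a"]
    by (auto simp: C_def measure_def)
  then have "\<mu> A = emeasure lborel A"
    using eq by (metis ennreal_mult_cancel_left mult.commute)
  moreover have "\<mu> A = emeasure (distr lborel borel T) A"
  proof -
    have "\<mu> A = (\<integral>\<^sup>+x. indicator A x \<partial>(distr lborel borel T))"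
      by (subst nn_integral_distr) (auto simp: \<mu>_def)
    then show ?thesis by simp
  qed
  ultimately show "emeasure (distr lborel borel T) A = emeasure lborel A" by simp
qed

section \<open>Reflection in the hyperplane of points with inner product \<open>a\<close> with a
  unit vector\<close>

definition hrefl :: "'a::euclidean_space \<Rightarrow> real \<Rightarrow> 'a \<Rightarrow> 'a" where
  "hrefl e a x = x - (2 * (x \<bullet> e - a)) *\<^sub>R e"

lemma hrefl_measurable[measurable]: "hrefl e a \<in> borel_measurable borel"
  unfolding hrefl_def by measurable

context
  fixes e :: "'a::euclidean_space" and a :: real
  assumes e: "norm e = 1"
begin

lemma inner_unit_self: "e \<bullet> e = 1"
  using e by (simp add: norm_eq_1)

lemma hrefl_inner: "hrefl e a x \<bullet> e - a = - (x \<bullet> e - a)"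
  by (simp add: hrefl_def inner_diff_left inner_unit_self algebra_simps)

lemma hrefl_hrefl[simp]: "hrefl e a (hrefl e a x) = x"
proof -
  have "hrefl e a (hrefl e a x) = hrefl e a x - (2 * (hrefl e a x \<bullet> e - a)) *\<^sub>R e"
    by (simp add: hrefl_def)
  also have "\<dots> = x" unfolding hrefl_inner by (simp add: hrefl_def scaleR_left_diff_distrib)
  finally show ?thesis .
qed

text \<open>Reflecting one of two points lengthens their distance exactly when both lie strictly on
  the same side. Every later comparison of distances under a reflection, for kernels, supports and
  mollifiers, reads off the sign of this product.\<close>

lemma hrefl_dist_sq: "(norm (hrefl e a x - y))\<^sup>2 = (norm (x - y))\<^sup>2 + 4 * (x \<bullet> e - a) * (y \<bullet> e - a)"
proof -
  define t where "t = x \<bullet> e - a"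
  have "(norm (hrefl e a x - y))\<^sup>2 = (norm ((x - y) - (2 * t) *\<^sub>R e))\<^sup>2"
    by (simp add: hrefl_def t_def algebra_simps)
  also have "\<dots> = (norm (x - y))\<^sup>2 - 4 * t * ((x - y) \<bullet> e) + 4 * t\<^sup>2"
    unfolding power2_norm_eq_inner
    by (simp add: inner_diff_left inner_diff_right inner_unit_self inner_commute power2_eq_square algebra_simps)
  also have "(x - y) \<bullet> e = t - (y \<bullet> e - a)" by (simp add: t_def inner_diff_left)
  also have "(norm (x - y))\<^sup>2 - 4 * t * (t - (y \<bullet> e - a)) + 4 * t\<^sup>2 = (norm (x - y))\<^sup>2 + 4 * t * (y \<bullet> e - a)"
    by (simp add: power2_eq_square algebra_simps)
  finally show ?thesis by (simp add: t_def)
qed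

lemma hrefl_dist: "norm (hrefl e a x - hrefl e a y) = norm (x - y)"
proof -
  have "hrefl e a x - hrefl e a y = hrefl e 0 (x - y)"
    by (simp add: hrefl_def inner_diff_left algebra_simps)
  moreover have "(norm (hrefl e a x - hrefl e a y))\<^sup>2 = (norm (x - y))\<^sup>2"
    using hrefl_dist_sq[of x "hrefl e a y"] hrefl_dist_sq[of y x] unfolding hrefl_inner
    by (simp add: norm_minus_commute algebra_simps)
  ultimately show ?thesis by (simp add: power2_eq_iff_nonneg)
qed

lemma hrefl_dist_swap: "norm (hrefl e a x - y) = norm (x - hrefl e a y)"
  using hrefl_dist[of x "hrefl e a y"] by simp

text \<open>The reflection is its linear part \<open>hrefl e 0\<close>, an isometry fixing the
  origin, followed by the translation by \<open>(2 * a) *\<^sub>R e\<close>.\<close>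

lemma nn_integral_hrefl:
  fixes f :: "'a::euclidean_space \<Rightarrow> ennreal"
  assumes [measurable]: "f \<in> borel_measurable borel"
  shows "(\<integral>\<^sup>+x. f (hrefl e a x) \<partial>lborel) = (\<integral>\<^sup>+x. f x \<partial>lborel)"
proof -
  have lin: "linear (hrefl e 0)"
    by (rule linearI) (auto simp: hrefl_def inner_add_left algebra_simps)
  have iso: "norm (hrefl e 0 x) = norm x" for x
  proof -
    have "(norm (hrefl e 0 x))\<^sup>2 = (norm x)\<^sup>2"
      unfolding power2_norm_eq_inner hrefl_def
      by (simp add: inner_diff_left inner_diff_right inner_unit_self inner_commute power2_eq_square algebra_simps)
    then show ?thesis by (simp add: power2_eq_iff_nonneg)
  qed
  have "(\<integral>\<^sup>+x. f x \<partial>lborel) = (\<integral>\<^sup>+x. f (x + (2 * a) *\<^sub>R e) \<partial>lborel)"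
    by (rule nn_integral_lborel_add[symmetric]) simp
  also have "\<dots> = (\<integral>\<^sup>+x. f (x + (2 * a) *\<^sub>R e) \<partial>(distr lborel borel (hrefl e 0)))"
    using distr_lborel_isometry[OF lin iso] by simp
  also have "\<dots> = (\<integral>\<^sup>+x. f (hrefl e 0 x + (2 * a) *\<^sub>R e) \<partial>lborel)"
    by (subst nn_integral_distr) auto
  also have "(\<lambda>x. hrefl e 0 x + (2 * a) *\<^sub>R e) = hrefl e a"
    by (auto simp: hrefl_def algebra_simps)
  then have "(\<integral>\<^sup>+x. f (hrefl e 0 x + (2 * a) *\<^sub>R e) \<partial>lborel) = (\<integral>\<^sup>+x. f (hrefl e a x) \<partial>lborel)"
    by metis
  finally show ?thesis by simp
qed

lemma AE_hrefl:
  assumes "AE x in lborel. P x"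
  shows "AE x in lborel. P (hrefl e a x)"
proof -
  obtain N where N: "{x\<in>space lborel. \<not> P x} \<subseteq> N" "emeasure lborel N = 0" "N \<in> sets lborel"
    using AE_E[OF assms] by blast
  have [measurable]: "N \<in> sets borel" using N by simp
  have "(\<integral>\<^sup>+x. indicator N (hrefl e a x) \<partial>lborel) = 0"
    using N by (subst nn_integral_hrefl) auto
  then have "AE x in lborel. hrefl e a x \<notin> N"
    by (subst (asm) nn_integral_0_iff_AE) (auto simp: indicator_def elim: eventually_mono)
  then show ?thesis using N(1) by (auto elim!: eventually_mono)
qed

end

section \<open>Jensen, completeness of \<open>L\<^sup>2\<close> and quadratic forms\<close>

lemma ball_borel_measurable[measurable]:
  "ball (c::'a::euclidean_space) r \<in> sets borel" "cball (c::'a::euclidean_space) r \<in> sets borel"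
  by auto

lemma integrable_sq_nn_integral:
  assumes [measurable]: "f \<in> borel_measurable M" and "(\<integral>\<^sup>+x. ennreal ((f x)\<^sup>2) \<partial>M) < \<infinity>"
  shows "integrable M (\<lambda>x. (f x)\<^sup>2 :: real)"
  using assms by (intro integrableI_nonneg) auto

text \<open>The weighted variance of \<open>c - g\<close> about its mean \<open>d\<close> is
  nonnegative. An infinite right side leaves nothing to prove; a finite one makes
  \<open>w * g\<close> integrable through \<bar>t\<bar> \<le> 1 + t^2.\<close>

lemma jensen_sq:
  fixes w g :: "'a \<Rightarrow> real"
  assumes [measurable]: "w \<in> borel_measurable M" "g \<in> borel_measurable M"
    and w: "\<And>x. w x \<ge> 0" and w1: "(\<integral>\<^sup>+x. ennreal (w x) \<partial>M) = 1"
  shows "ennreal ((c - (\<integral>x. w x * g x \<partial>M))\<^sup>2) \<le> (\<integral>\<^sup>+x. ennreal (w x * (c - g x)\<^sup>2) \<partial>M)"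
proof (cases "(\<integral>\<^sup>+x. ennreal (w x * (c - g x)\<^sup>2) \<partial>M) < \<infinity>")
  case False
  then show ?thesis by (simp add: less_top[symmetric])
next
  case True
  have iw: "integrable M w" and w_int: "(\<integral>x. w x \<partial>M) = 1"
    using w w1 by (auto intro!: integrableI_nonneg simp: integral_eq_nn_integral)
  have i2: "integrable M (\<lambda>x. w x * (c - g x)\<^sup>2)"
    using True w by (intro integrableI_nonneg) auto
  have i1: "integrable M (\<lambda>x. w x * (c - g x))"
  proof (rule Bochner_Integration.integrable_bound[OF Bochner_Integration.integrable_add[OF iw i2]])
    have "\<bar>t\<bar> \<le> 1 + t\<^sup>2" for t :: real
    proof -
      have "0 \<le> (\<bar>t\<bar> - 1/2)\<^sup>2" by simp
      then show ?thesis unfolding power2_diff by (simp add: power2_eq_square)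
    qed
    then have "w x * \<bar>c - g x\<bar> \<le> w x * (1 + (c - g x)\<^sup>2)" for x
      by (intro mult_left_mono w)
    then show "AE x in M. norm (w x * (c - g x)) \<le> norm (w x + w x * (c - g x)\<^sup>2)"
      using w by (auto simp: abs_mult distrib_left)
  qed simp
  define d where "d = (\<integral>x. w x * (c - g x) \<partial>M)"
  have "integrable M (\<lambda>x. c * w x - w x * (c - g x))"
    using iw i1 by auto
  then have ig: "integrable M (\<lambda>x. w x * g x)" by (simp add: algebra_simps)
  have d: "d = c - (\<integral>x. w x * g x \<partial>M)"
    using iw ig w_int by (simp add: d_def right_diff_distrib)
  have "0 \<le> (\<integral>x. w x * ((c - g x) - d)\<^sup>2 \<partial>M)"
    using w by (intro integral_nonneg_AE) auto
  also have "(\<lambda>x. w x * ((c - g x) - d)\<^sup>2) = (\<lambda>x. w x * (c - g x)\<^sup>2 - 2 * d * (w x * (c - g x)) + d\<^sup>2 * w x)"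
    by (auto simp: power2_eq_square algebra_simps)
  also have "(\<integral>x. w x * (c - g x)\<^sup>2 - 2 * d * (w x * (c - g x)) + d\<^sup>2 * w x \<partial>M)
      = (\<integral>x. w x * (c - g x)\<^sup>2 \<partial>M) - d\<^sup>2"
    using iw i1 i2 by (simp add: w_int d_def[symmetric] power2_eq_square)
  finally have "d\<^sup>2 \<le> (\<integral>x. w x * (c - g x)\<^sup>2 \<partial>M)" by simp
  also have "ennreal \<dots> = (\<integral>\<^sup>+x. ennreal (w x * (c - g x)\<^sup>2) \<partial>M)"
    using i2 w by (simp add: nn_integral_eq_integral)
  finally show ?thesis by (simp add: d ennreal_leI)
qed

lemma fatou_bound:
  fixes h :: "nat \<Rightarrow> 'a \<Rightarrow> ennreal"
  assumes [measurable]: "\<And>n. h n \<in> borel_measurable M"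
    and lim: "AE x in M. (\<lambda>n. h n x) \<longlonglongrightarrow> g x"
    and bd: "eventually (\<lambda>n. (\<integral>\<^sup>+x. h n x \<partial>M) \<le> B) sequentially"
  shows "(\<integral>\<^sup>+x. g x \<partial>M) \<le> B"
proof -
  have "(\<integral>\<^sup>+x. g x \<partial>M) = (\<integral>\<^sup>+x. liminf (\<lambda>n. h n x) \<partial>M)"
    using lim by (intro nn_integral_cong_AE) (auto elim!: eventually_mono simp: lim_imp_Liminf)
  also have "\<dots> \<le> liminf (\<lambda>n. \<integral>\<^sup>+x. h n x \<partial>M)"
    by (rule nn_integral_liminf) simp
  also have "\<dots> \<le> limsup (\<lambda>n. \<integral>\<^sup>+x. h n x \<partial>M)"
    by (rule Liminf_le_Limsup) simp
  also have "\<dots> \<le> B"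
    using bd by (rule Limsup_bounded)
  finally show ?thesis .
qed

lemma ennreal_tendsto_0I:
  fixes f :: "'b \<Rightarrow> ennreal"
  assumes "\<And>\<epsilon>::real. \<epsilon> > 0 \<Longrightarrow> eventually (\<lambda>n. f n \<le> ennreal \<epsilon>) F"
  shows "(f \<longlongrightarrow> 0) F"
proof (rule order_tendstoI)
  fix a :: ennreal assume "0 < a"
  then obtain b where b: "0 < b" "b < a" using dense by blast
  then obtain r where r: "b = ennreal r" "r > 0"
    by (cases b) (auto simp: ennreal_less_zero_iff)
  show "eventually (\<lambda>n. f n < a) F"
    using assms[OF r(2)] b r(1) by (auto elim!: eventually_mono)
qed simp

text \<open>The Riesz-Fischer argument, recording both the a.e. convergent subsequence, needed for
  Fatou, and the convergence of the full sequence in norm. The range is a Banach space so that the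
  lemma serves functions as well as gradients.\<close>

lemma L2_complete:
  fixes f :: "nat \<Rightarrow> 'a::euclidean_space \<Rightarrow> 'b::{banach,second_countable_topology}"
  assumes [measurable]: "\<And>n. f n \<in> borel_measurable borel"
    and cauchy: "\<And>\<epsilon>. \<epsilon> > 0 \<Longrightarrow>
      \<exists>N. \<forall>m\<ge>N. \<forall>n\<ge>N. (\<integral>\<^sup>+x. ennreal ((norm (f m x - f n x))\<^sup>2) \<partial>lborel) \<le> ennreal \<epsilon>"
  obtains g \<phi> where "strict_mono \<phi>" "g \<in> borel_measurable borel"
    "AE x in lborel. (\<lambda>n. f (\<phi> n) x) \<longlonglongrightarrow> g x"
    "(\<lambda>n. \<integral>\<^sup>+x. ennreal ((norm (f n x - g x))\<^sup>2) \<partial>lborel) \<longlonglongrightarrow> 0"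
proof -
  \<comment> \<open>The rate 8^-k against the weight 4^k leaves a summable 2^-k. Hence a.e. the
    increments are at most a constant times 2^-k, and the telescoping series converges.\<close>
  have "\<forall>k. \<exists>N. \<forall>m\<ge>N. \<forall>n\<ge>N. (\<integral>\<^sup>+x. ennreal ((norm (f m x - f n x))\<^sup>2) \<partial>lborel) \<le> ennreal ((1/8)^k)"
    using cauchy by simp
  then obtain N where N: "\<And>k m n. m \<ge> N k \<Longrightarrow> n \<ge> N k \<Longrightarrow>
      (\<integral>\<^sup>+x. ennreal ((norm (f m x - f n x))\<^sup>2) \<partial>lborel) \<le> ennreal ((1/8)^k)"
    by metis
  \<comment> \<open>The partial sum dominates \<open>N k\<close>, and the added \<open>k\<close>
    makes the index strictly increasing.\<close>
  define \<phi> where "\<phi> k = (\<Sum>j\<le>k. N j) + k" for k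
  have sm: "strict_mono \<phi>" by (rule strict_mono_Suc_iff[THEN iffD2]) (simp add: \<phi>_def)
  have \<phi>N: "\<phi> k \<ge> N k" for k
    using member_le_sum[of k "{..k}" N] by (simp add: \<phi>_def)
  define \<Delta> where "\<Delta> k x = f (\<phi> (Suc k)) x - f (\<phi> k) x" for k x
  have [measurable]: "\<Delta> k \<in> borel_measurable borel" for k unfolding \<Delta>_def by measurable
  have "(\<integral>\<^sup>+x. (\<Sum>k. ennreal (4^k * (norm (\<Delta> k x))\<^sup>2)) \<partial>lborel)
      = (\<Sum>k. \<integral>\<^sup>+x. ennreal (4^k * (norm (\<Delta> k x))\<^sup>2) \<partial>lborel)"
    by (rule nn_integral_suminf) simp
  also have "\<dots> \<le> (\<Sum>k. ennreal ((1/2)^k))"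
  proof (rule suminf_le)
    fix k
    have "(\<integral>\<^sup>+x. ennreal (4^k * (norm (\<Delta> k x))\<^sup>2) \<partial>lborel)
        = ennreal (4^k) * (\<integral>\<^sup>+x. ennreal ((norm (\<Delta> k x))\<^sup>2) \<partial>lborel)"
      by (simp add: ennreal_mult nn_integral_cmult)
    also have "\<dots> \<le> ennreal (4^k) * ennreal ((1/8)^k)"
      unfolding \<Delta>_def
      using \<phi>N[of k] strict_monoD[OF sm, of k "Suc k"] by (intro mult_left_mono N) auto
    also have "\<dots> = ennreal ((1/2)^k)"
      by (simp add: ennreal_mult[symmetric] power_mult_distrib[symmetric])
    finally show "(\<integral>\<^sup>+x. ennreal (4^k * (norm (\<Delta> k x))\<^sup>2) \<partial>lborel) \<le> ennreal ((1/2)^k)" .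
  qed auto
  also have "\<dots> < \<infinity>"
    by (subst suminf_ennreal2) (auto simp: summable_geometric)
  finally have "AE x in lborel. (\<Sum>k. ennreal (4^k * (norm (\<Delta> k x))\<^sup>2)) \<noteq> \<infinity>"
    by (intro nn_integral_PInf_AE) auto
  then have conv: "AE x in lborel. convergent (\<lambda>n. f (\<phi> n) x)"
  proof (rule eventually_mono)
    fix x assume "(\<Sum>k. ennreal (4^k * (norm (\<Delta> k x))\<^sup>2)) \<noteq> \<infinity>"
    moreover define X where "X = (\<Sum>k. ennreal (4^k * (norm (\<Delta> k x))\<^sup>2))"
    ultimately have "X \<noteq> \<infinity>" by simp
    then obtain S where S: "S \<ge> 0" "X = ennreal S"
      by (cases X) auto
    have leX: "ennreal (4^k * (norm (\<Delta> k x))\<^sup>2) \<le> X" for k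
      unfolding X_def
      by (rule order_trans[OF _ sum_le_suminf[of _ "{k}"]]) auto
    have le: "norm (\<Delta> k x) \<le> sqrt S * (1/2)^k" for k
    proof -
      have pow4: "(2^k)\<^sup>2 = (4::real)^k" by (simp add: power2_eq_square power_mult_distrib[symmetric])
      have "ennreal (4^k * (norm (\<Delta> k x))\<^sup>2) \<le> ennreal S"
        using leX S(2) by metis
      then have "(2^k * norm (\<Delta> k x))\<^sup>2 \<le> S"
        using S(1) by (simp add: power_mult_distrib pow4)
      then have "2^k * norm (\<Delta> k x) \<le> sqrt S" by (rule real_le_rsqrt)
      then show ?thesis by (simp add: power_one_over field_simps)
    qed
    have "summable (\<lambda>k. sqrt S * (1/2)^k)" by (intro summable_mult summable_geometric) simp
    then have "summable (\<lambda>k. \<Delta> k x)"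
      using le by (rule summable_comparison_test'[where N=0])
    then have "convergent (\<lambda>n. \<Sum>k<n. \<Delta> k x)" by (simp add: summable_iff_convergent)
    then have "convergent (\<lambda>n. (\<Sum>k<n. \<Delta> k x) + f (\<phi> 0) x)" by (intro convergent_add convergent_const)
    moreover have "(\<Sum>k<n. \<Delta> k x) + f (\<phi> 0) x = f (\<phi> n) x" for n
      unfolding \<Delta>_def by (subst sum_lessThan_telescope) simp
    ultimately show "convergent (\<lambda>n. f (\<phi> n) x)" by simp
  qed
  define g where "g x = lim (\<lambda>n. f (\<phi> n) x)" for x
  have g[measurable]: "g \<in> borel_measurable borel"
    unfolding g_def by (rule borel_measurable_lim_metric) simp
  have AE: "AE x in lborel. (\<lambda>n. f (\<phi> n) x) \<longlonglongrightarrow> g x"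
    using conv by (auto elim!: eventually_mono simp: g_def convergent_LIMSEQ_iff)
  have "(\<lambda>n. \<integral>\<^sup>+x. ennreal ((norm (f n x - g x))\<^sup>2) \<partial>lborel) \<longlonglongrightarrow> 0"
  proof (rule ennreal_tendsto_0I)
    \<comment> \<open>Fatou along the subsequence carries the Cauchy bound for
      \<open>f m - f (\<phi> n)\<close> over to \<open>f m - g\<close>, for every large
      \<open>m\<close>.\<close>
    fix \<epsilon> :: real assume "\<epsilon> > 0"
    then obtain N where N: "\<And>m n. m \<ge> N \<Longrightarrow> n \<ge> N \<Longrightarrow>
        (\<integral>\<^sup>+x. ennreal ((norm (f m x - f n x))\<^sup>2) \<partial>lborel) \<le> ennreal \<epsilon>"
      using cauchy by metis
    have "(\<integral>\<^sup>+x. ennreal ((norm (f m x - g x))\<^sup>2) \<partial>lborel) \<le> ennreal \<epsilon>" if m: "m \<ge> N" for m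
    proof (rule fatou_bound)
      show "(\<lambda>x. ennreal ((norm (f m x - f (\<phi> n) x))\<^sup>2)) \<in> borel_measurable lborel" for n by simp
      show "AE x in lborel. (\<lambda>n. ennreal ((norm (f m x - f (\<phi> n) x))\<^sup>2)) \<longlonglongrightarrow> ennreal ((norm (f m x - g x))\<^sup>2)"
        using AE by (auto elim!: eventually_mono intro!: tendsto_intros)
      show "\<forall>\<^sub>F n in sequentially. (\<integral>\<^sup>+x. ennreal ((norm (f m x - f (\<phi> n) x))\<^sup>2) \<partial>lborel) \<le> ennreal \<epsilon>"
        using N[OF m] seq_suble[OF sm] by (intro eventually_sequentiallyI[of N]) (meson order_trans)
    qed
    then show "\<forall>\<^sub>F n in sequentially. (\<integral>\<^sup>+x. ennreal ((norm (f n x - g x))\<^sup>2) \<partial>lborel) \<le> ennreal \<epsilon>"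
      by (intro eventually_sequentiallyI)
  qed
  then show ?thesis using that[OF sm g AE] by blast
qed


section \<open>Quadratic forms with a radial kernel\<close>

definition qform :: "(real \<Rightarrow> real) \<Rightarrow> ('a::euclidean_space \<Rightarrow> real) \<Rightarrow> ennreal" where
  "qform k u = (\<integral>\<^sup>+x. \<integral>\<^sup>+y. ennreal ((u x - u y)\<^sup>2 * k (norm (x - y))) \<partial>lborel \<partial>lborel)"

text \<open>In this form the kernel weighs the squared L2 norms of \<open>u (x + h) - u x\<close>.
  Anything that acts well on translates, such as mollification or a Lipschitz bound, can be inserted
  for each \<open>h\<close> separately.\<close>

lemma qform_shift:
  fixes u :: "'a::euclidean_space \<Rightarrow> real"
  assumes [measurable]: "u \<in> borel_measurable borel" "k \<in> borel_measurable borel" and k: "\<And>r. k r \<ge> 0"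
  shows "qform k u = (\<integral>\<^sup>+h. ennreal (k (norm h)) * (\<integral>\<^sup>+x. ennreal ((u (x + h) - u x)\<^sup>2) \<partial>lborel) \<partial>lborel)"
proof -
  have "(\<integral>\<^sup>+y. ennreal ((u x - u y)\<^sup>2 * k (norm (x - y))) \<partial>lborel)
      = (\<integral>\<^sup>+h. ennreal (k (norm h)) * ennreal ((u (x + h) - u x)\<^sup>2) \<partial>lborel)" for x
  proof -
    have "(\<integral>\<^sup>+y. ennreal ((u x - u y)\<^sup>2 * k (norm (x - y))) \<partial>lborel)
        = (\<integral>\<^sup>+y. ennreal ((u x - u (y + x))\<^sup>2 * k (norm (x - (y + x)))) \<partial>lborel)"
      by (rule nn_integral_lborel_add[symmetric]) measurable
    also have "\<dots> = (\<integral>\<^sup>+h. ennreal (k (norm h)) * ennreal ((u (x + h) - u x)\<^sup>2) \<partial>lborel)"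
      using k by (intro nn_integral_cong) (simp add: ennreal_mult mult.commute add.commute power2_commute)
    finally show ?thesis .
  qed
  then have "qform k u = (\<integral>\<^sup>+x. \<integral>\<^sup>+h. ennreal (k (norm h)) * ennreal ((u (x + h) - u x)\<^sup>2) \<partial>lborel \<partial>lborel)"
    by (simp add: qform_def)
  also have "\<dots> = (\<integral>\<^sup>+h. \<integral>\<^sup>+x. ennreal (k (norm h)) * ennreal ((u (x + h) - u x)\<^sup>2) \<partial>lborel \<partial>lborel)"
    by (rule lborel_pair.Fubini') measurable
  also have "\<dots> = (\<integral>\<^sup>+h. ennreal (k (norm h)) * (\<integral>\<^sup>+x. ennreal ((u (x + h) - u x)\<^sup>2) \<partial>lborel) \<partial>lborel)"
    by (intro nn_integral_cong nn_integral_cmult) measurable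
  finally show ?thesis .
qed

text \<open>Fatou is applied to the inner and to the outer integral, so a.e. convergence in one
  variable suffices and no null set in the product has to be handled.\<close>

lemma qform_fatou:
  fixes u :: "nat \<Rightarrow> 'a::euclidean_space \<Rightarrow> real"
  assumes [measurable]: "\<And>n. u n \<in> borel_measurable borel" "k \<in> borel_measurable borel"
    and lim: "AE x in lborel. (\<lambda>n. u n x) \<longlonglongrightarrow> v x"
    and bd: "eventually (\<lambda>n. qform k (u n) \<le> B) sequentially"
  shows "qform k v \<le> B"
proof -
  have "(\<integral>\<^sup>+y. ennreal ((v x - v y)\<^sup>2 * k (norm (x - y))) \<partial>lborel)
      \<le> liminf (\<lambda>n. \<integral>\<^sup>+y. ennreal ((u n x - u n y)\<^sup>2 * k (norm (x - y))) \<partial>lborel)"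
    if x: "(\<lambda>n. u n x) \<longlonglongrightarrow> v x" for x
  proof -
    have "(\<integral>\<^sup>+y. ennreal ((v x - v y)\<^sup>2 * k (norm (x - y))) \<partial>lborel)
      = (\<integral>\<^sup>+y. liminf (\<lambda>n. ennreal ((u n x - u n y)\<^sup>2 * k (norm (x - y)))) \<partial>lborel)"
    proof (intro nn_integral_cong_AE)
      show "AE y in lborel. ennreal ((v x - v y)\<^sup>2 * k (norm (x - y)))
          = liminf (\<lambda>n. ennreal ((u n x - u n y)\<^sup>2 * k (norm (x - y))))"
        using lim
      proof eventually_elim
        case (elim y)
        have "(\<lambda>n. ennreal ((u n x - u n y)\<^sup>2 * k (norm (x - y)))) \<longlonglongrightarrow> ennreal ((v x - v y)\<^sup>2 * k (norm (x - y)))"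
          using x elim by (intro tendsto_intros)
        then show ?case by (simp add: lim_imp_Liminf)
      qed
    qed
    also have "\<dots> \<le> liminf (\<lambda>n. \<integral>\<^sup>+y. ennreal ((u n x - u n y)\<^sup>2 * k (norm (x - y))) \<partial>lborel)"
      by (rule nn_integral_liminf) measurable
    finally show ?thesis .
  qed
  then have "qform k v \<le> (\<integral>\<^sup>+x. liminf (\<lambda>n. \<integral>\<^sup>+y. ennreal ((u n x - u n y)\<^sup>2 * k (norm (x - y))) \<partial>lborel) \<partial>lborel)"
    unfolding qform_def using lim by (intro nn_integral_mono_AE) (auto elim!: eventually_mono)
  also have "\<dots> \<le> liminf (\<lambda>n. qform k (u n))"
    unfolding qform_def by (rule nn_integral_liminf) measurable
  also have "\<dots> \<le> limsup (\<lambda>n. qform k (u n))"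
    by (rule Liminf_le_Limsup) simp
  also have "\<dots> \<le> B"
    using bd by (rule Limsup_bounded)
  finally show ?thesis .
qed

lemma qform_cong_AE:
  assumes "AE x in lborel. u x = v x"
  shows "qform k u = qform k v"
proof -
  have "(\<integral>\<^sup>+y. ennreal ((u x - u y)\<^sup>2 * k (norm (x - y))) \<partial>lborel)
      = (\<integral>\<^sup>+y. ennreal ((v x - v y)\<^sup>2 * k (norm (x - y))) \<partial>lborel)" if "u x = v x" for x
    using assms that by (intro nn_integral_cong_AE) (auto elim!: eventually_mono)
  then show ?thesis
    unfolding qform_def using assms by (intro nn_integral_cong_AE) (auto elim!: eventually_mono)
qed

lemma qform_abs_le:
  assumes "\<And>r. k r \<ge> 0"
  shows "qform k (\<lambda>x. \<bar>u x\<bar>) \<le> qform k u"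
  unfolding qform_def
proof (intro nn_integral_mono ennreal_leI mult_right_mono)
  show "(\<bar>u x\<bar> - \<bar>u y\<bar>)\<^sup>2 \<le> (u x - u y)\<^sup>2" for x y
    by (rule abs_le_square_iff[THEN iffD1]) (simp add: abs_triangle_ineq3)
qed (use assms in auto)

lemma qform_cmult:
  assumes [measurable]: "u \<in> borel_measurable borel" "k \<in> borel_measurable borel"
  shows "qform k (\<lambda>x. c * u x) = ennreal (c\<^sup>2) * qform k u"
proof -
  have "ennreal ((c * u x - c * u y)\<^sup>2 * k (norm (x - y))) = ennreal (c\<^sup>2) * ennreal ((u x - u y)\<^sup>2 * k (norm (x - y)))" for x y
    by (subst ennreal_mult'[symmetric]) (auto simp: right_diff_distrib[symmetric] power_mult_distrib mult.assoc)
  then show ?thesis by (simp add: qform_def nn_integral_cmult)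
qed

lemma qform_translate:
  assumes [measurable]: "u \<in> borel_measurable borel" "k \<in> borel_measurable borel"
  shows "qform k (\<lambda>x. u (x + c)) = qform k u"
proof -
  have "(\<integral>\<^sup>+y. ennreal ((u (x + c) - u (y + c))\<^sup>2 * k (norm (x - y))) \<partial>lborel)
      = (\<integral>\<^sup>+y. ennreal ((u (x + c) - u y)\<^sup>2 * k (norm ((x + c) - y))) \<partial>lborel)" for x
    using nn_integral_lborel_add[of "\<lambda>y. ennreal ((u (x + c) - u y)\<^sup>2 * k (norm ((x + c) - y)))" c] by simp
  then show ?thesis
    unfolding qform_def
    using nn_integral_lborel_add[of "\<lambda>x. \<integral>\<^sup>+y. ennreal ((u x - u y)\<^sup>2 * k (norm (x - y))) \<partial>lborel" c] by simp
qed

lemma qform_scale: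
  fixes u :: "'a::euclidean_space \<Rightarrow> real"
  assumes [measurable]: "u \<in> borel_measurable borel" "k \<in> borel_measurable borel" and t: "t > 0"
  shows "qform k (\<lambda>x. u (x /\<^sub>R t)) = ennreal (t ^ (2 * DIM('a))) * qform (\<lambda>r. k (t * r)) u"
proof -
  have "(\<integral>\<^sup>+y. ennreal ((u (x /\<^sub>R t) - u (y /\<^sub>R t))\<^sup>2 * k (norm (x - y))) \<partial>lborel)
      = ennreal (t ^ DIM('a)) * (\<integral>\<^sup>+y. ennreal ((u (x /\<^sub>R t) - u y)\<^sup>2 * k (norm (x - t *\<^sub>R y))) \<partial>lborel)" for x
    using nn_integral_lborel_scale[of "\<lambda>y. ennreal ((u (x /\<^sub>R t) - u (y /\<^sub>R t))\<^sup>2 * k (norm (x - y)))" t] t by simp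
  then have "qform k (\<lambda>x. u (x /\<^sub>R t))
      = ennreal (t ^ DIM('a)) * (\<integral>\<^sup>+x. \<integral>\<^sup>+y. ennreal ((u (x /\<^sub>R t) - u y)\<^sup>2 * k (norm (x - t *\<^sub>R y))) \<partial>lborel \<partial>lborel)"
    by (simp add: qform_def nn_integral_cmult)
  also have "(\<integral>\<^sup>+x. \<integral>\<^sup>+y. ennreal ((u (x /\<^sub>R t) - u y)\<^sup>2 * k (norm (x - t *\<^sub>R y))) \<partial>lborel \<partial>lborel)
      = ennreal (t ^ DIM('a)) * (\<integral>\<^sup>+x. \<integral>\<^sup>+y. ennreal ((u x - u y)\<^sup>2 * k (norm (t *\<^sub>R x - t *\<^sub>R y))) \<partial>lborel \<partial>lborel)"
    using nn_integral_lborel_scale[of "\<lambda>x. \<integral>\<^sup>+y. ennreal ((u (x /\<^sub>R t) - u y)\<^sup>2 * k (norm (x - t *\<^sub>R y))) \<partial>lborel" t] t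
    by simp
  also have "(\<integral>\<^sup>+x. \<integral>\<^sup>+y. ennreal ((u x - u y)\<^sup>2 * k (norm (t *\<^sub>R x - t *\<^sub>R y))) \<partial>lborel \<partial>lborel) = qform (\<lambda>r. k (t * r)) u"
    using t by (simp add: qform_def scaleR_diff_right[symmetric])
  finally show ?thesis
    using t by (simp add: mult.assoc[symmetric] ennreal_mult[symmetric] power_add[symmetric] mult_2)
qed

section \<open>Second moments of linear functions over a ball\<close>

definition moment2 :: "'a::euclidean_space \<Rightarrow> ennreal" where
  "moment2 g = (\<integral>\<^sup>+z. indicator (ball 0 1) z * ennreal ((g \<bullet> z)\<^sup>2) \<partial>lborel)"

lemma moment2_scaleR: "moment2 (c *\<^sub>R g) = ennreal (c\<^sup>2) * moment2 g"
proof -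
  have "indicator (ball 0 1) z * ennreal ((c *\<^sub>R g \<bullet> z)\<^sup>2)
      = ennreal (c\<^sup>2) * (indicator (ball 0 1) z * ennreal ((g \<bullet> z)\<^sup>2))" for z
    by (simp add: power_mult_distrib ennreal_mult ac_simps)
  then have "moment2 (c *\<^sub>R g) = (\<integral>\<^sup>+z. ennreal (c\<^sup>2) * (indicator (ball 0 1) z * ennreal ((g \<bullet> z)\<^sup>2)) \<partial>lborel)"
    unfolding moment2_def by presburger
  also have "\<dots> = ennreal (c\<^sup>2) * moment2 g"
    unfolding moment2_def by (rule nn_integral_cmult) measurable
  finally show ?thesis .
qed

text \<open>The reflection in the hyperplane orthogonal to \<open>e - f\<close> exchanges the two
  unit vectors and preserves both the ball and the measure.\<close>

lemma moment2_unit_eq: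
  fixes e f :: "'a::euclidean_space"
  assumes "norm e = 1" "norm f = 1"
  shows "moment2 e = moment2 f"
proof (cases "e = f")
  case False
  define w where "w = (e - f) /\<^sub>R norm (e - f)"
  have w: "norm w = 1" using False by (simp add: w_def)
  have ee: "e \<bullet> e = 1" "f \<bullet> f = 1" using assms by (auto simp: norm_eq_1)
  have nn: "(norm (e - f))\<^sup>2 = 2 * (1 - e \<bullet> f)"
    unfolding power2_norm_eq_inner by (simp add: inner_diff_left inner_diff_right ee inner_commute)
  have "e \<bullet> (e - f) = (norm (e - f))\<^sup>2 / 2"
    using nn by (simp add: inner_diff_right ee)
  then have ew: "2 * (e \<bullet> w) = norm (e - f)"
    using False by (simp add: w_def power2_eq_square) (simp add: field_simps del: inner_diff_right)
  have "hrefl w 0 e = f"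
    using False by (simp add: hrefl_def ew) (simp add: w_def)
  moreover have "e \<bullet> hrefl w 0 z = hrefl w 0 e \<bullet> z" for z
    by (simp add: hrefl_def inner_diff_left inner_diff_right inner_commute algebra_simps)
  ultimately have *: "e \<bullet> hrefl w 0 z = f \<bullet> z" for z by simp
  have nr: "norm (hrefl w 0 z) = norm z" for z
    using hrefl_dist[OF w, of 0 z 0] by (simp add: hrefl_def)
  have "moment2 e = (\<integral>\<^sup>+z. indicator (ball 0 1) (hrefl w 0 z) * ennreal ((e \<bullet> hrefl w 0 z)\<^sup>2) \<partial>lborel)"
    unfolding moment2_def by (rule nn_integral_hrefl[OF w, symmetric]) measurable
  also have "\<dots> = moment2 f"
    unfolding moment2_def * using nr by (intro nn_integral_cong) (auto simp: indicator_def)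
  finally show ?thesis .
qed simp

text \<open>The constant for which the second moment of \<open>g\<close> equals
  \<open>ballmom * |g|^2\<close>. It is read off from an arbitrary basis vector, since all unit
  vectors give the same value, and depends on nothing but the type.\<close>

definition ballmom :: "'a::euclidean_space itself \<Rightarrow> real" where
  "ballmom _ = enn2real (moment2 (SOME b::'a. b \<in> Basis))"

text \<open>Homogeneity reduces the formula to a unit vector. The constant is positive because a
  vanishing moment in one direction vanishes in all basis directions, and almost every point of the
  unit ball would then be 0.\<close>

lemma moment2_ballmom: "moment2 (g::'a::euclidean_space) = ennreal (ballmom TYPE('a) * (norm g)\<^sup>2)"
  and ballmom_pos: "ballmom TYPE('a::euclidean_space) > 0"
proof -
  define b :: 'a where "b = (SOME b. b \<in> Basis)"
  have bB: "b \<in> Basis" unfolding b_def by (rule someI_ex) (use nonempty_Basis in blast)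
  have b: "norm b = 1" using bB by simp
  have "moment2 b \<le> (\<integral>\<^sup>+z. indicator (ball (0::'a) 1) z \<partial>lborel)"
    unfolding moment2_def
  proof (rule nn_integral_mono)
    fix z :: 'a
    have "(b \<bullet> z)\<^sup>2 \<le> 1" if "norm z < 1"
      using Cauchy_Schwarz_ineq2[of b z] that b by (simp add: abs_square_le_1)
    then show "indicator (ball 0 1) z * ennreal ((b \<bullet> z)\<^sup>2) \<le> indicator (ball 0 1) z"
      by (auto simp: indicator_def)
  qed
  also have "\<dots> < \<infinity>" using emeasure_lborel_ball_finite[of "0::'a" 1] by simp
  finally have fin: "moment2 b = ennreal (ballmom TYPE('a))"
    by (simp add: ballmom_def b_def)
  have "moment2 b \<noteq> 0"
  proof
    assume 0: "moment2 b = 0"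
    have "(\<integral>\<^sup>+z. indicator (ball 0 1) z * ennreal ((i \<bullet> z)\<^sup>2) \<partial>lborel) = 0" if "i \<in> Basis" for i :: 'a
      using moment2_unit_eq[of i b] that 0 b by (simp add: moment2_def)
    then have "AE z in lborel. indicator (ball 0 1) z * ennreal ((i \<bullet> z)\<^sup>2) = 0" if "i \<in> Basis" for i :: 'a
      using that by (subst nn_integral_0_iff_AE[symmetric]) measurable
    then have "AE z in lborel. \<forall>i\<in>(Basis::'a set). indicator (ball 0 1) z * ennreal ((i \<bullet> z)\<^sup>2) = 0"
      by (intro AE_finite_allI) auto
    moreover have "AE z in lborel. z \<noteq> (0::'a)" by (rule AE_lborel_singleton)
    ultimately have "AE z in lborel. z \<notin> ball (0::'a) 1"
    proof eventually_elim
      case (elim z)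
      then show ?case
        by (auto simp: indicator_def inner_commute[of _ z] intro: euclidean_eqI split: if_splits)
    qed
    then have "emeasure lborel (ball (0::'a) 1) = 0"
      by (subst (asm) AE_iff_null_sets[symmetric]) auto
    then show False using content_ball_pos[of 1 "0::'a"] by (simp add: measure_def)
  qed
  then show pos: "ballmom TYPE('a) > 0"
    using fin by (metis ennreal_eq_zero_iff ennreal_neg less_eq_real_def not_less)
  show "moment2 g = ennreal (ballmom TYPE('a) * (norm g)\<^sup>2)"
  proof (cases "g = 0")
    case True then show ?thesis by (simp add: moment2_def)
  next
    case False
    have "moment2 g = moment2 (norm g *\<^sub>R (g /\<^sub>R norm g))" using False by simp
    also have "\<dots> = ennreal ((norm g)\<^sup>2) * moment2 b"
      using moment2_unit_eq[of "g /\<^sub>R norm g" b] False b by (subst moment2_scaleR) auto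
    finally show ?thesis using pos by (simp add: fin ennreal_mult[symmetric] mult.commute)
  qed
qed

text \<open>The power of \<epsilon> collects DIM from the volume element and 2 from the squared
  linear function; its inverse is the normalization in \<open>kloc\<close>.\<close>

lemma moment2_ball:
  fixes g :: "'a::euclidean_space"
  assumes \<epsilon>: "\<epsilon> > 0"
  shows "(\<integral>\<^sup>+h. indicator (ball 0 \<epsilon>) h * ennreal ((g \<bullet> h)\<^sup>2) \<partial>lborel)
       = ennreal (ballmom TYPE('a) * \<epsilon> ^ (DIM('a) + 2) * (norm g)\<^sup>2)"
proof -
  have "(\<integral>\<^sup>+h. indicator (ball 0 \<epsilon>) h * ennreal ((g \<bullet> h)\<^sup>2) \<partial>lborel)
      = ennreal (\<epsilon> ^ DIM('a)) * (\<integral>\<^sup>+h. indicator (ball 0 \<epsilon>) (\<epsilon> *\<^sub>R h) * ennreal ((g \<bullet> (\<epsilon> *\<^sub>R h))\<^sup>2) \<partial>lborel)"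
    by (subst nn_integral_lborel_scale[of _ \<epsilon>], measurable) (use \<epsilon> in auto)
  also have "(\<integral>\<^sup>+h. indicator (ball 0 \<epsilon>) (\<epsilon> *\<^sub>R h) * ennreal ((g \<bullet> (\<epsilon> *\<^sub>R h))\<^sup>2) \<partial>lborel) = moment2 (\<epsilon> *\<^sub>R g)"
    unfolding moment2_def using \<epsilon> by (intro nn_integral_cong) (auto simp: indicator_def)
  finally show ?thesis
    using \<epsilon> ballmom_pos[where 'a='a]
    by (simp add: moment2_ballmom ennreal_mult[symmetric] power_add power2_eq_square ac_simps)
qed

section \<open>Mollification\<close>

lemma distr_lborel_minus: "distr lborel borel (\<lambda>y. c - y) = (lborel :: 'a::euclidean_space measure)"
proof -
  have "lborel = density (distr lborel borel (\<lambda>x. c + (-1) *\<^sub>R x)) (\<lambda>_. ennreal (\<bar>-1\<bar> ^ DIM('a)))"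
    by (rule lborel_affine) simp
  also have "\<dots> = distr lborel borel (\<lambda>y. c - y)" by (simp add: density_1)
  finally show ?thesis by (rule sym)
qed

lemma integral_lborel_minus:
  fixes f :: "'a::euclidean_space \<Rightarrow> 'b::{banach,second_countable_topology}"
  assumes f[measurable]: "f \<in> borel_measurable borel"
  shows "(\<integral>x. f (c - x) \<partial>lborel) = (\<integral>x. f x \<partial>lborel)"
proof -
  have "(\<integral>x. f x \<partial>(distr lborel borel (\<lambda>y. c - y))) = (\<integral>x. f (c - x) \<partial>lborel)" by (rule integral_distr) measurable
  then show ?thesis by (metis distr_lborel_minus)
qed

lemma integrable_lborel_minus:
  fixes f :: "'a::euclidean_space \<Rightarrow> 'b::{banach,second_countable_topology}"
  assumes "integrable lborel f"
  shows "integrable lborel (\<lambda>x. f (c - x))"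
  by (rule integrable_distr[where M'=borel]) (measurable, subst distr_lborel_minus, rule assms)

lemma integral_lborel_add:
  fixes f :: "'a::euclidean_space \<Rightarrow> 'b::{banach,second_countable_topology}"
  assumes [measurable]: "f \<in> borel_measurable borel"
  shows "(\<integral>x. f (x + c) \<partial>lborel) = (\<integral>x. f x \<partial>lborel)"
proof -
  have "(\<integral>x. f x \<partial>lborel) = (\<integral>x. f x \<partial>(distr lborel borel ((+) c)))"
    by (simp add: lborel_distr_plus)
  also have "\<dots> = (\<integral>x. f (x + c) \<partial>lborel)" by (subst integral_distr) (auto simp: add.commute)
  finally show ?thesis by simp
qed

lemma integrable_lborel_add:
  fixes f :: "'a::euclidean_space \<Rightarrow> 'b::{banach,second_countable_topology}"
  assumes "integrable lborel f"
  shows "integrable lborel (\<lambda>x. f (x + c))"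
proof -
  have "integrable lborel (\<lambda>x. f (c + x))"
    by (rule integrable_distr[where M'=borel]) (measurable, subst lborel_distr_plus, rule assms)
  then show ?thesis by (simp add: add.commute)
qed

text \<open>An explicit profile of class C1 with compact support, which is all that
  \<open>Cc1_test\<close> asks for. It is radial and nonincreasing in the norm, so mollification
  respects symmetric decrease, and its Taylor remainder is quadratic with an explicit
  constant.\<close>

definition bump0 :: "'a::euclidean_space \<Rightarrow> real" where
  "bump0 z = (max 0 (1 - (norm z)\<^sup>2))\<^sup>2"

definition bump_mass :: "'a::euclidean_space itself \<Rightarrow> real" where
  "bump_mass _ = (\<integral>z. bump0 (z::'a) \<partial>lborel)"

lemma bump0_measurable[measurable]: "bump0 \<in> borel_measurable borel"
  unfolding bump0_def by measurable

lemma bump0_nonneg: "bump0 z \<ge> 0" by (simp add: bump0_def)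

lemma bump0_le_1: "bump0 z \<le> 1"
  unfolding bump0_def by (intro power_le_one) auto

lemma bump0_zero: "norm z \<ge> 1 \<Longrightarrow> bump0 z = 0"
proof -
  assume "norm z \<ge> 1"
  then have "1 - (norm z)\<^sup>2 \<le> 0" using one_le_power[of "norm z" 2] by simp
  then show ?thesis unfolding bump0_def by (subst max_absorb1) auto
qed

lemma bump0_antimono: "norm z \<le> norm z' \<Longrightarrow> bump0 z' \<le> bump0 z"
  unfolding bump0_def by (intro power_mono max.mono) (auto intro!: power_mono)

lemma integrable_bump0: "integrable lborel (bump0 :: 'a::euclidean_space \<Rightarrow> real)"
proof (rule Bochner_Integration.integrable_bound)
  show "integrable lborel (indicator (ball (0::'a) 1) :: 'a \<Rightarrow> real)"
    using emeasure_lborel_ball_finite[of "0::'a" 1] by (intro integrable_real_indicator) auto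
  show "AE z in lborel. norm (bump0 (z::'a)) \<le> norm (indicator (ball (0::'a) 1) z :: real)"
  proof (rule always_eventually, rule allI)
    show "norm (bump0 z) \<le> norm (indicator (ball (0::'a) 1) z :: real)" for z :: 'a
      using bump0_le_1[of z] bump0_zero[of z] bump0_nonneg[of z] by (auto simp: indicator_def)
  qed
qed measurable

lemma bump_mass_pos: "bump_mass TYPE('a::euclidean_space) > 0"
proof -
  have "bump_mass TYPE('a) \<ge> 0"
    unfolding bump_mass_def by (intro integral_nonneg_AE) (auto simp: bump0_nonneg)
  moreover have "bump_mass TYPE('a) \<noteq> 0"
  proof
    assume "bump_mass TYPE('a) = 0"
    then have "AE z in lborel. bump0 (z::'a) = 0"
      unfolding bump_mass_def
      by (subst (asm) integral_nonneg_eq_0_iff_AE) (auto simp: bump0_nonneg integrable_bump0)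
    then have "AE z in lborel. z \<notin> ball (0::'a) 1"
    proof eventually_elim
      case (elim z)
      have "bump0 z > 0" if "norm z < 1"
        using that unfolding bump0_def by (intro zero_less_power) (simp add: power_less_one_iff abs_square_less_1 less_max_iff_disj)
      then show ?case using elim by auto
    qed
    then have "emeasure lborel (ball (0::'a) 1) = 0"
      by (subst (asm) AE_iff_null_sets[symmetric]) auto
    then show False using content_ball_pos[of 1 "0::'a"] by (simp add: measure_def)
  qed
  ultimately show ?thesis by simp
qed

text \<open>The squared positive part has derivative \<open>2 * max 0 t\<close>, which is Lipschitz
  with constant 2, so the remainder is at most \<open>s^2\<close>. The cases treat the kink at 0
  directly.\<close>

lemma pos_part_sq_taylor:
  fixes t s :: real
  shows "\<bar>(max 0 (t + s))\<^sup>2 - (max 0 t)\<^sup>2 - 2 * max 0 t * s\<bar> \<le> s\<^sup>2"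
proof (cases "t \<ge> 0")
  case t: True
  show ?thesis
  proof (cases "t + s \<ge> 0")
    case True
    then show ?thesis using t by (simp add: power2_eq_square algebra_simps)
  next
    case False
    have "0 \<le> t * (- t - 2 * s)" using t False by (intro mult_nonneg_nonneg) auto
    moreover have "0 \<le> (s + t)\<^sup>2" by simp
    ultimately show ?thesis using t False by (simp add: power2_eq_square algebra_simps max_def)
  qed
next
  case t: False
  show ?thesis
  proof (cases "t + s \<ge> 0")
    case True
    then have "(t + s)\<^sup>2 \<le> s\<^sup>2" using t by (intro power_mono) auto
    then show ?thesis using t True by (simp add: max_def)
  qed (use t in \<open>simp add: max_def\<close>)
qed

text \<open>For norm z \<le> 2 and norm h \<le> 1 the increment \<open>s\<close> of 1 - |z|^2 is at
  most 5 |h|, which contributes 25; the second-order part of \<open>s\<close>, multiplied by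
  \<open>2 * max 0 t\<close>, contributes the other 2. For larger \<open>z\<close> every term
  vanishes.\<close>

lemma bump0_taylor:
  assumes h: "norm h \<le> 1"
  shows "\<bar>bump0 (z + h) - bump0 z - (- 4 * max 0 (1 - (norm z)\<^sup>2)) * (z \<bullet> h)\<bar> \<le> 27 * (norm h)\<^sup>2"
proof (cases "norm z \<le> 2")
  case True
  define t where "t = 1 - (norm z)\<^sup>2"
  define s where "s = - (2 * (z \<bullet> h) + (norm h)\<^sup>2)"
  have "(norm (z + h))\<^sup>2 = (norm z)\<^sup>2 + 2 * (z \<bullet> h) + (norm h)\<^sup>2"
    unfolding power2_norm_eq_inner by (simp add: inner_add_left inner_add_right inner_commute)
  then have ts: "1 - (norm (z + h))\<^sup>2 = t + s" by (simp add: t_def s_def)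
  have *: "\<bar>bump0 (z + h) - bump0 z - 2 * max 0 t * s\<bar> \<le> s\<^sup>2"
    unfolding bump0_def ts t_def[symmetric] by (rule pos_part_sq_taylor)
  have "\<bar>z \<bullet> h\<bar> \<le> 2 * norm h"
    using order_trans[OF Cauchy_Schwarz_ineq2[of z h] mult_right_mono[OF True norm_ge_zero]] .
  moreover have "(norm h)\<^sup>2 \<le> norm h" using h by (simp add: power2_eq_square mult_left_le)
  ultimately have "\<bar>s\<bar> \<le> 5 * norm h" unfolding s_def using zero_le_power2[of "norm h"] by linarith
  then have s2: "s\<^sup>2 \<le> 25 * (norm h)\<^sup>2"
    using power_mono[of "\<bar>s\<bar>" "5 * norm h" 2] by (simp add: power_mult_distrib)
  have "max 0 t \<le> 1" by (simp add: t_def)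
  then have "max 0 t * (norm h)\<^sup>2 \<le> (norm h)\<^sup>2" "0 \<le> max 0 t * (norm h)\<^sup>2"
    by (auto intro!: mult_left_le_one_le)
  moreover have "2 * max 0 t * s = (- 4 * max 0 t) * (z \<bullet> h) - 2 * (max 0 t * (norm h)\<^sup>2)"
    by (simp add: s_def algebra_simps)
  ultimately show ?thesis using * s2 unfolding t_def[symmetric] by linarith
next
  case False
  then have "norm (z + h) \<ge> 1" using h norm_diff_ineq[of z h] by linarith
  moreover have "max 0 (1 - (norm z)\<^sup>2) = 0"
    using False one_le_power[of "norm z" 2] by (intro max_absorb1) simp
  ultimately show ?thesis using False by (simp add: bump0_zero)
qed

section \<open>The scaled mollifier and its gradient\<close>

definition moll :: "real \<Rightarrow> 'a::euclidean_space \<Rightarrow> real" where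
  "moll \<delta> z = bump0 (z /\<^sub>R \<delta>) / (bump_mass TYPE('a) * \<delta> ^ DIM('a))"

text \<open>The gradient of \<open>moll \<delta>\<close>. The additional factor \<delta> in the
  denominator is the inner derivative of the rescaling.\<close>

definition mollg :: "real \<Rightarrow> 'a::euclidean_space \<Rightarrow> 'a" where
  "mollg \<delta> z = (- 4 * max 0 (1 - (norm (z /\<^sub>R \<delta>))\<^sup>2) / (bump_mass TYPE('a) * \<delta> ^ DIM('a) * \<delta>)) *\<^sub>R (z /\<^sub>R \<delta>)"

lemma moll_measurable[measurable]: "moll \<delta> \<in> borel_measurable borel"
  unfolding moll_def by measurable

lemma continuous_mollg: "continuous_on UNIV (mollg \<delta>)"
  unfolding mollg_def divide_inverse by (intro continuous_intros)

lemma mollg_measurable[measurable]: "mollg \<delta> \<in> borel_measurable borel"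
  by (intro borel_measurable_continuous_onI continuous_mollg)

lemma moll_minus: "moll \<delta> (- z) = moll \<delta> z" by (simp add: moll_def bump0_def)

context
  fixes \<delta> :: real assumes \<delta>: "\<delta> > 0"
begin

lemma moll_nonneg: "moll \<delta> (z::'a::euclidean_space) \<ge> 0"
  using \<delta> bump_mass_pos[where 'a='a] by (simp add: moll_def bump0_nonneg)

lemma moll_le: "moll \<delta> (z::'a::euclidean_space) \<le> 1 / (bump_mass TYPE('a) * \<delta> ^ DIM('a))"
  using \<delta> bump_mass_pos[where 'a='a] unfolding moll_def by (intro divide_right_mono bump0_le_1) auto

lemma moll_zero: "norm z \<ge> \<delta> \<Longrightarrow> moll \<delta> z = 0"
  using \<delta> by (simp add: moll_def bump0_zero field_simps)

lemma mollg_zero: "norm z \<ge> \<delta> \<Longrightarrow> mollg \<delta> z = 0"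
proof -
  assume "norm z \<ge> \<delta>"
  then have "1 \<le> norm (z /\<^sub>R \<delta>)" using \<delta> by (simp add: field_simps)
  then have "1 - (norm (z /\<^sub>R \<delta>))\<^sup>2 \<le> 0" using one_le_power[of "norm (z /\<^sub>R \<delta>)" 2] by linarith
  then show ?thesis unfolding mollg_def by (subst max_absorb1) auto
qed

lemma moll_antimono:
  fixes z z' :: "'a::euclidean_space"
  shows "norm z \<le> norm z' \<Longrightarrow> moll \<delta> z' \<le> moll \<delta> z"
  using \<delta> bump_mass_pos[where 'a='a] unfolding moll_def
  by (intro divide_right_mono bump0_antimono) (auto simp: mult_left_mono)

lemma nn_integral_moll: "(\<integral>\<^sup>+y. ennreal (moll \<delta> (x - y)) \<partial>lborel) = 1" for x :: "'a::euclidean_space"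
proof -
  define M where "M = bump_mass TYPE('a)"
  have M: "M > 0" using bump_mass_pos[where 'a='a] by (simp add: M_def)
  have "(\<integral>\<^sup>+y. ennreal (moll \<delta> (x - y)) \<partial>lborel) = (\<integral>\<^sup>+y. ennreal (moll \<delta> (y::'a)) \<partial>lborel)"
    by (rule nn_integral_lborel_minus[of "\<lambda>y. ennreal (moll \<delta> y)"]) measurable
  also have "\<dots> = ennreal (\<delta> ^ DIM('a)) * (\<integral>\<^sup>+y. ennreal (moll \<delta> (\<delta> *\<^sub>R y :: 'a)) \<partial>lborel)"
    by (subst nn_integral_lborel_scale[of _ \<delta>], measurable) (use \<delta> in auto)
  also have "(\<integral>\<^sup>+y. ennreal (moll \<delta> (\<delta> *\<^sub>R y :: 'a)) \<partial>lborel) = (\<integral>\<^sup>+y. ennreal (1 / (M * \<delta> ^ DIM('a))) * ennreal (bump0 (y::'a)) \<partial>lborel)"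
    using \<delta> M by (intro nn_integral_cong) (simp add: moll_def ennreal_mult[symmetric] bump0_nonneg M_def)
  also have "\<dots> = ennreal (1 / (M * \<delta> ^ DIM('a))) * ennreal M"
    by (simp add: nn_integral_cmult nn_integral_eq_integral integrable_bump0 bump0_nonneg M_def bump_mass_def)
  finally show ?thesis using \<delta> M by (simp add: ennreal_mult[symmetric])
qed

lemma moll_taylor:
  fixes z h :: "'a::euclidean_space"
  assumes h: "norm h \<le> \<delta>"
  shows "\<bar>moll \<delta> (z + h) - moll \<delta> z - mollg \<delta> z \<bullet> h\<bar> \<le> 27 / (bump_mass TYPE('a) * \<delta> ^ DIM('a) * \<delta>\<^sup>2) * (norm h)\<^sup>2"
proof -
  define c where "c = bump_mass TYPE('a) * \<delta> ^ DIM('a)"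
  have c: "c > 0" using bump_mass_pos[where 'a='a] \<delta> by (simp add: c_def)
  define z' where "z' = z /\<^sub>R \<delta>"
  define h' where "h' = h /\<^sub>R \<delta>"
  have h': "norm h' \<le> 1" using h \<delta> by (simp add: h'_def field_simps)
  have "mollg \<delta> z \<bullet> h = (- 4 * max 0 (1 - (norm z')\<^sup>2)) * (z' \<bullet> h') / c"
    using \<delta> by (simp add: mollg_def z'_def h'_def c_def field_simps)
  then have "moll \<delta> (z + h) - moll \<delta> z - mollg \<delta> z \<bullet> h
     = (bump0 (z' + h') - bump0 z' - (- 4 * max 0 (1 - (norm z')\<^sup>2)) * (z' \<bullet> h')) / c"
    unfolding moll_def c_def[symmetric] z'_def[symmetric] scaleR_add_right h'_def[symmetric]
    by (simp add: diff_divide_distrib add_divide_distrib)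
  then have "\<bar>moll \<delta> (z + h) - moll \<delta> z - mollg \<delta> z \<bullet> h\<bar> \<le> 27 * (norm h')\<^sup>2 / c"
    using bump0_taylor[OF h', of z'] c by (simp add: divide_right_mono)
  moreover have "27 * (norm h')\<^sup>2 / c = 27 / (c * \<delta>\<^sup>2) * (norm h)\<^sup>2"
    using \<delta> c by (simp add: h'_def power2_eq_square field_simps)
  ultimately show ?thesis by (simp add: c_def)
qed

lemma mollg_bound: "norm (mollg \<delta> (z::'a::euclidean_space)) \<le> 4 / (bump_mass TYPE('a) * \<delta> ^ DIM('a) * \<delta>)"
proof (cases "norm z \<ge> \<delta>")
  case True
  then show ?thesis using \<delta> bump_mass_pos[where 'a='a] by (simp add: mollg_zero)
next
  case False
  define c where "c = bump_mass TYPE('a) * \<delta> ^ DIM('a) * \<delta>"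
  have c: "c > 0" using bump_mass_pos[where 'a='a] \<delta> by (simp add: c_def)
  have 1: "norm (z /\<^sub>R \<delta>) \<le> 1" using False \<delta> by (simp add: field_simps)
  have 2: "\<bar>max 0 (1 - (norm (z /\<^sub>R \<delta>))\<^sup>2)\<bar> \<le> 1" by auto
  have "norm (mollg \<delta> z) = (4 / c) * (\<bar>max 0 (1 - (norm (z /\<^sub>R \<delta>))\<^sup>2)\<bar> * norm (z /\<^sub>R \<delta>))"
    using c by (simp add: mollg_def c_def[symmetric] abs_mult)
  also have "\<dots> \<le> (4 / c) * (1 * 1)"
    using c by (intro mult_left_mono mult_mono 1 2) auto
  finally show ?thesis by (simp add: c_def)
qed

end

lemma has_derivative_quadratic:
  fixes f :: "'a::euclidean_space \<Rightarrow> real"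
  assumes r: "r > 0" and *: "\<And>h. norm h \<le> r \<Longrightarrow> \<bar>f (x + h) - f x - g \<bullet> h\<bar> \<le> L * (norm h)\<^sup>2"
  shows "(f has_derivative (\<lambda>h. g \<bullet> h)) (at x)"
  unfolding has_derivative_at_alt
proof (intro conjI allI impI)
  show "bounded_linear ((\<bullet>) g)" by (rule bounded_linear_inner_right)
  fix e :: real assume e: "e > 0"
  define d where "d = min r (e / (\<bar>L\<bar> + 1))"
  have "d > 0" using e r by (simp add: d_def)
  moreover have "norm (f y - f x - g \<bullet> (y - x)) \<le> e * norm (y - x)" if y: "norm (y - x) < d" for y
  proof -
    have "norm (f y - f x - g \<bullet> (y - x)) \<le> L * (norm (y - x))\<^sup>2"
      using *[of "y - x"] y by (simp add: d_def)
    also have "\<dots> \<le> ((\<bar>L\<bar> + 1) * norm (y - x)) * norm (y - x)"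
      by (simp add: power2_eq_square mult.assoc[symmetric] mult_right_mono)
    also have "\<dots> \<le> e * norm (y - x)"
      using y by (intro mult_right_mono) (auto simp: d_def field_simps)
    finally show ?thesis .
  qed
  ultimately show "\<exists>d>0. \<forall>y. norm (y - x) < d \<longrightarrow> norm (f y - f x - g \<bullet> (y - x)) \<le> e * norm (y - x)"
    by blast
qed

lemma moll_has_derivative:
  "\<delta> > 0 \<Longrightarrow> (moll \<delta> has_derivative (\<lambda>h. mollg \<delta> z \<bullet> h)) (at z)"
  by (rule has_derivative_quadratic[where r=\<delta>]) (auto intro: moll_taylor)

text \<open>Testing a weak gradient against this function of \<open>y\<close> identifies the
  gradient of a mollification with the mollification of the weak gradient. The minus sign is the
  inner derivative of \<open>x - y\<close>.\<close>

lemma Cc1_test_moll: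
  assumes \<delta>: "\<delta> > 0"
  shows "Cc1_test (\<lambda>y. moll \<delta> (x - y)) (\<lambda>y. - mollg \<delta> (x - y))"
  unfolding Cc1_test_def
proof (intro conjI allI)
  fix y
  show "((\<lambda>y. moll \<delta> (x - y)) has_derivative (\<lambda>h. (- mollg \<delta> (x - y)) \<bullet> h)) (at y)"
  proof -
    have "((\<lambda>y. x - y) has_derivative (\<lambda>h. - h)) (at y)" by (auto intro!: derivative_eq_intros)
    from has_derivative_compose[OF this moll_has_derivative[OF \<delta>, of "x - y"]]
    show ?thesis by simp
  qed
  show "continuous_on UNIV (\<lambda>y. - mollg \<delta> (x - y))"
    by (intro continuous_intros continuous_on_compose2[OF continuous_mollg]) auto
  have "{y. moll \<delta> (x - y) \<noteq> 0} \<subseteq> cball x \<delta>"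
  proof
    fix y assume "y \<in> {y. moll \<delta> (x - y) \<noteq> 0}"
    then show "y \<in> cball x \<delta>" using moll_zero[OF \<delta>, of "x - y"] by (force simp: dist_norm)
  qed
  then have "bounded {y. moll \<delta> (x - y) \<noteq> 0}" using bounded_subset bounded_cball by blast
  then show "compact (closure {y. moll \<delta> (x - y) \<noteq> 0})" by (simp add: compact_closure)
qed

section \<open>Convolution with the mollifier\<close>

definition mconv :: "real \<Rightarrow> ('a::euclidean_space \<Rightarrow> real) \<Rightarrow> 'a \<Rightarrow> real" where
  "mconv \<delta> u x = (\<integral>y. moll \<delta> (x - y) * u y \<partial>lborel)"

definition mconvg :: "real \<Rightarrow> ('a::euclidean_space \<Rightarrow> real) \<Rightarrow> 'a \<Rightarrow> 'a" where
  "mconvg \<delta> u x = (\<integral>y. u y *\<^sub>R mollg \<delta> (x - y) \<partial>lborel)"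

lemma mconv_measurable[measurable]:
  assumes [measurable]: "u \<in> borel_measurable borel"
  shows "mconv \<delta> u \<in> borel_measurable borel"
  unfolding mconv_def by measurable

lemma mconvg_measurable[measurable]:
  assumes [measurable]: "u \<in> borel_measurable borel"
  shows "mconvg \<delta> u \<in> borel_measurable borel"
  unfolding mconvg_def by measurable

context
  fixes \<delta> :: real and u :: "'a::euclidean_space \<Rightarrow> real"
  assumes \<delta>: "\<delta> > 0" and u: "integrable lborel u"
begin

lemma integrable_moll_mult: "integrable lborel (\<lambda>y. moll \<delta> (x - y) * u y)"
proof (rule Bochner_Integration.integrable_bound)
  show "integrable lborel (\<lambda>y. (1 / (bump_mass TYPE('a) * \<delta> ^ DIM('a))) * u y)" using u by simp
  show "(\<lambda>y. moll \<delta> (x - y) * u y) \<in> borel_measurable lborel"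
    using borel_measurable_integrable[OF u] by simp
  have "norm (moll \<delta> (x - y) * u y) \<le> norm ((1 / (bump_mass TYPE('a) * \<delta> ^ DIM('a))) * u y)" for y
    unfolding norm_mult using moll_le[OF \<delta>, of "x - y"] moll_nonneg[OF \<delta>, of "x - y"]
    by (intro mult_right_mono) (auto simp del: abs_divide)
  then show "AE y in lborel. norm (moll \<delta> (x - y) * u y) \<le> norm ((1 / (bump_mass TYPE('a) * \<delta> ^ DIM('a))) * u y)"
    by simp
qed

lemma integrable_mollg_mult: "integrable lborel (\<lambda>y. u y *\<^sub>R mollg \<delta> (x - y))"
proof (rule Bochner_Integration.integrable_bound)
  show "integrable lborel (\<lambda>y. (4 / (bump_mass TYPE('a) * \<delta> ^ DIM('a) * \<delta>)) * u y)" using u by simp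
  show "(\<lambda>y. u y *\<^sub>R mollg \<delta> (x - y)) \<in> borel_measurable lborel"
    using borel_measurable_integrable[OF u] by simp
  have "norm (u y *\<^sub>R mollg \<delta> (x - y)) \<le> norm ((4 / (bump_mass TYPE('a) * \<delta> ^ DIM('a) * \<delta>)) * u y)" for y
    unfolding norm_scaleR norm_mult
    using mollg_bound[OF \<delta>, of "x - y"] \<delta> bump_mass_pos[where 'a='a]
    by (subst mult.commute, intro mult_mono) auto
  then show "AE y in lborel. norm (u y *\<^sub>R mollg \<delta> (x - y)) \<le> norm ((4 / (bump_mass TYPE('a) * \<delta> ^ DIM('a) * \<delta>)) * u y)"
    by simp
qed

text \<open>The quadratic remainder of the mollifier is uniform in the point, so it can be
  integrated against \<bar>u\<bar>. Differentiability of the convolution follows with no regularity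
  of \<open>u\<close> beyond integrability.\<close>

lemma mconv_taylor:
  assumes h: "norm h \<le> \<delta>"
  shows "\<bar>mconv \<delta> u (x + h) - mconv \<delta> u x - mconvg \<delta> u x \<bullet> h\<bar>
    \<le> (27 / (bump_mass TYPE('a) * \<delta> ^ DIM('a) * \<delta>\<^sup>2) * (\<integral>y. \<bar>u y\<bar> \<partial>lborel)) * (norm h)\<^sup>2"
proof -
  define L where "L = 27 / (bump_mass TYPE('a) * \<delta> ^ DIM('a) * \<delta>\<^sup>2)"
  define F where "F y = moll \<delta> ((x - y) + h) * u y - moll \<delta> (x - y) * u y - (u y *\<^sub>R mollg \<delta> (x - y)) \<bullet> h" for y
  have 1: "integrable lborel (\<lambda>y. moll \<delta> ((x - y) + h) * u y)"
    using integrable_moll_mult[of "x + h"] by (simp add: algebra_simps)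
  have F: "integrable lborel F"
    unfolding F_def using 1 integrable_moll_mult[of x] integrable_mollg_mult[of x]
    by (intro Bochner_Integration.integrable_diff integrable_inner_left)
  have "mconv \<delta> u (x + h) - mconv \<delta> u x - mconvg \<delta> u x \<bullet> h = (\<integral>y. F y \<partial>lborel)"
    unfolding F_def mconv_def mconvg_def
    using 1 integrable_moll_mult[of x] integrable_mollg_mult[of x]
    by (simp add: integral_inner_left[symmetric] algebra_simps del: inner_scaleR_left integral_inner_left)
  also have "\<bar>\<dots>\<bar> \<le> (\<integral>y. (L * (norm h)\<^sup>2) * \<bar>u y\<bar> \<partial>lborel)"
    unfolding real_norm_def[symmetric]
  proof (rule Bochner_Integration.integral_norm_bound_integral[OF F])
    show "integrable lborel (\<lambda>y. (L * (norm h)\<^sup>2) * norm (u y))" using u by simp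
    fix y
    have "F y = (moll \<delta> ((x - y) + h) - moll \<delta> (x - y) - mollg \<delta> (x - y) \<bullet> h) * u y"
      by (simp add: F_def algebra_simps)
    then show "norm (F y) \<le> L * (norm h)\<^sup>2 * norm (u y)"
      using moll_taylor[OF \<delta> h, of "x - y"] unfolding L_def[symmetric] by (simp add: abs_mult mult_right_mono)
  qed
  finally show ?thesis by (simp add: L_def mult_ac)
qed

lemma mconv_has_derivative: "(mconv \<delta> u has_derivative (\<lambda>h. mconvg \<delta> u x \<bullet> h)) (at x)"
  by (rule has_derivative_quadratic[OF \<delta>]) (rule mconv_taylor)

lemma continuous_mconvg: "continuous_on UNIV (mconvg \<delta> u)"
  unfolding continuous_on_sequentially
proof (intro ballI allI impI, elim conjE)
  fix X and x :: 'a assume X: "X \<longlonglongrightarrow> x"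
  have "(\<lambda>n. \<integral>y. u y *\<^sub>R mollg \<delta> (X n - y) \<partial>lborel) \<longlonglongrightarrow> (\<integral>y. u y *\<^sub>R mollg \<delta> (x - y) \<partial>lborel)"
  proof (rule integral_dominated_convergence)
    show "integrable lborel (\<lambda>y. (4 / (bump_mass TYPE('a) * \<delta> ^ DIM('a) * \<delta>)) * \<bar>u y\<bar>)" using u by simp
    show "(\<lambda>y. u y *\<^sub>R mollg \<delta> (x - y)) \<in> borel_measurable lborel"
      "(\<lambda>y. u y *\<^sub>R mollg \<delta> (X n - y)) \<in> borel_measurable lborel" for n
      using borel_measurable_integrable[OF u] by simp_all
    have "(\<lambda>n. mollg \<delta> (X n - y)) \<longlonglongrightarrow> mollg \<delta> (x - y)" for y
      using X continuous_mollg[of \<delta>]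
      by (intro isCont_tendsto_compose[of _ "mollg \<delta>"]) (auto intro!: tendsto_intros simp: continuous_on_eq_continuous_at)
    then show "AE y in lborel. (\<lambda>n. u y *\<^sub>R mollg \<delta> (X n - y)) \<longlonglongrightarrow> u y *\<^sub>R mollg \<delta> (x - y)"
      by (auto intro!: tendsto_intros)
    have "norm (u y *\<^sub>R mollg \<delta> (X n - y)) \<le> (4 / (bump_mass TYPE('a) * \<delta> ^ DIM('a) * \<delta>)) * \<bar>u y\<bar>" for n y
      unfolding norm_scaleR
      using mollg_bound[OF \<delta>, of "X n - y"] by (subst mult.commute, intro mult_right_mono) auto
    then show "AE y in lborel. norm (u y *\<^sub>R mollg \<delta> (X n - y)) \<le> (4 / (bump_mass TYPE('a) * \<delta> ^ DIM('a) * \<delta>)) * \<bar>u y\<bar>" for n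
      by simp
  qed
  then show "(mconvg \<delta> u \<circ> X) \<longlonglongrightarrow> mconvg \<delta> u x"
    by (simp add: mconvg_def comp_def)
qed

text \<open>Convolution commutes with translation, so the difference on the left is an average of
  translated differences of \<open>u\<close>. Jensen bounds its square, and translation invariance
  removes the averaging. Consequently mollification does not increase \<open>locq\<close>.\<close>

lemma nn_integral_mconv_shift:
  "(\<integral>\<^sup>+x. ennreal ((mconv \<delta> u (x + h) - mconv \<delta> u x)\<^sup>2) \<partial>lborel) \<le> (\<integral>\<^sup>+x. ennreal ((u (x + h) - u x)\<^sup>2) \<partial>lborel)"
proof -
  have [measurable]: "u \<in> borel_measurable borel" using borel_measurable_integrable[OF u] by simp
  have *: "mconv \<delta> u x = (\<integral>z. moll \<delta> z * u (x - z) \<partial>lborel)" for x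
    using integral_lborel_minus[of "\<lambda>z. moll \<delta> (x - z) * u z" x] by (simp add: mconv_def)
  have i: "integrable lborel (\<lambda>z. moll \<delta> z * u (x - z))" for x
    using integrable_lborel_minus[OF integrable_moll_mult[of x], of x] by simp
  have "ennreal ((mconv \<delta> u (x + h) - mconv \<delta> u x)\<^sup>2)
      \<le> (\<integral>\<^sup>+z. ennreal (moll \<delta> z) * ennreal ((u (x - z + h) - u (x - z))\<^sup>2) \<partial>lborel)" for x
  proof -
    have "mconv \<delta> u (x + h) - mconv \<delta> u x = (\<integral>z. moll \<delta> z * (u (x - z + h) - u (x - z)) \<partial>lborel)"
      using i[of "x + h"] i[of x] by (simp add: * right_diff_distrib algebra_simps)
    then have "ennreal ((mconv \<delta> u (x + h) - mconv \<delta> u x)\<^sup>2)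
        = ennreal ((0 - (\<integral>z. moll \<delta> z * (u (x - z + h) - u (x - z)) \<partial>lborel))\<^sup>2)" by simp
    also have "\<dots> \<le> (\<integral>\<^sup>+z. ennreal (moll \<delta> z * (0 - (u (x - z + h) - u (x - z)))\<^sup>2) \<partial>lborel)"
      using nn_integral_moll[OF \<delta>, of 0] by (intro jensen_sq) (auto simp: moll_nonneg[OF \<delta>] moll_minus)
    finally show ?thesis by (simp add: ennreal_mult moll_nonneg[OF \<delta>] power2_commute)
  qed
  then have "(\<integral>\<^sup>+x. ennreal ((mconv \<delta> u (x + h) - mconv \<delta> u x)\<^sup>2) \<partial>lborel)
     \<le> (\<integral>\<^sup>+x. \<integral>\<^sup>+z. ennreal (moll \<delta> z) * ennreal ((u (x - z + h) - u (x - z))\<^sup>2) \<partial>lborel \<partial>lborel)"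
    by (intro nn_integral_mono)
  also have "\<dots> = (\<integral>\<^sup>+z. \<integral>\<^sup>+x. ennreal (moll \<delta> z) * ennreal ((u (x - z + h) - u (x - z))\<^sup>2) \<partial>lborel \<partial>lborel)"
    by (rule lborel_pair.Fubini') measurable
  also have "\<dots> = (\<integral>\<^sup>+z. ennreal (moll \<delta> (z::'a)) * (\<integral>\<^sup>+x. ennreal ((u (x + h) - u x)\<^sup>2) \<partial>lborel) \<partial>lborel)"
  proof (rule nn_integral_cong)
    fix z :: 'a
    show "(\<integral>\<^sup>+x. ennreal (moll \<delta> z) * ennreal ((u (x - z + h) - u (x - z))\<^sup>2) \<partial>lborel)
       = ennreal (moll \<delta> z) * (\<integral>\<^sup>+x. ennreal ((u (x + h) - u x)\<^sup>2) \<partial>lborel)"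
      using nn_integral_lborel_add[of "\<lambda>x. ennreal ((u (x + h) - u x)\<^sup>2)" "- z"]
      by (subst nn_integral_cmult) auto
  qed
  also have "\<dots> = (\<integral>\<^sup>+x. ennreal ((u (x + h) - u x)\<^sup>2) \<partial>lborel)"
    using nn_integral_moll[OF \<delta>, of "0::'a"] by (simp add: nn_integral_multc moll_minus)
  finally show ?thesis .
qed

end

text \<open>The squared Gagliardo seminorm as a form. At \<open>r = 0\<close> the division gives the
  default value 0, which does no harm, since the factor \<open>(u x - u y)^2\<close> is then 0 as
  well.\<close>

definition gagl :: "real \<Rightarrow> ('a::euclidean_space \<Rightarrow> real) \<Rightarrow> ennreal" where
  "gagl s u = qform (\<lambda>r. 1 / r powr (real DIM('a) + 2 * s)) u"

text \<open>The freedom to choose \<open>q\<close> covers both averages around \<open>x\<close> itself and averages around finitely many centres.\<close>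
lemma mconv_poincare:
  fixes u :: "'a::euclidean_space \<Rightarrow> real"
  assumes \<delta>: "\<delta> > 0" and s: "s > 0"
    and [measurable]: "u \<in> borel_measurable borel" "q \<in> borel_measurable borel"
    and q: "\<And>x. x \<in> S \<Longrightarrow> norm (q x - x) \<le> \<delta>"
  shows "(\<integral>\<^sup>+x. indicator S x * ennreal ((u x - mconv \<delta> u (q x))\<^sup>2) \<partial>lborel)
     \<le> ennreal (2 powr (real DIM('a) + 2 * s) / bump_mass TYPE('a) * \<delta> powr (2 * s)) * gagl s u"
proof -
  define p where "p = real DIM('a) + 2 * s"
  have p: "p > 0" using s by (simp add: p_def add_nonneg_pos)
  define M where "M = bump_mass TYPE('a)"
  have M: "M > 0" using bump_mass_pos[where 'a='a] by (simp add: M_def)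
  \<comment> \<open>Where the weight is nonzero, \<open>y\<close> is within 2 \<delta> of
    \<open>x\<close>, so the bound 1 / (M \<delta>^n) for the mollifier is at most \<open>A\<close>
    times the Gagliardo kernel. The powers of \<delta> combine to \<delta>^(2 s), which is the rate
    of approximation.\<close>
  define A where "A = (2 * \<delta>) powr p / (M * \<delta> ^ DIM('a))"
  have A0: "A \<ge> 0" using M \<delta> by (simp add: A_def)
  have A: "A = 2 powr p / M * \<delta> powr (2 * s)"
  proof -
    have "(2 * \<delta>) powr p = 2 powr p * \<delta> powr p" using \<delta> by (simp add: powr_mult)
    also have "\<delta> powr p = \<delta> ^ DIM('a) * \<delta> powr (2 * s)"
      using \<delta> by (simp add: p_def powr_add powr_realpow)
    finally show ?thesis using \<delta> M by (simp add: A_def)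
  qed
  have key: "moll \<delta> (q x - y) * (u x - u y)\<^sup>2 \<le> A * ((u x - u y)\<^sup>2 * (1 / norm (x - y) powr p))"
    if "x \<in> S" for x y
  proof (cases "norm (q x - y) < \<delta> \<and> x \<noteq> y")
    case True
    then have "norm (x - y) \<le> 2 * \<delta>"
      using norm_triangle_ineq[of "x - q x" "q x - y"] q[OF that] by (simp add: norm_minus_commute)
    then have "norm (x - y) powr p \<le> (2 * \<delta>) powr p" using p by (intro powr_mono2) auto
    then have "1 / (M * \<delta> ^ DIM('a)) \<le> A * (1 / norm (x - y) powr p)"
      using True M \<delta> by (simp add: A_def field_simps)
    then have "moll \<delta> (q x - y) \<le> A * (1 / norm (x - y) powr p)"
      using moll_le[OF \<delta>, of "q x - y"] by (simp add: M_def)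
    then have "moll \<delta> (q x - y) * (u x - u y)\<^sup>2 \<le> (A * (1 / norm (x - y) powr p)) * (u x - u y)\<^sup>2"
      by (rule mult_right_mono) simp
    then show ?thesis by (simp add: mult_ac)
  next
    case False
    then have "moll \<delta> (q x - y) * (u x - u y)\<^sup>2 = 0" using moll_zero[OF \<delta>, of "q x - y"] by force
    moreover have "0 \<le> A * ((u x - u y)\<^sup>2 * (1 / norm (x - y) powr p))" using A0 by simp
    ultimately show ?thesis by (simp only:)
  qed
  have "indicator S x * ennreal ((u x - mconv \<delta> u (q x))\<^sup>2)
      \<le> ennreal A * (\<integral>\<^sup>+y. ennreal ((u x - u y)\<^sup>2 * (1 / norm (x - y) powr p)) \<partial>lborel)" for x
  proof (cases "x \<in> S")
    case True
    have "ennreal ((u x - mconv \<delta> u (q x))\<^sup>2) \<le> (\<integral>\<^sup>+y. ennreal (moll \<delta> (q x - y) * (u x - u y)\<^sup>2) \<partial>lborel)"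
      unfolding mconv_def by (rule jensen_sq) (auto simp: moll_nonneg[OF \<delta>] nn_integral_moll[OF \<delta>])
    also have "\<dots> \<le> (\<integral>\<^sup>+y. ennreal A * ennreal ((u x - u y)\<^sup>2 * (1 / norm (x - y) powr p)) \<partial>lborel)"
      using key[OF True] A0 by (intro nn_integral_mono) (auto simp: ennreal_mult[symmetric] intro!: ennreal_leI)
    also have "\<dots> = ennreal A * (\<integral>\<^sup>+y. ennreal ((u x - u y)\<^sup>2 * (1 / norm (x - y) powr p)) \<partial>lborel)"
      by (rule nn_integral_cmult) measurable
    finally show ?thesis using True by simp
  qed simp
  then have "(\<integral>\<^sup>+x. indicator S x * ennreal ((u x - mconv \<delta> u (q x))\<^sup>2) \<partial>lborel)
      \<le> (\<integral>\<^sup>+x. ennreal A * (\<integral>\<^sup>+y. ennreal ((u x - u y)\<^sup>2 * (1 / norm (x - y) powr p)) \<partial>lborel) \<partial>lborel)"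
    by (rule nn_integral_mono)
  also have "\<dots> = ennreal A * gagl s u"
    unfolding gagl_def qform_def p_def by (rule nn_integral_cmult) measurable
  finally show ?thesis by (simp add: A p_def M_def)
qed

lemma integrable_of_sq_bounded:
  fixes u :: "'a::euclidean_space \<Rightarrow> real"
  assumes [measurable]: "u \<in> borel_measurable borel"
    and z: "\<And>x. x \<notin> ball 0 R \<Longrightarrow> u x = 0" and i: "(\<integral>\<^sup>+x. ennreal ((u x)\<^sup>2) \<partial>lborel) < \<infinity>"
  shows "integrable lborel u"
proof (rule Bochner_Integration.integrable_bound)
  have "integrable lborel (\<lambda>x. (u x)\<^sup>2)" using i by (intro integrable_sq_nn_integral) auto
  moreover have "integrable lborel (indicator (ball (0::'a) R) :: 'a \<Rightarrow> real)"
    using emeasure_lborel_ball_finite[of "0::'a" R] by (intro integrable_real_indicator) auto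
  ultimately show "integrable lborel (\<lambda>x. indicator (ball (0::'a) R) x + (u x)\<^sup>2)" by auto
  have "norm (u x) \<le> norm (indicator (ball (0::'a) R) x + (u x)\<^sup>2)" for x
  proof (cases "x \<in> ball 0 R")
    case True
    have "0 \<le> (\<bar>u x\<bar> - 1/2)\<^sup>2" by simp
    then have "\<bar>u x\<bar> \<le> 1 + (u x)\<^sup>2" unfolding power2_diff by (simp add: power2_eq_square)
    then show ?thesis using True by simp
  qed (use z in simp)
  then show "AE x in lborel. norm (u x) \<le> norm (indicator (ball (0::'a) R) x + (u x)\<^sup>2)" by simp
qed simp

section \<open>Polarization\<close>

definition polar :: "'a::euclidean_space \<Rightarrow> real \<Rightarrow> ('a \<Rightarrow> real) \<Rightarrow> 'a \<Rightarrow> real" where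
  "polar e a u x = (if x \<bullet> e > a then max (u x) (u (hrefl e a x)) else min (u x) (u (hrefl e a x)))"

lemma polar_measurable[measurable]:
  assumes [measurable]: "u \<in> borel_measurable borel"
  shows "polar e a u \<in> borel_measurable borel"
  unfolding polar_def by measurable

text \<open>The sum of the form's integrand over the four pairs made of \<open>x\<close> or its
  mirror image with \<open>y\<close> or its mirror image. Only two distances occur among them, which
  is why it involves just two kernel values.\<close>

definition quad4 :: "'a::euclidean_space \<Rightarrow> real \<Rightarrow> (real \<Rightarrow> real) \<Rightarrow> ('a \<Rightarrow> real) \<Rightarrow> 'a \<Rightarrow> 'a \<Rightarrow> real" where
  "quad4 e a k u x y =
    ((u x - u y)\<^sup>2 + (u (hrefl e a x) - u (hrefl e a y))\<^sup>2) * k (norm (x - y)) +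
    ((u (hrefl e a x) - u y)\<^sup>2 + (u x - u (hrefl e a y))\<^sup>2) * k (norm (hrefl e a x - y))"

text \<open>Read \<open>p\<close>, \<open>q\<close> as the values at \<open>x\<close> and its mirror
  image and \<open>r\<close>, \<open>t\<close> as those at \<open>y\<close> and its mirror image.
  Sorting both pairs keeps all squares and changes only the pairing in the cross terms; it matters
  only when the pairs were ordered oppositely.\<close>

lemma two_point_identity:
  fixes p q r t k1 k2 :: real
  shows "((p - r)\<^sup>2 + (q - t)\<^sup>2) * k1 + ((q - r)\<^sup>2 + (p - t)\<^sup>2) * k2
    - (((max p q - max r t)\<^sup>2 + (min p q - min r t)\<^sup>2) * k1 + ((min p q - max r t)\<^sup>2 + (max p q - min r t)\<^sup>2) * k2)
    = 2 * (k1 - k2) * max 0 (- ((p - q) * (r - t)))"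
proof (cases "p \<le> q")
  case pq: True
  then have m: "max p q = q" "min p q = p" by auto
  show ?thesis
  proof (cases "r \<le> t")
    case True
    then have m': "max r t = t" "min r t = r" by auto
    have "max 0 (- ((p - q) * (r - t))) = 0" using pq True by (simp add: mult_nonpos_nonpos)
    then show ?thesis unfolding m m' by (simp add: power2_eq_square algebra_simps)
  next
    case False
    then have m': "max r t = r" "min r t = t" by auto
    have "max 0 (- ((p - q) * (r - t))) = - ((p - q) * (r - t))" using pq False by (simp add: mult_nonpos_nonneg)
    then show ?thesis unfolding m m' by (simp add: power2_eq_square algebra_simps)
  qed
next
  case pq: False
  then have m: "max p q = p" "min p q = q" by auto
  show ?thesis
  proof (cases "r \<le> t")
    case True
    then have m': "max r t = t" "min r t = r" by auto
    have "max 0 (- ((p - q) * (r - t))) = - ((p - q) * (r - t))" using pq True by (simp add: mult_nonneg_nonpos)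
    then show ?thesis unfolding m m' by (simp add: power2_eq_square algebra_simps)
  next
    case False
    then have m': "max r t = r" "min r t = t" by auto
    have "max 0 (- ((p - q) * (r - t))) = 0" using pq False by simp
    then show ?thesis unfolding m m' by (simp add: power2_eq_square algebra_simps)
  qed
qed

text \<open>Both parts drop information from the identity: the first keeps the deficit for the
  equality case, the second is the plain decrease.\<close>

lemma two_point_le:
  fixes p q r t k1 k2 :: real
  assumes "k2 \<le> k1"
  shows "((max p q - max r t)\<^sup>2 + (min p q - min r t)\<^sup>2) * k1 + ((min p q - max r t)\<^sup>2 + (max p q - min r t)\<^sup>2) * k2
    \<le> ((p - r)\<^sup>2 + (q - t)\<^sup>2) * k1 + ((q - r)\<^sup>2 + (p - t)\<^sup>2) * k2 - 2 * (k1 - k2) * (- ((p - q) * (r - t)))"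
  and "((max p q - max r t)\<^sup>2 + (min p q - min r t)\<^sup>2) * k1 + ((min p q - max r t)\<^sup>2 + (max p q - min r t)\<^sup>2) * k2
    \<le> ((p - r)\<^sup>2 + (q - t)\<^sup>2) * k1 + ((q - r)\<^sup>2 + (p - t)\<^sup>2) * k2"
proof -
  have "2 * (k1 - k2) * (- ((p - q) * (r - t))) \<le> 2 * (k1 - k2) * max 0 (- ((p - q) * (r - t)))"
    using assms by (intro mult_left_mono) auto
  then show "((max p q - max r t)\<^sup>2 + (min p q - min r t)\<^sup>2) * k1 + ((min p q - max r t)\<^sup>2 + (max p q - min r t)\<^sup>2) * k2
    \<le> ((p - r)\<^sup>2 + (q - t)\<^sup>2) * k1 + ((q - r)\<^sup>2 + (p - t)\<^sup>2) * k2 - 2 * (k1 - k2) * (- ((p - q) * (r - t)))"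
    unfolding two_point_identity[of p r q t k1 k2, symmetric] by linarith
  have "0 \<le> 2 * (k1 - k2) * max 0 (- ((p - q) * (r - t)))"
    using assms by (intro mult_nonneg_nonneg) auto
  then show "((max p q - max r t)\<^sup>2 + (min p q - min r t)\<^sup>2) * k1 + ((min p q - max r t)\<^sup>2 + (max p q - min r t)\<^sup>2) * k2
    \<le> ((p - r)\<^sup>2 + (q - t)\<^sup>2) * k1 + ((q - r)\<^sup>2 + (p - t)\<^sup>2) * k2"
    unfolding two_point_identity[of p r q t k1 k2, symmetric] by linarith
qed

context
  fixes e :: "'a::euclidean_space" and a :: real
  assumes e: "norm e = 1"
begin

lemma hrefl_fixed: "x \<bullet> e = a \<Longrightarrow> hrefl e a x = x"
  by (simp add: hrefl_def)

lemma polar_pos: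
  assumes "x \<bullet> e \<ge> a"
  shows "polar e a u x = max (u x) (u (hrefl e a x))" "polar e a u (hrefl e a x) = min (u x) (u (hrefl e a x))"
  using assms hrefl_inner[OF e, of a x] hrefl_fixed[of x]
  by (cases "x \<bullet> e = a"; auto simp: polar_def hrefl_hrefl[OF e] min.commute)+

lemma polar_neg:
  assumes "x \<bullet> e \<le> a"
  shows "polar e a u x = min (u x) (u (hrefl e a x))" "polar e a u (hrefl e a x) = max (u x) (u (hrefl e a x))"
  using assms hrefl_inner[OF e, of a x] hrefl_fixed[of x]
  by (cases "x \<bullet> e = a"; auto simp: polar_def hrefl_hrefl[OF e] max.commute)+

text \<open>Polarization only permutes the two values at a point and its mirror image. Hence the L2
  norm and the volume of the positivity set are preserved.\<close>

lemma nn_integral_polar: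
  fixes f :: "real \<Rightarrow> ennreal"
  assumes [measurable]: "u \<in> borel_measurable borel" "f \<in> borel_measurable borel"
  shows "(\<integral>\<^sup>+x. f (polar e a u x) \<partial>lborel) = (\<integral>\<^sup>+x. f (u x) \<partial>lborel)"
proof -
  have sum: "2 * (\<integral>\<^sup>+x. f (v x) \<partial>lborel) = (\<integral>\<^sup>+x. f (v x) + f (v (hrefl e a x)) \<partial>lborel)"
    if [measurable]: "v \<in> borel_measurable borel" for v
    using nn_integral_hrefl[OF e, of "\<lambda>x. f (v x)" a] by (simp add: nn_integral_add mult_2)
  have "f (polar e a u x) + f (polar e a u (hrefl e a x)) = f (u x) + f (u (hrefl e a x))" for x
    using polar_pos[of x u] polar_neg[of x u]
    by (cases "x \<bullet> e \<ge> a"; cases "u x \<le> u (hrefl e a x)") (auto simp: max_def min_def add.commute)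
  then have "2 * (\<integral>\<^sup>+x. f (polar e a u x) \<partial>lborel) = 2 * (\<integral>\<^sup>+x. f (u x) \<partial>lborel)"
    by (simp add: sum)
  then show ?thesis by (subst (asm) ennreal_mult_cancel_left) auto
qed

text \<open>Reflecting either variable leaves the double integral unchanged, so the four reflected
  copies of the integrand each contribute the same form.\<close>

lemma qform_quad4:
  assumes [measurable]: "u \<in> borel_measurable borel" "k \<in> borel_measurable borel" and k: "\<And>r. k r \<ge> 0"
  shows "4 * qform k u = (\<integral>\<^sup>+x. \<integral>\<^sup>+y. ennreal (quad4 e a k u x y) \<partial>lborel \<partial>lborel)"
proof -
  define F where "F x y = ennreal ((u x - u y)\<^sup>2 * k (norm (x - y)))" for x y
  have F[measurable]: "(\<lambda>(x,y). F x y) \<in> borel_measurable (borel \<Otimes>\<^sub>M borel)" unfolding F_def by measurable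
  have F1[measurable]: "(\<lambda>x. \<integral>\<^sup>+y. F x y \<partial>lborel) \<in> borel_measurable borel" unfolding F_def by measurable
  have F2[measurable]: "(\<lambda>y. F x y) \<in> borel_measurable borel" for x unfolding F_def by measurable
  have q: "qform k u = (\<integral>\<^sup>+x. \<integral>\<^sup>+y. F x y \<partial>lborel \<partial>lborel)" by (simp add: qform_def F_def)
  have qy: "(\<integral>\<^sup>+y. F x (hrefl e a y) \<partial>lborel) = (\<integral>\<^sup>+y. F x y \<partial>lborel)" for x
    by (rule nn_integral_hrefl[OF e]) measurable
  have qx: "(\<integral>\<^sup>+x. \<integral>\<^sup>+y. F (hrefl e a x) y \<partial>lborel \<partial>lborel) = qform k u"
    unfolding q by (rule nn_integral_hrefl[OF e]) measurable
  have "ennreal (quad4 e a k u x y) = F x y + F (hrefl e a x) (hrefl e a y) + F (hrefl e a x) y + F x (hrefl e a y)" for x y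
    unfolding quad4_def F_def hrefl_dist[OF e] hrefl_dist_swap[OF e, of a x y, symmetric]
    using k by (simp add: ennreal_plus[symmetric] distrib_right del: ennreal_plus)
  then have "(\<integral>\<^sup>+x. \<integral>\<^sup>+y. ennreal (quad4 e a k u x y) \<partial>lborel \<partial>lborel)
     = (\<integral>\<^sup>+x. (\<integral>\<^sup>+y. F x y \<partial>lborel) + (\<integral>\<^sup>+y. F (hrefl e a x) y \<partial>lborel) + (\<integral>\<^sup>+y. F (hrefl e a x) y \<partial>lborel) + (\<integral>\<^sup>+y. F x y \<partial>lborel) \<partial>lborel)"
    by (simp add: nn_integral_add qy)
  also have "\<dots> = qform k u + qform k u + qform k u + qform k u"
    by (simp add: nn_integral_add qx q[symmetric])
  also have "\<dots> = 4 * qform k u"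
  proof -
    have "q + q + q + q = 4 * q" for q :: ennreal
      by (metis (no_types) add.assoc mult_2 mult_2_right numeral_Bit0 distrib_right)
    then show ?thesis .
  qed
  finally show ?thesis by simp
qed

text \<open>For two points on the same side the unreflected distance is the smaller one and carries
  the larger kernel value. For points on opposite sides the same inequality is applied with the
  mirror image of \<open>y\<close> in place of \<open>y\<close>, which exchanges the two kernel
  values.\<close>

lemma quad4_polar_le:
  assumes k: "\<And>r. k r \<ge> 0" and dec: "\<And>r s. 0 < r \<Longrightarrow> r \<le> s \<Longrightarrow> k s \<le> k r"
  shows "quad4 e a k (polar e a u) x y \<le> quad4 e a k u x y"
    and "x \<bullet> e \<ge> a \<Longrightarrow> y \<bullet> e \<ge> a \<Longrightarrow> x \<noteq> y \<Longrightarrow> quad4 e a k (polar e a u) x y \<le> quad4 e a k u x y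
       - 2 * (k (norm (x - y)) - k (norm (hrefl e a x - y))) * (- ((u x - u (hrefl e a x)) * (u y - u (hrefl e a y))))"
proof -
  let ?s = "hrefl e a"
  have sq: "(norm (?s x - y))\<^sup>2 = (norm (x - y))\<^sup>2 + 4 * ((x \<bullet> e - a) * (y \<bullet> e - a))"
    using hrefl_dist_sq[OF e, of a x y] by (simp only: mult.assoc)
  have same: "norm (x - y) \<le> norm (?s x - y)" if "(x \<bullet> e - a) * (y \<bullet> e - a) \<ge> 0"
    by (rule power2_le_imp_le) (use sq that in linarith, rule norm_ge_zero)
  have opp: "norm (?s x - y) \<le> norm (x - y)" if "(x \<bullet> e - a) * (y \<bullet> e - a) \<le> 0"
    by (rule power2_le_imp_le) (use sq that in linarith, rule norm_ge_zero)
  show "quad4 e a k (polar e a u) x y \<le> quad4 e a k u x y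
       - 2 * (k (norm (x - y)) - k (norm (hrefl e a x - y))) * (- ((u x - u (hrefl e a x)) * (u y - u (hrefl e a y))))"
    if xy: "x \<bullet> e \<ge> a" "y \<bullet> e \<ge> a" "x \<noteq> y"
  proof -
    have "k (norm (?s x - y)) \<le> k (norm (x - y))"
      using xy by (intro dec same) auto
    from two_point_le(1)[OF this, of "u x" "u (?s x)" "u y" "u (?s y)"]
    show ?thesis unfolding quad4_def polar_pos[OF xy(1)] polar_pos[OF xy(2)] by simp
  qed
  \<comment> \<open>The kernel is monotone only for positive arguments, and the Gagliardo kernel
    indeed drops to 0 at 0. Distance 0 is therefore split off; there the affected terms vanish and
    the others are unchanged by polarization.\<close>
  consider "x = y" | "x = ?s y" | "x \<noteq> y" "x \<noteq> ?s y" by blast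
  then show "quad4 e a k (polar e a u) x y \<le> quad4 e a k u x y"
  proof cases
    case 1
    have "(polar e a u (?s x) - polar e a u x)\<^sup>2 = (u (?s x) - u x)\<^sup>2"
      using polar_pos[of x u] polar_neg[of x u] by (cases "x \<bullet> e \<ge> a") (auto simp: max_def min_def power2_commute)
    moreover have "(polar e a u x - polar e a u (?s x))\<^sup>2 = (u x - u (?s x))\<^sup>2"
      using calculation by (simp add: power2_commute)
    ultimately show ?thesis unfolding quad4_def 1[symmetric] by simp
  next
    case 2
    have y: "y = ?s x" using 2 by (simp add: hrefl_hrefl[OF e])
    have "(polar e a u x - polar e a u (?s x))\<^sup>2 = (u x - u (?s x))\<^sup>2"
      using polar_pos[of x u] polar_neg[of x u] by (cases "x \<bullet> e \<ge> a") (auto simp: max_def min_def power2_commute)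
    moreover have "(polar e a u (?s x) - polar e a u x)\<^sup>2 = (u (?s x) - u x)\<^sup>2"
      using calculation by (simp add: power2_commute)
    ultimately show ?thesis unfolding quad4_def y by (simp add: hrefl_hrefl[OF e])
  next
    case 3
    have n0: "norm (x - y) > 0" "norm (?s x - y) > 0"
      using 3 by (auto simp: hrefl_hrefl[OF e])
    show ?thesis
    proof (cases "(x \<bullet> e - a) * (y \<bullet> e - a) \<ge> 0")
      case True
      have kk: "k (norm (?s x - y)) \<le> k (norm (x - y))" using n0 same[OF True] by (intro dec)
      consider "x \<bullet> e \<ge> a" "y \<bullet> e \<ge> a" | "x \<bullet> e \<le> a" "y \<bullet> e \<le> a"
        using True unfolding zero_le_mult_iff by fastforce
      then show ?thesis
      proof cases
        case 1
        show ?thesis using two_point_le(2)[OF kk, of "u x" "u (?s x)" "u y" "u (?s y)"]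
          unfolding quad4_def polar_pos[OF 1(1)] polar_pos[OF 1(2)] by simp
      next
        case 2
        show ?thesis using two_point_le(2)[OF kk, of "u x" "u (?s x)" "u y" "u (?s y)"]
          unfolding quad4_def polar_neg[OF 2(1)] polar_neg[OF 2(2)] by (simp add: algebra_simps)
      qed
    next
      case False
      then have kk: "k (norm (x - y)) \<le> k (norm (?s x - y))" using n0 opp by (intro dec) auto
      consider "x \<bullet> e \<ge> a" "y \<bullet> e \<le> a" | "x \<bullet> e \<le> a" "y \<bullet> e \<ge> a"
        using False unfolding zero_le_mult_iff by fastforce
      then show ?thesis
      proof cases
        case 1
        show ?thesis using two_point_le(2)[OF kk, of "u x" "u (?s x)" "u (?s y)" "u y"]
          unfolding quad4_def polar_pos[OF 1(1)] polar_neg[OF 1(2)]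
          by (simp add: algebra_simps max.commute[of "u (?s y)"] min.commute[of "u (?s y)"])
      next
        case 2
        show ?thesis using two_point_le(2)[OF kk, of "u x" "u (?s x)" "u (?s y)" "u y"]
          unfolding quad4_def polar_neg[OF 2(1)] polar_pos[OF 2(2)]
          by (simp add: algebra_simps max.commute[of "u (?s y)"] min.commute[of "u (?s y)"])
      qed
    qed
  qed
qed

lemma quad4_nonneg: "(\<And>r. k r \<ge> 0) \<Longrightarrow> quad4 e a k u x y \<ge> 0"
  unfolding quad4_def by (intro add_nonneg_nonneg mult_nonneg_nonneg) auto

lemma quad4_measurable[measurable]:
  assumes [measurable]: "u \<in> borel_measurable borel" "k \<in> borel_measurable borel"
  shows "(\<lambda>(x, y). quad4 e a k u x y) \<in> borel_measurable (borel \<Otimes>\<^sub>M borel)"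
  unfolding quad4_def by measurable

lemma qform_polar_le:
  assumes [measurable]: "u \<in> borel_measurable borel" "k \<in> borel_measurable borel" and k: "\<And>r. k r \<ge> 0"
    and dec: "\<And>r s. 0 < r \<Longrightarrow> r \<le> s \<Longrightarrow> k s \<le> k r"
  shows "qform k (polar e a u) \<le> qform k u"
proof -
  have "4 * qform k (polar e a u) \<le> 4 * qform k u"
    using quad4_polar_le(1)[where k=k and u=u, OF k dec]
    by (subst (1 2) qform_quad4) (auto simp: k intro!: nn_integral_mono ennreal_leI)
  then show ?thesis by (subst (asm) ennreal_mult_le_mult_iff) auto
qed

text \<open>Finiteness allows the equal forms to be cancelled, so the nonnegative four-point deficit
  vanishes a.e. With a strictly decreasing kernel this says that
  \<open>d = u - u \<circ> hrefl e a\<close> has \<open>d x * d y \<ge> 0\<close> for almost all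
  pairs in the half space; one point with \<open>d x > 0\<close> then decides the sign for almost
  all others.\<close>

lemma qform_polar_eq:
  assumes [measurable]: "u \<in> borel_measurable borel" "k \<in> borel_measurable borel" and k: "\<And>r. k r \<ge> 0"
    and dec: "\<And>r s. 0 < r \<Longrightarrow> r < s \<Longrightarrow> k s < k r"
    and eq: "qform k (polar e a u) = qform k u" and fin: "qform k u < \<infinity>"
  shows "(AE x in lborel. x \<bullet> e > a \<longrightarrow> u (hrefl e a x) \<le> u x) \<or> (AE x in lborel. x \<bullet> e > a \<longrightarrow> u x \<le> u (hrefl e a x))"
proof -
  have dec': "\<And>r s. 0 < r \<Longrightarrow> r \<le> s \<Longrightarrow> k s \<le> k r" using dec by (metis less_eq_real_def)
  let ?Q = "quad4 e a k u" and ?P = "quad4 e a k (polar e a u)"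
  note le = quad4_polar_le(1)[where k=k and u=u, OF k dec']
  have [measurable]: "(\<lambda>x. \<integral>\<^sup>+y. ennreal (?P x y) \<partial>lborel) \<in> borel_measurable borel"
    "(\<lambda>x. \<integral>\<^sup>+y. ennreal (?Q x y - ?P x y) \<partial>lborel) \<in> borel_measurable borel"
    "(\<lambda>y. ennreal (?P x y)) \<in> borel_measurable borel"
    "(\<lambda>y. ennreal (?Q x y - ?P x y)) \<in> borel_measurable borel" for x
    unfolding quad4_def by measurable
  have "4 * qform k u = (\<integral>\<^sup>+x. \<integral>\<^sup>+y. ennreal (?P x y) + ennreal (?Q x y - ?P x y) \<partial>lborel \<partial>lborel)"
    using le k by (subst qform_quad4) (auto simp: ennreal_plus[symmetric] quad4_nonneg simp del: ennreal_plus)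
  also have "\<dots> = 4 * qform k (polar e a u) + (\<integral>\<^sup>+x. \<integral>\<^sup>+y. ennreal (?Q x y - ?P x y) \<partial>lborel \<partial>lborel)"
    by (subst qform_quad4) (use k in \<open>simp_all add: nn_integral_add\<close>)
  finally have "4 * qform k u + (\<integral>\<^sup>+x. \<integral>\<^sup>+y. ennreal (?Q x y - ?P x y) \<partial>lborel \<partial>lborel) = 4 * qform k u + 0"
    using eq by simp
  moreover have "4 * qform k u \<noteq> top" using fin by (simp add: ennreal_mult_eq_top_iff)
  ultimately have "(\<integral>\<^sup>+x. \<integral>\<^sup>+y. ennreal (?Q x y - ?P x y) \<partial>lborel \<partial>lborel) = 0"
    unfolding ennreal_add_left_cancel infinity_ennreal_def by blast
  then have "AE x in lborel. (\<integral>\<^sup>+y. ennreal (?Q x y - ?P x y) \<partial>lborel) = 0"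
    by (subst (asm) nn_integral_0_iff_AE) auto
  then have AE: "AE x in lborel. AE y in lborel. ennreal (?Q x y - ?P x y) = 0"
    by (rule eventually_mono) (rule nn_integral_0_iff_AE[THEN iffD1], simp_all)
  define d where "d x = u x - u (hrefl e a x)" for x
  have sgn: "d x * d y \<ge> 0" if "ennreal (?Q x y - ?P x y) = 0" "x \<bullet> e > a" "y \<bullet> e > a" for x y
  proof (cases "x = y")
    case False
    have "?Q x y - ?P x y \<le> 0" using that(1) by (simp only: ennreal_eq_0_iff)
    then have eq: "?Q x y = ?P x y" using le[of x y] by linarith
    have "(norm (x - y))\<^sup>2 < (norm (hrefl e a x - y))\<^sup>2"
      using hrefl_dist_sq[OF e, of a x y] mult_pos_pos[of "x \<bullet> e - a" "y \<bullet> e - a"] that by (simp only: mult.assoc) simp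
    then have "norm (x - y) < norm (hrefl e a x - y)" by (rule power2_less_imp_less) simp
    then have kk: "k (norm (hrefl e a x - y)) < k (norm (x - y))" using False by (intro dec) auto
    define K where "K = k (norm (x - y)) - k (norm (hrefl e a x - y))"
    have K: "K > 0" using kk by (simp add: K_def)
    have "?P x y \<le> ?Q x y - 2 * K * (- (d x * d y))"
      unfolding d_def K_def using that False by (intro quad4_polar_le(2)[where k=k and u=u, OF k dec']) auto
    then have "2 * K * (- (d x * d y)) \<le> 0" using eq by linarith
    then have "0 \<le> K * (d x * d y)" by (simp add: mult.assoc)
    then show ?thesis using K by (simp add: zero_le_mult_iff)
  qed simp
  show ?thesis
  proof (rule disjCI)
    assume n: "\<not> (AE x in lborel. x \<bullet> e > a \<longrightarrow> u x \<le> u (hrefl e a x))"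
    \<comment> \<open>A single \<open>x\<close> must combine a strict sign with a good section in
      \<open>y\<close>. If no such point existed, the failing alternative would hold a.e.\<close>
    have "\<exists>x. x \<bullet> e > a \<and> d x > 0 \<and> (AE y in lborel. ennreal (?Q x y - ?P x y) = 0)"
    proof (rule ccontr)
      assume neg: "\<not> ?thesis"
      have "AE x in lborel. x \<bullet> e > a \<longrightarrow> u x \<le> u (hrefl e a x)"
        using AE
      proof eventually_elim
        case (elim x)
        then have "x \<bullet> e > a \<longrightarrow> \<not> d x > 0" using neg by blast
        then show ?case by (auto simp: d_def)
      qed
      then show False using n by simp
    qed
    then obtain x where x: "x \<bullet> e > a" "d x > 0" "AE y in lborel. ennreal (?Q x y - ?P x y) = 0"
      by blast
    show "AE y in lborel. y \<bullet> e > a \<longrightarrow> u (hrefl e a y) \<le> u y"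
      using x(3)
    proof eventually_elim
      case (elim y)
      show ?case
      proof
        assume "y \<bullet> e > a"
        then have "d x * d y \<ge> 0" using sgn[OF elim x(1)] by simp
        then show "u (hrefl e a y) \<le> u y" using x(2) by (simp add: zero_le_mult_iff d_def)
      qed
    qed
  qed
qed

text \<open>With a \<le> 0 the origin lies on the side that receives the larger values, so
  reflecting a point of that side moves it away from the origin. On the other side the minimum with
  0 is taken.\<close>

lemma polar_support:
  assumes "a \<le> 0" "\<And>x. u x \<ge> 0" "\<And>x. x \<notin> ball 0 R \<Longrightarrow> u x = 0" "x \<notin> ball 0 R"
  shows "polar e a u x = 0"
proof (cases "x \<bullet> e > a")
  case True
  have "(norm x)\<^sup>2 \<le> (norm (hrefl e a x))\<^sup>2"
    using hrefl_dist_sq[OF e, of a x 0] True assms(1)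
    by (simp add: mult_nonneg_nonpos)
  then have "norm x \<le> norm (hrefl e a x)" by (rule power2_le_imp_le) simp
  then have "hrefl e a x \<notin> ball 0 R" using assms(4) by auto
  then show ?thesis using assms(3,4) True by (simp add: polar_def)
next
  case False
  then show ?thesis using assms by (simp add: polar_def)
qed

lemma distr_hrefl: "distr lborel borel (hrefl e a) = (lborel :: 'a measure)"
proof (rule measure_eqI)
  fix A assume "A \<in> sets (distr lborel borel (hrefl e a))"
  then have [measurable]: "A \<in> sets borel" by simp
  have "emeasure (distr lborel borel (hrefl e a)) A = (\<integral>\<^sup>+x. indicator A x \<partial>(distr lborel borel (hrefl e a)))"
    by simp
  also have "\<dots> = (\<integral>\<^sup>+x. indicator A (hrefl e a x) \<partial>lborel)"
    by (rule nn_integral_distr) auto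
  also have "\<dots> = (\<integral>\<^sup>+x. indicator A x \<partial>lborel)" by (rule nn_integral_hrefl[OF e]) auto
  finally show "emeasure (distr lborel borel (hrefl e a)) A = emeasure lborel A" by simp
qed simp

lemma integral_hrefl:
  fixes f :: "'a \<Rightarrow> real"
  assumes [measurable]: "f \<in> borel_measurable borel"
  shows "(\<integral>x. f (hrefl e a x) \<partial>lborel) = (\<integral>x. f x \<partial>lborel)"
proof -
  have "(\<integral>x. f x \<partial>(distr lborel borel (hrefl e a))) = (\<integral>x. f (hrefl e a x) \<partial>lborel)"
    by (rule integral_distr) measurable
  then show ?thesis unfolding distr_hrefl by simp
qed

lemma integrable_hrefl:
  fixes f :: "'a \<Rightarrow> real"
  assumes "integrable lborel f"
  shows "integrable lborel (\<lambda>x. f (hrefl e a x))"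
  by (rule integrable_distr[where M'=borel]) (measurable, subst distr_hrefl, rule assms)

end

section \<open>Symmetric decreasing functions\<close>

text \<open>At scale 2^-k the Poincare bound decays like \<theta>^k with \<theta> = 2^(-2 s). A
  geometric rate makes the squared errors summable, so the whole dyadic sequence, and not just a
  subsequence, converges a.e.\<close>

lemma mconv_L2_geometric:
  fixes u :: "'a::euclidean_space \<Rightarrow> real"
  assumes s: "s > 0" and [measurable]: "u \<in> borel_measurable borel" and fin: "gagl s u < \<infinity>"
  obtains A \<theta> where "A \<ge> 0" "0 < \<theta>" "\<theta> < 1"
    "\<And>k. (\<integral>\<^sup>+x. ennreal ((u x - mconv ((1/2)^k) u x)\<^sup>2) \<partial>lborel) \<le> ennreal (A * \<theta> ^ k)"
proof -
  define C where "C = 2 powr (real DIM('a) + 2 * s) / bump_mass TYPE('a)"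
  have C: "C \<ge> 0" using bump_mass_pos[where 'a='a] by (simp add: C_def)
  define g where "g = enn2real (gagl s u)"
  have g: "gagl s u = ennreal g" "g \<ge> 0" using fin by (auto simp: g_def)
  define \<theta> where "\<theta> = (1/2::real) powr (2 * s)"
  have \<theta>: "0 < \<theta>" "\<theta> < 1" using s powr_less_mono'[of "1/2" 0 "2 * s"] by (auto simp: \<theta>_def)
  have bound: "(\<integral>\<^sup>+x. ennreal ((u x - mconv ((1/2)^k) u x)\<^sup>2) \<partial>lborel) \<le> ennreal ((C * g) * \<theta> ^ k)" for k
  proof -
    have "(\<integral>\<^sup>+x. indicator UNIV x * ennreal ((u x - mconv ((1/2)^k) u x)\<^sup>2) \<partial>lborel)
        \<le> ennreal (C * ((1/2)^k) powr (2 * s)) * gagl s u"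
      unfolding C_def by (rule mconv_poincare) (use s in auto)
    also have "((1/2::real)^k) powr (2 * s) = \<theta> ^ k"
      by (simp add: \<theta>_def powr_realpow[symmetric] powr_powr mult.commute)
    finally show ?thesis using C g \<theta> by (simp add: ennreal_mult[symmetric] mult_ac)
  qed
  show ?thesis by (rule that[of "C * g" \<theta>]) (use C g \<theta> bound in auto)
qed

lemma mconv_AE_tendsto:
  fixes u :: "'a::euclidean_space \<Rightarrow> real"
  assumes s: "s > 0" and um[measurable]: "u \<in> borel_measurable borel" and fin: "gagl s u < \<infinity>"
  shows "AE x in lborel. (\<lambda>k. mconv ((1/2)^k) u x) \<longlonglongrightarrow> u x"
proof -
  obtain A \<theta> where A: "A \<ge> 0" "0 < \<theta>" "\<theta> < 1"
    and bound: "\<And>k. (\<integral>\<^sup>+x. ennreal ((u x - mconv ((1/2)^k) u x)\<^sup>2) \<partial>lborel) \<le> ennreal (A * \<theta> ^ k)"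
    using mconv_L2_geometric[OF s um fin] by blast
  have "(\<integral>\<^sup>+x. (\<Sum>k. ennreal ((u x - mconv ((1/2)^k) u x)\<^sup>2)) \<partial>lborel)
      = (\<Sum>k. \<integral>\<^sup>+x. ennreal ((u x - mconv ((1/2)^k) u x)\<^sup>2) \<partial>lborel)"
    by (rule nn_integral_suminf) measurable
  also have "\<dots> \<le> (\<Sum>k. ennreal (A * \<theta> ^ k))" by (intro suminf_le bound) auto
  also have "\<dots> < \<infinity>"
    using A by (subst suminf_ennreal2) (auto intro!: summable_mult summable_geometric)
  finally have "AE x in lborel. (\<Sum>k. ennreal ((u x - mconv ((1/2)^k) u x)\<^sup>2)) \<noteq> \<infinity>"
    by (intro nn_integral_PInf_AE) auto
  then show ?thesis
  proof eventually_elim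
    case (elim x)
    have "summable (\<lambda>k. (u x - mconv ((1/2)^k) u x)\<^sup>2)"
      using elim by (intro summable_suminf_not_top) auto
    then have "(\<lambda>k. (u x - mconv ((1/2)^k) u x)\<^sup>2) \<longlonglongrightarrow> 0" by (rule summable_LIMSEQ_zero)
    then have "(\<lambda>k. sqrt ((u x - mconv ((1/2)^k) u x)\<^sup>2)) \<longlonglongrightarrow> sqrt 0" by (rule tendsto_real_sqrt)
    then have "(\<lambda>k. u x - mconv ((1/2)^k) u x) \<longlonglongrightarrow> 0" by (simp add: tendsto_rabs_zero_iff)
    then have "(\<lambda>k. u x - (u x - mconv ((1/2)^k) u x)) \<longlonglongrightarrow> u x - 0" by (intro tendsto_intros)
    then show ?case by simp
  qed
qed

text \<open>Symmetric decrease expressed a.e. through reflections: the half space containing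
  \<open>c\<close> carries the larger values. This is the form delivered by the equality case of
  polarization, and it needs no choice of a representative.\<close>

definition decreasing_about :: "'a::euclidean_space \<Rightarrow> ('a \<Rightarrow> real) \<Rightarrow> bool" where
  "decreasing_about c u \<longleftrightarrow>
    (\<forall>e a. norm e = 1 \<longrightarrow> c \<bullet> e > a \<longrightarrow> (AE x in lborel. x \<bullet> e > a \<longrightarrow> u (hrefl e a x) \<le> u x))"

text \<open>The reflection exchanging \<open>x\<close> and \<open>y\<close> has \<open>c\<close> on
  the side of \<open>x\<close>. The difference of the two mollifiers is odd under it and nonnegative
  on that side, and so pairs nonnegatively with a function that is larger there.\<close>

lemma mconv_decreasing:
  fixes u :: "'a::euclidean_space \<Rightarrow> real"
  assumes \<delta>: "\<delta> > 0" and u: "integrable lborel u" and dec: "decreasing_about c u"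
    and xy: "norm (x - c) < norm (y - c)"
  shows "mconv \<delta> u y \<le> mconv \<delta> u x"
proof -
  have [measurable]: "u \<in> borel_measurable borel" using borel_measurable_integrable[OF u] by simp
  have ne: "x \<noteq> y" using xy by auto
  define n where "n = norm (x - y)"
  have n: "n > 0" using ne by (simp add: n_def)
  define e where "e = (x - y) /\<^sub>R n"
  have e: "norm e = 1" using ne by (simp add: e_def n_def)
  \<comment> \<open>The bisecting hyperplane of \<open>x\<close> and \<open>y\<close>; the point
    \<open>c\<close> is on the side of \<open>x\<close> because it is nearer to \<open>x\<close>'s
    radius, as the squared distances show.\<close>
  define a where "a = ((x + y) \<bullet> e) / 2"
  have xe: "x \<bullet> e - a = n / 2"
  proof -
    have "x \<bullet> e - a = ((x - y) \<bullet> e) / 2" by (simp add: a_def inner_diff_left inner_add_left field_simps)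
    also have "(x - y) \<bullet> e = n"
      using n by (simp add: e_def n_def dot_square_norm power2_eq_square)
    finally show ?thesis .
  qed
  have sx: "hrefl e a x = y"
    using n by (simp add: hrefl_def xe) (simp add: e_def)
  have ce: "c \<bullet> e > a"
  proof -
    have "(norm (hrefl e a x - c))\<^sup>2 = (norm (x - c))\<^sup>2 + 4 * (n / 2) * (c \<bullet> e - a)"
      using hrefl_dist_sq[OF e, of a x c] by (simp add: xe)
    moreover have "(norm (x - c))\<^sup>2 < (norm (y - c))\<^sup>2" using xy by (intro power_strict_mono) auto
    ultimately have "0 < n * (c \<bullet> e - a)" by (simp add: sx)
    then show ?thesis using n by (simp add: zero_less_mult_iff)
  qed
  have AE1: "AE z in lborel. z \<bullet> e > a \<longrightarrow> u (hrefl e a z) \<le> u z"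
    using dec e ce by (auto simp: decreasing_about_def)
  have AE2: "AE z in lborel. hrefl e a z \<bullet> e > a \<longrightarrow> u z \<le> u (hrefl e a z)"
    using AE_hrefl[OF e AE1, of a] by (simp add: hrefl_hrefl[OF e])
  define w where "w z = moll \<delta> (x - z) - moll \<delta> (y - z)" for z
  have [measurable]: "w \<in> borel_measurable borel" unfolding w_def by measurable
  have wr: "w (hrefl e a z) = - w z" for z
  proof -
    have nxz: "norm (x - hrefl e a z) = norm (y - z)" using hrefl_dist_swap[OF e, of a x z] by (simp add: sx)
    have nyz: "norm (y - hrefl e a z) = norm (x - z)"
      using hrefl_dist[OF e, of a x z] by (simp add: sx)
    show ?thesis
      unfolding w_def
      using moll_antimono[OF \<delta>, of "x - hrefl e a z" "y - z"] moll_antimono[OF \<delta>, of "y - z" "x - hrefl e a z"]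
        moll_antimono[OF \<delta>, of "y - hrefl e a z" "x - z"] moll_antimono[OF \<delta>, of "x - z" "y - hrefl e a z"] nxz nyz
      by simp
  qed
  have wpos: "w z \<ge> 0" if "z \<bullet> e \<ge> a" for z
  proof -
    have "0 \<le> 4 * (n / 2) * (z \<bullet> e - a)" using n that by simp
    then have "(norm (x - z))\<^sup>2 \<le> (norm (y - z))\<^sup>2"
      using hrefl_dist_sq[OF e, of a x z] by (simp add: sx xe)
    then have "norm (x - z) \<le> norm (y - z)" by (rule power2_le_imp_le) simp
    then show ?thesis unfolding w_def using moll_antimono[OF \<delta>, of "x - z" "y - z"] by simp
  qed
  have i1: "integrable lborel (\<lambda>z. w z * u z)"
    unfolding w_def left_diff_distrib
    by (intro Bochner_Integration.integrable_diff integrable_moll_mult[OF \<delta> u])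
  have i2: "integrable lborel (\<lambda>z. w z * u (hrefl e a z))"
    using integrable_hrefl[OF e i1, of a] by (simp add: wr)
  have d: "mconv \<delta> u x - mconv \<delta> u y = (\<integral>z. w z * u z \<partial>lborel)"
    unfolding mconv_def w_def left_diff_distrib
    by (rule Bochner_Integration.integral_diff[symmetric]) (intro integrable_moll_mult[OF \<delta> u])+
  have "(\<integral>z. w z * u z \<partial>lborel) = (\<integral>z. w (hrefl e a z) * u (hrefl e a z) \<partial>lborel)"
    by (rule integral_hrefl[OF e, symmetric, of "\<lambda>z. w z * u z"]) measurable
  also have "\<dots> = - (\<integral>z. w z * u (hrefl e a z) \<partial>lborel)" by (simp add: wr)
  \<comment> \<open>Folding the integral with the odd weight leaves the integrand
    \<open>w z * (u z - u (hrefl e a z))\<close>, whose two factors have the same sign a.e.\<close>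
  finally have "2 * (\<integral>z. w z * u z \<partial>lborel) = (\<integral>z. w z * u z \<partial>lborel) - (\<integral>z. w z * u (hrefl e a z) \<partial>lborel)"
    by simp
  also have "\<dots> = (\<integral>z. w z * u z - w z * u (hrefl e a z) \<partial>lborel)" using i1 i2 by simp
  also have "\<dots> \<ge> 0"
  proof (rule integral_nonneg_AE)
    show "AE z in lborel. 0 \<le> w z * u z - w z * u (hrefl e a z)"
      using AE1 AE2
    proof eventually_elim
      case (elim z)
      consider "z \<bullet> e > a" | "z \<bullet> e = a" | "z \<bullet> e < a" by linarith
      then have "0 \<le> w z * (u z - u (hrefl e a z))"
      proof cases
        case 1
        then show ?thesis using wpos[of z] elim by (intro mult_nonneg_nonneg) auto
      next
        case 2
        then show ?thesis by (simp add: hrefl_def)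
      next
        case 3
        then have "hrefl e a z \<bullet> e > a" using hrefl_inner[OF e, of a z] by simp
        then show ?thesis using wpos[of "hrefl e a z"] elim wr[of z] by (intro mult_nonpos_nonpos) auto
      qed
      then show ?case by (simp add: right_diff_distrib)
    qed
  qed
  finally show ?thesis using d by simp
qed

text \<open>The mollifications are ordered by the distance to \<open>c\<close> at every point, and
  this order passes to their limit. Outside one null set \<open>N\<close> the function itself is
  thus ordered by that distance, and its positivity set is a ball up to measure zero.\<close>

lemma decreasing_about_level:
  fixes u :: "'a::euclidean_space \<Rightarrow> real"
  assumes s: "s > 0" and u: "integrable lborel u" and dec: "decreasing_about c u" and fin: "gagl s u < \<infinity>"
    and nz: "\<not> (AE x in lborel. u x = 0)" and pos: "\<And>x. u x \<ge> 0" and supp: "\<And>x. x \<notin> ball 0 R \<Longrightarrow> u x = 0"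
  obtains \<rho> where "\<rho> \<ge> 0" "AE x in lborel. x \<in> ball c \<rho> \<longrightarrow> u x > 0" "AE x in lborel. x \<notin> cball c \<rho> \<longrightarrow> u x = 0"
proof -
  have um[measurable]: "u \<in> borel_measurable borel" using borel_measurable_integrable[OF u] by simp
  obtain N where N: "{x\<in>space lborel. \<not> (\<lambda>k. mconv ((1/2)^k) u x) \<longlonglongrightarrow> u x} \<subseteq> N"
      "emeasure lborel N = 0" "N \<in> sets lborel"
    using AE_E[OF mconv_AE_tendsto[OF s um fin]] by blast
  have lim: "(\<lambda>k. mconv ((1/2)^k) u x) \<longlonglongrightarrow> u x" if "x \<notin> N" for x using N(1) that by auto
  have mono: "u y \<le> u x" if "x \<notin> N" "y \<notin> N" "norm (x - c) < norm (y - c)" for x y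
    by (rule LIMSEQ_le[OF lim[OF that(2)] lim[OF that(1)]])
       (auto intro!: exI[of _ 0] mconv_decreasing[OF _ u dec that(3)])
  have AEN: "AE x in lborel. x \<notin> N" using N by (intro AE_not_in) (auto simp: null_sets_def)
  define P where "P = {norm (x - c) |x. x \<notin> N \<and> u x > 0}"
  have "P \<noteq> {}"
  proof
    assume "P = {}"
    then have "AE x in lborel. u x = 0"
      using AEN pos by (auto simp: P_def elim!: eventually_mono) (metis less_eq_real_def)
    then show False using nz by simp
  qed
  have bdd: "p \<le> R + norm c" if pP: "p \<in> P" for p
  proof -
    obtain x where x: "p = norm (x - c)" "u x > 0" using pP unfolding P_def by blast
    then have "norm x < R" using supp[of x] by (cases "x \<in> ball 0 R") auto
    then show ?thesis using x norm_triangle_ineq4[of x c] by linarith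
  qed
  have bdd': "bdd_above P" using bdd by (rule bdd_aboveI)
  \<comment> \<open>The largest distance at which a positive value occurs. The open ball is used for
    positivity and the closed one for vanishing, since nothing is known on the sphere.\<close>
  define \<rho> where "\<rho> = Sup P"
  have \<rho>0: "\<rho> \<ge> 0"
  proof -
    obtain p where "p \<in> P" using \<open>P \<noteq> {}\<close> by blast
    then have "0 \<le> p" by (auto simp: P_def)
    also have "p \<le> \<rho>" unfolding \<rho>_def using \<open>p \<in> P\<close> bdd' by (rule cSup_upper)
    finally show ?thesis .
  qed
  moreover have "AE x in lborel. x \<in> ball c \<rho> \<longrightarrow> u x > 0"
    using AEN
  proof eventually_elim
    case (elim x)
    show ?case
    proof
      assume "x \<in> ball c \<rho>"
      then have "norm (x - c) < Sup P" by (simp add: \<rho>_def dist_norm norm_minus_commute)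
      then obtain p where p: "p \<in> P" "norm (x - c) < p" using less_cSup_iff[OF \<open>P \<noteq> {}\<close> bdd'] by blast
      then obtain y where "p = norm (y - c)" "y \<notin> N" "u y > 0" by (auto simp: P_def)
      then show "u x > 0" using mono[of x y] elim p by auto
    qed
  qed
  moreover have "AE x in lborel. x \<notin> cball c \<rho> \<longrightarrow> u x = 0"
    using AEN
  proof eventually_elim
    case (elim x)
    show ?case
    proof
      assume x: "x \<notin> cball c \<rho>"
      show "u x = 0"
      proof (rule ccontr)
        assume "u x \<noteq> 0"
        then have "norm (x - c) \<in> P" using elim pos[of x] by (auto simp: P_def)
        then have "norm (x - c) \<le> \<rho>" unfolding \<rho>_def using bdd' by (rule cSup_upper)
        then show False using x by (simp add: dist_norm norm_minus_commute)
      qed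
    qed
  qed
  ultimately show ?thesis using that by blast
qed

lemma AE_eq_of_integral_le:
  fixes f g :: "'a \<Rightarrow> real"
  assumes "integrable M f" "integrable M g" "AE x in M. f x \<le> g x" "(\<integral>x. g x \<partial>M) \<le> (\<integral>x. f x \<partial>M)"
  shows "AE x in M. f x = g x"
proof -
  have "(\<integral>x. g x - f x \<partial>M) = 0"
    using assms integral_mono_AE[OF assms(1-3)] by simp
  then have "AE x in M. g x - f x = 0"
    using assms by (subst (asm) integral_nonneg_eq_0_iff_AE) auto
  then show ?thesis by (auto elim!: eventually_mono)
qed

lemma AE_inner_neq:
  fixes e :: "'a::euclidean_space"
  assumes "norm e = 1"
  shows "AE x in lborel. x \<bullet> e \<noteq> a"
proof -
  have "negligible {x. e \<bullet> x = a}" using assms by (intro negligible_hyperplane) auto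
  then have "{x. e \<bullet> x = a} \<in> null_sets lebesgue" by (simp add: negligible_iff_null_sets)
  moreover have "{x. e \<bullet> x = a} \<in> sets borel" by (intro borel_closed closed_hyperplane)
  ultimately have "{x. e \<bullet> x = a} \<in> null_sets lborel"
    by (simp add: null_sets_completion_iff)
  then have "AE x in lborel. x \<notin> {x. e \<bullet> x = a}" by (rule AE_not_in)
  then show ?thesis by (simp add: inner_commute)
qed

text \<open>Each direction has a hyperplane halving the mass of \<open>u\<close>; the dichotomy turns it into a
  hyperplane of symmetry. The hyperplanes for the basis directions meet in the centre \<open>c\<close>, about
  which \<open>u\<close> is then even, so that every hyperplane through \<open>c\<close> halves the mass.\<close>
lemma dichotomy_imp_decreasing:
  fixes u :: "'a::euclidean_space \<Rightarrow> real"
  assumes u: "integrable lborel u" and pos: "\<And>x. u x \<ge> 0" and supp: "\<And>x. x \<notin> ball 0 R \<Longrightarrow> u x = 0"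
    and dich: "\<And>e a. norm e = 1 \<Longrightarrow> (AE x in lborel. x \<bullet> e > a \<longrightarrow> u (hrefl e a x) \<le> u x)
        \<or> (AE x in lborel. x \<bullet> e > a \<longrightarrow> u x \<le> u (hrefl e a x))"
  shows "\<exists>c. decreasing_about c u"
proof -
  have um[measurable]: "u \<in> borel_measurable borel" using borel_measurable_integrable[OF u] by simp
  define up where "up e a = (\<integral>x. indicator {x. x \<bullet> e > a} x * u x \<partial>lborel)" for e a
  define dn where "dn e a = (\<integral>x. indicator {x. x \<bullet> e < a} x * u x \<partial>lborel)" for e a
  have iu: "integrable lborel (\<lambda>x. indicator A x * u x)" if [measurable]: "A \<in> sets borel" for A :: "'a set"
    using u by (rule Bochner_Integration.integrable_bound) (auto simp: indicator_def)
  have hs[measurable]: "{x. x \<bullet> e > a} \<in> sets borel" "{x. x \<bullet> e < a} \<in> sets borel" for e :: 'a and a :: real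
    by measurable
  have dn_up: "dn e a = (\<integral>x. indicator {x. x \<bullet> e > a} x * u (hrefl e a x) \<partial>lborel)"
    and iur: "integrable lborel (\<lambda>x. indicator {x. x \<bullet> e > a} x * u (hrefl e a x))"
    if e: "norm e = 1" for e a
  proof -
    have eq: "(\<lambda>x. indicator {x. x \<bullet> e < a} (hrefl e a x) * u (hrefl e a x)) = (\<lambda>x. indicator {x. x \<bullet> e > a} x * u (hrefl e a x))"
    proof
      fix x
      have "hrefl e a x \<bullet> e < a \<longleftrightarrow> x \<bullet> e > a" using hrefl_inner[OF e, of a x] by linarith
      then show "indicator {x. x \<bullet> e < a} (hrefl e a x) * u (hrefl e a x) = indicator {x. x \<bullet> e > a} x * u (hrefl e a x)"
        by (simp add: indicator_def)
    qed
    show "dn e a = (\<integral>x. indicator {x. x \<bullet> e > a} x * u (hrefl e a x) \<partial>lborel)"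
      unfolding dn_def eq[symmetric] by (rule integral_hrefl[OF e, symmetric, of "\<lambda>x. indicator {x. x \<bullet> e < a} x * u x"]) measurable
    show "integrable lborel (\<lambda>x. indicator {x. x \<bullet> e > a} x * u (hrefl e a x))"
      using integrable_hrefl[OF e iu[of "{x. x \<bullet> e < a}"], of a] unfolding eq by simp
  qed
  \<comment> \<open>An a.e. inequality between \<open>u\<close> and its reflection, together with
    the reverse inequality of their integrals over the half space, forces equality.\<close>
  have le_eq: "AE x in lborel. x \<bullet> e > a \<longrightarrow> u x = u (hrefl e a x)"
    if e: "norm e = 1" and le: "AE x in lborel. x \<bullet> e > a \<longrightarrow> u x \<le> u (hrefl e a x)" and m: "dn e a \<le> up e a" for e a
  proof -
    have "AE x in lborel. indicator {x. x \<bullet> e > a} x * u x = indicator {x. x \<bullet> e > a} x * u (hrefl e a x)"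
      using le m unfolding dn_up[OF e] up_def
      by (intro AE_eq_of_integral_le iu iur[OF e]) (auto simp: indicator_def elim!: eventually_mono)
    then show ?thesis by (auto elim!: eventually_mono simp: indicator_def)
  qed
  have ge_eq: "AE x in lborel. x \<bullet> e > a \<longrightarrow> u x = u (hrefl e a x)"
    if e: "norm e = 1" and ge: "AE x in lborel. x \<bullet> e > a \<longrightarrow> u (hrefl e a x) \<le> u x" and m: "up e a \<le> dn e a" for e a
  proof -
    have "AE x in lborel. indicator {x. x \<bullet> e > a} x * u (hrefl e a x) = indicator {x. x \<bullet> e > a} x * u x"
      using ge m unfolding dn_up[OF e] up_def
      by (intro AE_eq_of_integral_le iu iur[OF e]) (auto simp: indicator_def elim!: eventually_mono)
    then show ?thesis by (auto elim!: eventually_mono simp: indicator_def)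
  qed
  have sym: "AE x in lborel. u (hrefl e a x) = u x" if e: "norm e = 1" and m: "up e a = dn e a" for e a
  proof -
    have 1: "AE x in lborel. x \<bullet> e > a \<longrightarrow> u x = u (hrefl e a x)"
      using dich[OF e, of a]
    proof
      assume "AE x in lborel. x \<bullet> e > a \<longrightarrow> u (hrefl e a x) \<le> u x"
      then show ?thesis using m by (intro ge_eq[OF e]) auto
    next
      assume "AE x in lborel. x \<bullet> e > a \<longrightarrow> u x \<le> u (hrefl e a x)"
      then show ?thesis using m by (intro le_eq[OF e]) auto
    qed
    show ?thesis using 1 AE_hrefl[OF e 1, of a]
    proof eventually_elim
      case (elim x)
      consider "x \<bullet> e > a" | "x \<bullet> e = a" | "x \<bullet> e < a" by linarith
      then show ?case
      proof cases
        case 3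
        then have "hrefl e a x \<bullet> e > a" using hrefl_inner[OF e, of a x] by simp
        then show ?thesis using elim by (simp add: hrefl_hrefl[OF e])
      qed (use elim in \<open>auto simp: hrefl_def\<close>)
    qed
  qed
  have I: "up e a + dn e a = (\<integral>x. u x \<partial>lborel)" if e: "norm e = 1" for e a
  proof -
    have "up e a + dn e a = (\<integral>x. indicator {x. x \<bullet> e > a} x * u x + indicator {x. x \<bullet> e < a} x * u x \<partial>lborel)"
      unfolding up_def dn_def by (subst Bochner_Integration.integral_add) (auto intro!: iu)
    also have "\<dots> = (\<integral>x. u x \<partial>lborel)"
      using AE_inner_neq[OF e, of a] by (intro integral_cong_AE) (auto elim!: eventually_mono simp: indicator_def)
    finally show ?thesis .
  qed
  \<comment> \<open>The mass above the hyperplane depends continuously on its position because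
    hyperplanes are null. It takes the full mass at \<open>-R'\<close> and 0 at \<open>R'\<close>,
    so the intermediate value theorem applies.\<close>
  have half: "\<exists>t. up e t = dn e t" if e: "norm e = 1" for e
  proof -
    define R' where "R' = max R 0"
    have cont: "continuous_on {-R'..R'} (\<lambda>t. up e t)"
      unfolding continuous_on_sequentially
    proof (intro ballI allI impI, elim conjE)
      fix X :: "nat \<Rightarrow> real" and t :: real assume X: "X \<longlonglongrightarrow> t"
      have "(\<lambda>n. \<integral>x. indicator {x. x \<bullet> e > X n} x * u x \<partial>lborel) \<longlonglongrightarrow> (\<integral>x. indicator {x. x \<bullet> e > t} x * u x \<partial>lborel)"
      proof (rule integral_dominated_convergence[where w=u])
        show "AE x in lborel. (\<lambda>n. indicator {x. x \<bullet> e > X n} x * u x) \<longlonglongrightarrow> indicator {x. x \<bullet> e > t} x * u x"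
          using AE_inner_neq[OF e, of t]
        proof eventually_elim
          case (elim x)
          have "eventually (\<lambda>n. indicator {x. x \<bullet> e > X n} x * u x = indicator {x. x \<bullet> e > t} x * u x) sequentially"
          proof (cases "x \<bullet> e > t")
            case True
            from order_tendstoD(2)[OF X True] show ?thesis by (rule eventually_mono) (use True in simp)
          next
            case False
            then have "x \<bullet> e < t" using elim by simp
            from order_tendstoD(1)[OF X this] show ?thesis by (rule eventually_mono) (use False in simp)
          qed
          then show ?case by (rule tendsto_eventually)
        qed
        show "AE x in lborel. norm (indicator {x. x \<bullet> e > X n} x * u x) \<le> u x" for n
          using pos by (auto simp: indicator_def)
      qed (use u in auto)
      then show "((\<lambda>t. up e t) \<circ> X) \<longlonglongrightarrow> up e t" by (simp add: up_def comp_def)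
    qed
    have ub: "u x = 0" if "\<bar>x \<bullet> e\<bar> \<ge> R'" for x
    proof -
      have "\<bar>x \<bullet> e\<bar> \<le> norm x" using Cauchy_Schwarz_ineq2[of x e] e by simp
      then show ?thesis using that supp[of x] by (simp add: R'_def)
    qed
    have "up e R' = 0"
    proof -
      have "(\<lambda>x. indicator {x. x \<bullet> e > R'} x * u x) = (\<lambda>x. 0)"
        using ub by (intro ext) (auto simp: indicator_def R'_def)
      then show ?thesis unfolding up_def by (simp only: Bochner_Integration.integral_zero)
    qed
    moreover have "dn e (-R') = 0"
    proof -
      have "(\<lambda>x. indicator {x. x \<bullet> e < -R'} x * u x) = (\<lambda>x. 0)"
        using ub by (intro ext) (auto simp: indicator_def R'_def)
      then show ?thesis unfolding dn_def by (simp only: Bochner_Integration.integral_zero)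
    qed
    moreover have "0 \<le> (\<integral>x. u x \<partial>lborel)" using pos by simp
    ultimately have "\<exists>t\<ge>-R'. t \<le> R' \<and> up e t = (\<integral>x. u x \<partial>lborel) / 2"
      using I[OF e, of "-R'"] by (intro IVT2' cont) (auto simp: R'_def)
    then obtain t where "up e t = (\<integral>x. u x \<partial>lborel) / 2" by blast
    then show ?thesis using I[OF e, of t] by (intro exI[of _ t]) simp
  qed
  then have "\<forall>b\<in>Basis. \<exists>t. up b t = dn (b::'a) t" by simp
  then obtain t where t: "\<And>b::'a. b \<in> Basis \<Longrightarrow> up b (t b) = dn b (t b)" by metis
  define c where "c = (\<Sum>b\<in>Basis. t b *\<^sub>R b)"
  \<comment> \<open>The composition of the reflections for the directions in \<open>B\<close>. As
    these are orthogonal, each factor leaves the other coordinates alone, and all of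
    \<open>Basis\<close> gives the point reflection \<open>2 *\<^sub>R c - x\<close>.\<close>
  define P where "P B x = x - (\<Sum>b\<in>B. (2 * (x \<bullet> b - t b)) *\<^sub>R b)" for B and x :: 'a
  have even0: "AE x in lborel. u (P B x) = u x" if "finite B" "B \<subseteq> Basis" for B
    using that
  proof (induction B rule: finite_induct)
    case empty
    then show ?case by (simp add: P_def)
  next
    case (insert b B)
    have b: "b \<in> Basis" "norm b = 1" using insert by auto
    have PP: "P (insert b B) x = P B (hrefl b (t b) x)" for x
    proof -
      have "hrefl b (t b) x \<bullet> b' = x \<bullet> b'" if "b' \<in> B" for b'
      proof -
        have "b \<bullet> b' = 0" using that insert by (intro inner_not_same_Basis) auto
        then show ?thesis by (simp add: hrefl_def inner_diff_left)
      qed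
      then have "(\<Sum>b'\<in>B. (2 * (hrefl b (t b) x \<bullet> b' - t b')) *\<^sub>R b') = (\<Sum>b'\<in>B. (2 * (x \<bullet> b' - t b')) *\<^sub>R b')"
        by (intro sum.cong) auto
      then show ?thesis using insert by (simp add: P_def hrefl_def)
    qed
    have "AE x in lborel. u (P B x) = u x" using insert by auto
    from AE_hrefl[OF b(2) this, of "t b"] sym[OF b(2) t[OF b(1)]]
    show ?case unfolding PP by eventually_elim simp
  qed
  have P: "P Basis x = 2 *\<^sub>R c - x" for x
  proof -
    have "(\<Sum>b\<in>Basis. (2 * (x \<bullet> b - t b)) *\<^sub>R b) = 2 *\<^sub>R ((\<Sum>b\<in>Basis. (x \<bullet> b) *\<^sub>R b) - c)"
      by (simp add: c_def sum_subtractf[symmetric] scaleR_sum_right algebra_simps)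
    then show ?thesis by (simp add: P_def euclidean_representation algebra_simps scaleR_2)
  qed
  have even: "AE x in lborel. u (2 *\<^sub>R c - x) = u x" using even0[of Basis] by (simp add: P)
  have mid: "up e (c \<bullet> e) = dn e (c \<bullet> e)" for e
  proof -
    have "up e (c \<bullet> e) = (\<integral>x. indicator {x. x \<bullet> e > c \<bullet> e} (2 *\<^sub>R c - x) * u (2 *\<^sub>R c - x) \<partial>lborel)"
      unfolding up_def by (rule integral_lborel_minus[symmetric, of "\<lambda>x. indicator {x. x \<bullet> e > c \<bullet> e} x * u x"]) measurable
    also have "\<dots> = dn e (c \<bullet> e)"
      unfolding dn_def using even
      by (intro integral_cong_AE) (auto elim!: eventually_mono simp: indicator_def inner_diff_left)
    finally show ?thesis .
  qed
  show ?thesis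
    unfolding decreasing_about_def
  proof (intro exI[of _ c] allI impI)
    fix e :: 'a and a assume e: "norm e = 1" and ca: "c \<bullet> e > a"
    have "up e (c \<bullet> e) \<le> up e a"
      unfolding up_def using ca pos by (intro integral_mono iu) (auto simp: indicator_def)
    moreover have "dn e a \<le> dn e (c \<bullet> e)"
      unfolding dn_def using ca pos by (intro integral_mono iu) (auto simp: indicator_def)
    \<comment> \<open>Moving the hyperplane away from the centre leaves more mass on the side of
      \<open>c\<close>. In the unwanted alternative of the dichotomy this excess forces equality, so
      the wanted inequality holds in either case.\<close>
    ultimately have m: "dn e a \<le> up e a" using mid[of e] by simp
    show "AE x in lborel. x \<bullet> e > a \<longrightarrow> u (hrefl e a x) \<le> u x"
      using dich[OF e, of a]
    proof
      assume "AE x in lborel. x \<bullet> e > a \<longrightarrow> u x \<le> u (hrefl e a x)"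
      from le_eq[OF e this m] show ?thesis by (auto elim!: eventually_mono)
    qed simp
  qed
qed

section \<open>The local energy as a limit of nonlocal ones\<close>

text \<open>The height is chosen by \<open>moment2_ball\<close>: averaging the squares of
  \<open>g \<bullet> h\<close> over the \<epsilon>-ball with this weight gives exactly the squared
  norm of \<open>g\<close>.\<close>

definition kloc :: "'a::euclidean_space itself \<Rightarrow> real \<Rightarrow> real \<Rightarrow> real" where
  "kloc _ \<epsilon> r = (if r < \<epsilon> then 1 / (ballmom TYPE('a) * \<epsilon> ^ (DIM('a) + 2)) else 0)"

definition locq :: "real \<Rightarrow> ('a::euclidean_space \<Rightarrow> real) \<Rightarrow> ennreal" where
  "locq \<epsilon> u = qform (kloc TYPE('a) \<epsilon>) u"

text \<open>A supremum rather than a limit, so that polarization and lower semicontinuity pass to it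
  form by form. Its relation to weak gradients consists of the two bounds
  \<open>weak_gradient_exists\<close> and \<open>dirichlet_le_weak_gradient\<close>.\<close>

definition dirichlet :: "('a::euclidean_space \<Rightarrow> real) \<Rightarrow> ennreal" where
  "dirichlet u = (SUP \<epsilon>\<in>{0<..}. locq \<epsilon> u)"

lemma kloc_measurable[measurable]: "kloc TYPE('a::euclidean_space) \<epsilon> \<in> borel_measurable borel"
  unfolding kloc_def by measurable

lemma kloc_nonneg: "\<epsilon> > 0 \<Longrightarrow> kloc TYPE('a::euclidean_space) \<epsilon> r \<ge> 0"
  using ballmom_pos[where 'a='a] by (simp add: kloc_def)

lemma kloc_antimono: "\<epsilon> > 0 \<Longrightarrow> r \<le> s \<Longrightarrow> kloc TYPE('a::euclidean_space) \<epsilon> s \<le> kloc TYPE('a) \<epsilon> r"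
  using ballmom_pos[where 'a='a] by (simp add: kloc_def)

lemma locq_le_dirichlet: "\<epsilon> > 0 \<Longrightarrow> locq \<epsilon> u \<le> dirichlet u"
  unfolding dirichlet_def by (rule SUP_upper) simp

lemma locq_shift:
  fixes u :: "'a::euclidean_space \<Rightarrow> real"
  assumes [measurable]: "u \<in> borel_measurable borel" and \<epsilon>: "\<epsilon> > 0"
  shows "locq \<epsilon> u = ennreal (1 / (ballmom TYPE('a) * \<epsilon> ^ (DIM('a) + 2))) *
    (\<integral>\<^sup>+h. indicator (ball 0 \<epsilon>) h * (\<integral>\<^sup>+x. ennreal ((u (x + h) - u x)\<^sup>2) \<partial>lborel) \<partial>lborel)"
proof -
  have "locq \<epsilon> u = (\<integral>\<^sup>+h. ennreal (kloc TYPE('a) \<epsilon> (norm h)) * (\<integral>\<^sup>+x. ennreal ((u (x + h) - u x)\<^sup>2) \<partial>lborel) \<partial>lborel)"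
    unfolding locq_def by (rule qform_shift) (auto simp: kloc_nonneg[OF \<epsilon>])
  also have "\<dots> = (\<integral>\<^sup>+h. ennreal (1 / (ballmom TYPE('a) * \<epsilon> ^ (DIM('a) + 2))) *
      (indicator (ball 0 \<epsilon>) h * (\<integral>\<^sup>+x. ennreal ((u (x + h) - u x)\<^sup>2) \<partial>lborel)) \<partial>lborel)"
    by (intro nn_integral_cong) (auto simp: kloc_def indicator_def)
  also have "\<dots> = ennreal (1 / (ballmom TYPE('a) * \<epsilon> ^ (DIM('a) + 2))) *
      (\<integral>\<^sup>+h. indicator (ball 0 \<epsilon>) h * (\<integral>\<^sup>+x. ennreal ((u (x + h) - u x)\<^sup>2) \<partial>lborel) \<partial>lborel)"
    by (rule nn_integral_cmult) measurable
  finally show ?thesis .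
qed

lemma locq_mconv_le:
  assumes "\<delta> > 0" "\<epsilon> > 0" "integrable lborel u"
  shows "locq \<epsilon> (mconv \<delta> u) \<le> locq \<epsilon> u"
proof -
  have [measurable]: "u \<in> borel_measurable borel" using borel_measurable_integrable[OF assms(3)] by simp
  show ?thesis
    using assms by (simp add: locq_shift) (intro mult_left_mono nn_integral_mono nn_integral_mconv_shift; simp)
qed

lemma nn_integral_sq_finite:
  fixes f :: "'a::euclidean_space \<Rightarrow> real"
  assumes cont: "continuous_on UNIV f" and supp: "\<And>x. norm x \<ge> R \<Longrightarrow> f x = 0"
  shows "(\<integral>\<^sup>+x. ennreal ((f x)\<^sup>2) \<partial>lborel) < \<infinity>"
proof -
  have "bounded (f ` cball 0 R)"
    by (intro compact_imp_bounded compact_continuous_image continuous_on_subset[OF cont]) auto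
  then obtain K where K: "\<And>x. x \<in> cball 0 R \<Longrightarrow> norm (f x) \<le> K" unfolding bounded_iff by blast
  have "(\<integral>\<^sup>+x. ennreal ((f x)\<^sup>2) \<partial>lborel) \<le> (\<integral>\<^sup>+x. ennreal (K\<^sup>2) * indicator (cball (0::'a) R) x \<partial>lborel)"
  proof (rule nn_integral_mono)
    fix x
    have "(f x)\<^sup>2 \<le> K\<^sup>2" if "x \<in> cball 0 R"
      using power_mono[OF K[OF that], of 2] by simp
    then show "ennreal ((f x)\<^sup>2) \<le> ennreal (K\<^sup>2) * indicator (cball 0 R) x"
      using supp[of x] by (auto simp: indicator_def ennreal_leI)
  qed
  also have "\<dots> < \<infinity>"
    using emeasure_lborel_cball_finite[of "0::'a" R] by (simp add: nn_integral_cmult_indicator ennreal_mult_less_top)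
  finally show ?thesis .
qed

text \<open>A C1 function bundled with its gradient. The instances are the mollifications, their
  sums, the test functions and products with test functions.\<close>

locale C1_fun =
  fixes f :: "'a::euclidean_space \<Rightarrow> real" and g :: "'a \<Rightarrow> 'a"
  assumes der: "\<And>x. (f has_derivative (\<lambda>h. g x \<bullet> h)) (at x)" and cont: "continuous_on UNIV g"
begin

lemma g_measurable[measurable]: "g \<in> borel_measurable borel"
  by (intro borel_measurable_continuous_onI cont)

lemma cont_f: "continuous_on UNIV f"
  using der has_derivative_continuous by (intro continuous_at_imp_continuous_on) blast

lemma f_measurable[measurable]: "f \<in> borel_measurable borel"
  by (intro borel_measurable_continuous_onI cont_f)

text \<open>The increment is the integral of the directional derivative along the segment. Jensen
  over the parameter interval and translation invariance give the bound without loss.\<close>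

lemma shift_bound: "(\<integral>\<^sup>+x. ennreal ((f (x + h) - f x)\<^sup>2) \<partial>lborel) \<le> (\<integral>\<^sup>+x. ennreal ((g x \<bullet> h)\<^sup>2) \<partial>lborel)"
proof -
  have "ennreal ((f (x + h) - f x)\<^sup>2) \<le> (\<integral>\<^sup>+t. indicator {0..1} t * ennreal ((g (x + t *\<^sub>R h) \<bullet> h)\<^sup>2) \<partial>(lborel::real measure))" for x
  proof -
    have "(\<integral>t. (g (x + t *\<^sub>R h) \<bullet> h) * indicator {0..1} t \<partial>lborel) = f (x + 1 *\<^sub>R h) - f (x + 0 *\<^sub>R h)"
    proof (rule integral_FTC_Icc_real)
      fix t :: real
      have "((\<lambda>t. x + t *\<^sub>R h) has_derivative (\<lambda>t. t *\<^sub>R h)) (at t)"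
        by (auto intro!: derivative_eq_intros)
      from has_derivative_compose[OF this der[of "x + t *\<^sub>R h"]]
      show "((\<lambda>t. f (x + t *\<^sub>R h)) has_real_derivative g (x + t *\<^sub>R h) \<bullet> h) (at t)"
        unfolding has_field_derivative_def by (simp add: mult_commute_abs)
      show "isCont (\<lambda>t. g (x + t *\<^sub>R h) \<bullet> h) t"
        using cont by (intro continuous_intros isCont_o2[of _ "\<lambda>t. x + t *\<^sub>R h" g]) (auto simp: continuous_on_eq_continuous_at)
    qed simp
    then have "ennreal ((f (x + h) - f x)\<^sup>2) = ennreal ((0 - (\<integral>t. indicator {0..1} t * (g (x + t *\<^sub>R h) \<bullet> h) \<partial>lborel))\<^sup>2)"
      by (simp add: mult.commute power2_commute)
    also have "\<dots> \<le> (\<integral>\<^sup>+t. ennreal (indicator {0..1} t * (0 - g (x + t *\<^sub>R h) \<bullet> h)\<^sup>2) \<partial>(lborel::real measure))"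
      by (rule jensen_sq) (auto simp: ennreal_indicator)
    also have "\<dots> = (\<integral>\<^sup>+t. indicator {0..1} t * ennreal ((g (x + t *\<^sub>R h) \<bullet> h)\<^sup>2) \<partial>(lborel::real measure))"
      by (intro nn_integral_cong) (auto simp: indicator_def)
    finally show ?thesis .
  qed
  then have "(\<integral>\<^sup>+x. ennreal ((f (x + h) - f x)\<^sup>2) \<partial>lborel)
     \<le> (\<integral>\<^sup>+x. \<integral>\<^sup>+t. indicator {0..1} t * ennreal ((g (x + t *\<^sub>R h) \<bullet> h)\<^sup>2) \<partial>(lborel::real measure) \<partial>lborel)"
    by (intro nn_integral_mono)
  also have "\<dots> = (\<integral>\<^sup>+t. \<integral>\<^sup>+x. indicator {0..1} t * ennreal ((g (x + t *\<^sub>R h) \<bullet> h)\<^sup>2) \<partial>lborel \<partial>(lborel::real measure))"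
    by (rule lborel_pair.Fubini') measurable
  also have "\<dots> = (\<integral>\<^sup>+t. indicator {0..1} t * (\<integral>\<^sup>+x. ennreal ((g x \<bullet> h)\<^sup>2) \<partial>lborel) \<partial>(lborel::real measure))"
  proof (rule nn_integral_cong)
    fix t :: real
    show "(\<integral>\<^sup>+x. indicator {0..1} t * ennreal ((g (x + t *\<^sub>R h) \<bullet> h)\<^sup>2) \<partial>lborel) = indicator {0..1} t * (\<integral>\<^sup>+x. ennreal ((g x \<bullet> h)\<^sup>2) \<partial>lborel)"
      using nn_integral_lborel_add[of "\<lambda>x. ennreal ((g x \<bullet> h)\<^sup>2)" "t *\<^sub>R h"]
      by (subst nn_integral_cmult) auto
  qed
  also have "\<dots> = (\<integral>\<^sup>+x. ennreal ((g x \<bullet> h)\<^sup>2) \<partial>lborel)"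
    by (subst nn_integral_multc) auto
  finally show ?thesis .
qed

text \<open>After Fubini the inner integral over \<open>h\<close> is the second moment of the
  gradient, and the normalization of \<open>kloc\<close> cancels its constant.\<close>

lemma locq_le_gradient:
  assumes \<epsilon>: "\<epsilon> > 0"
  shows "locq \<epsilon> f \<le> (\<integral>\<^sup>+x. ennreal ((norm (g x))\<^sup>2) \<partial>lborel)"
proof -
  define c where "c = ballmom TYPE('a) * \<epsilon> ^ (DIM('a) + 2)"
  have c: "c > 0" using ballmom_pos[where 'a='a] \<epsilon> by (simp add: c_def)
  have "locq \<epsilon> f \<le> ennreal (1 / c) * (\<integral>\<^sup>+h. indicator (ball 0 \<epsilon>) h * (\<integral>\<^sup>+x. ennreal ((g x \<bullet> h)\<^sup>2) \<partial>lborel) \<partial>lborel)"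
    unfolding locq_shift[OF f_measurable \<epsilon>] c_def[symmetric]
    by (intro mult_left_mono nn_integral_mono shift_bound) auto
  also have "(\<integral>\<^sup>+h. indicator (ball 0 \<epsilon>) h * (\<integral>\<^sup>+x. ennreal ((g x \<bullet> h)\<^sup>2) \<partial>lborel) \<partial>lborel)
      = (\<integral>\<^sup>+h. \<integral>\<^sup>+x. indicator (ball 0 \<epsilon>) h * ennreal ((g x \<bullet> h)\<^sup>2) \<partial>lborel \<partial>lborel)"
    by (intro nn_integral_cong nn_integral_cmult[symmetric]) measurable
  also have "\<dots> = (\<integral>\<^sup>+x. \<integral>\<^sup>+h. indicator (ball 0 \<epsilon>) h * ennreal ((g x \<bullet> h)\<^sup>2) \<partial>lborel \<partial>lborel)"
    by (rule lborel_pair.Fubini') measurable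
  also have "\<dots> = (\<integral>\<^sup>+x. ennreal c * ennreal ((norm (g x))\<^sup>2) \<partial>lborel)"
    unfolding moment2_ball[OF \<epsilon>] c_def[symmetric]
    using c by (intro nn_integral_cong) (simp add: ennreal_mult)
  also have "\<dots> = ennreal c * (\<integral>\<^sup>+x. ennreal ((norm (g x))\<^sup>2) \<partial>lborel)"
    by (rule nn_integral_cmult) measurable
  finally show ?thesis using c by (simp add: mult.assoc[symmetric] ennreal_mult[symmetric])
qed

text \<open>Substituting h = \<epsilon> z turns the form at scale \<epsilon> into an integral of
  squared difference quotients over the fixed unit ball. These converge pointwise along \<epsilon> =
  2^-k, and Fatou transfers the bound.\<close>

lemma gradient_le_locq:
  assumes B: "\<And>\<epsilon>. \<epsilon> > 0 \<Longrightarrow> locq \<epsilon> f \<le> B"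
  shows "(\<integral>\<^sup>+x. ennreal ((norm (g x))\<^sup>2) \<partial>lborel) \<le> B"
proof -
  define \<kappa> where "\<kappa> = ballmom TYPE('a)"
  have \<kappa>: "\<kappa> > 0" using ballmom_pos[where 'a='a] by (simp add: \<kappa>_def)
  define \<epsilon> where "\<epsilon> k = (1/2::real)^k" for k :: nat
  have \<epsilon>: "\<epsilon> k > 0" for k by (simp add: \<epsilon>_def)
  have \<epsilon>0: "\<epsilon> \<longlonglongrightarrow> 0" unfolding \<epsilon>_def by (rule LIMSEQ_power_zero) simp
  have fl: "filterlim \<epsilon> (at 0) sequentially"
    unfolding filterlim_at using \<epsilon>0 by (simp add: \<epsilon>_def)
  define F where "F k p = indicator (ball 0 1) (fst p) * ennreal (((f (snd p + \<epsilon> k *\<^sub>R fst p) - f (snd p)) / \<epsilon> k)\<^sup>2)" for k and p :: "'a \<times> 'a"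
  define G where "G p = indicator (ball 0 1) (fst p) * ennreal ((g (snd p) \<bullet> fst p)\<^sup>2)" for p :: "'a \<times> 'a"
  have Fm[measurable]: "F k \<in> borel_measurable (lborel \<Otimes>\<^sub>M lborel)" for k unfolding F_def by measurable
  have Gm[measurable]: "G \<in> borel_measurable (lborel \<Otimes>\<^sub>M lborel)" unfolding G_def by measurable
  have F_int: "(\<integral>\<^sup>+p. F k p \<partial>(lborel \<Otimes>\<^sub>M lborel)) = ennreal \<kappa> * locq (\<epsilon> k) f" for k
  proof -
    have "(\<integral>\<^sup>+p. F k p \<partial>(lborel \<Otimes>\<^sub>M lborel)) = (\<integral>\<^sup>+z. \<integral>\<^sup>+x. F k (z, x) \<partial>lborel \<partial>lborel)"
      by (rule lborel.nn_integral_fst[symmetric]) measurable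
    also have "\<dots> = (\<integral>\<^sup>+z. ennreal (1 / (\<epsilon> k)\<^sup>2) * (indicator (ball 0 1) z * (\<integral>\<^sup>+x. ennreal ((f (x + \<epsilon> k *\<^sub>R z) - f x)\<^sup>2) \<partial>lborel)) \<partial>lborel)"
    proof (rule nn_integral_cong)
      fix z :: 'a
      have "F k (z, x) = (ennreal (1 / (\<epsilon> k)\<^sup>2) * indicator (ball 0 1) z) * ennreal ((f (x + \<epsilon> k *\<^sub>R z) - f x)\<^sup>2)" for x
        by (auto simp: F_def power_divide ennreal_mult[symmetric] indicator_def)
      then show "(\<integral>\<^sup>+x. F k (z, x) \<partial>lborel) = ennreal (1 / (\<epsilon> k)\<^sup>2) * (indicator (ball 0 1) z * (\<integral>\<^sup>+x. ennreal ((f (x + \<epsilon> k *\<^sub>R z) - f x)\<^sup>2) \<partial>lborel))"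
        by (simp add: nn_integral_cmult mult.assoc)
    qed
    also have "\<dots> = ennreal (1 / (\<epsilon> k)\<^sup>2) * (\<integral>\<^sup>+z. indicator (ball 0 1) z * (\<integral>\<^sup>+x. ennreal ((f (x + \<epsilon> k *\<^sub>R z) - f x)\<^sup>2) \<partial>lborel) \<partial>lborel)"
      by (rule nn_integral_cmult) measurable
    finally have 1: "(\<integral>\<^sup>+p. F k p \<partial>(lborel \<Otimes>\<^sub>M lborel)) =
       ennreal (1 / (\<epsilon> k)\<^sup>2) * (\<integral>\<^sup>+z. indicator (ball 0 1) z * (\<integral>\<^sup>+x. ennreal ((f (x + \<epsilon> k *\<^sub>R z) - f x)\<^sup>2) \<partial>lborel) \<partial>lborel)" .
    have "(\<integral>\<^sup>+h. indicator (ball 0 (\<epsilon> k)) h * (\<integral>\<^sup>+x. ennreal ((f (x + h) - f x)\<^sup>2) \<partial>lborel) \<partial>lborel)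
      = ennreal (\<epsilon> k ^ DIM('a)) * (\<integral>\<^sup>+z. indicator (ball 0 (\<epsilon> k)) (\<epsilon> k *\<^sub>R z) * (\<integral>\<^sup>+x. ennreal ((f (x + \<epsilon> k *\<^sub>R z) - f x)\<^sup>2) \<partial>lborel) \<partial>lborel)"
      using \<epsilon>[of k] by (subst nn_integral_lborel_scale[of _ "\<epsilon> k"]) auto
    also have "(\<integral>\<^sup>+z. indicator (ball 0 (\<epsilon> k)) (\<epsilon> k *\<^sub>R z) * (\<integral>\<^sup>+x. ennreal ((f (x + \<epsilon> k *\<^sub>R z) - f x)\<^sup>2) \<partial>lborel) \<partial>lborel)
      = (\<integral>\<^sup>+z. indicator (ball 0 1) z * (\<integral>\<^sup>+x. ennreal ((f (x + \<epsilon> k *\<^sub>R z) - f x)\<^sup>2) \<partial>lborel) \<partial>lborel)"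
      using \<epsilon>[of k] by (intro nn_integral_cong) (auto simp: indicator_def)
    finally have 2: "ennreal \<kappa> * locq (\<epsilon> k) f = (ennreal \<kappa> * ennreal (1 / (\<kappa> * \<epsilon> k ^ (DIM('a) + 2))) * ennreal (\<epsilon> k ^ DIM('a))) *
       (\<integral>\<^sup>+z. indicator (ball 0 1) z * (\<integral>\<^sup>+x. ennreal ((f (x + \<epsilon> k *\<^sub>R z) - f x)\<^sup>2) \<partial>lborel) \<partial>lborel)"
      unfolding locq_shift[OF f_measurable \<epsilon>] \<kappa>_def[symmetric] by (simp add: mult.assoc)
    have "ennreal \<kappa> * ennreal (1 / (\<kappa> * \<epsilon> k ^ (DIM('a) + 2))) * ennreal (\<epsilon> k ^ DIM('a)) = ennreal (1 / (\<epsilon> k)\<^sup>2)"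
      using \<kappa> \<epsilon>[of k] by (simp add: ennreal_mult[symmetric] power_add power2_eq_square)
    then show ?thesis using 1 2 by simp
  qed
  have G_int: "(\<integral>\<^sup>+p. G p \<partial>(lborel \<Otimes>\<^sub>M lborel)) = ennreal \<kappa> * (\<integral>\<^sup>+x. ennreal ((norm (g x))\<^sup>2) \<partial>lborel)"
  proof -
    have "(\<integral>\<^sup>+p. G p \<partial>(lborel \<Otimes>\<^sub>M lborel)) = (\<integral>\<^sup>+z. \<integral>\<^sup>+x. G (z, x) \<partial>lborel \<partial>lborel)"
      by (rule lborel.nn_integral_fst[symmetric]) measurable
    also have "\<dots> = (\<integral>\<^sup>+x. \<integral>\<^sup>+z. G (z, x) \<partial>lborel \<partial>lborel)"
      by (rule lborel_pair.Fubini') measurable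
    also have "\<dots> = (\<integral>\<^sup>+x. ennreal \<kappa> * ennreal ((norm (g x))\<^sup>2) \<partial>lborel)"
      using \<kappa> by (intro nn_integral_cong) (simp add: G_def moment2_def[symmetric] moment2_ballmom \<kappa>_def ennreal_mult)
    also have "\<dots> = ennreal \<kappa> * (\<integral>\<^sup>+x. ennreal ((norm (g x))\<^sup>2) \<partial>lborel)"
      by (rule nn_integral_cmult) measurable
    finally show ?thesis .
  qed
  have "(\<integral>\<^sup>+p. G p \<partial>(lborel \<Otimes>\<^sub>M lborel)) \<le> ennreal \<kappa> * B"
  proof (rule fatou_bound[where h=F])
    show "\<forall>\<^sub>F k in sequentially. (\<integral>\<^sup>+p. F k p \<partial>(lborel \<Otimes>\<^sub>M lborel)) \<le> ennreal \<kappa> * B"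
      using B \<epsilon> by (simp add: F_int mult_left_mono)
    have "(\<lambda>k. F k p) \<longlonglongrightarrow> G p" for p
    proof -
      obtain z x where p: "p = (z, x)" by (cases p)
      have "((\<lambda>t. f (x + t *\<^sub>R z)) has_derivative (\<lambda>t. g (x + 0 *\<^sub>R z) \<bullet> (t *\<^sub>R z))) (at 0)"
        by (rule has_derivative_compose[OF _ der]) (auto intro!: derivative_eq_intros)
      then have "((\<lambda>t. f (x + t *\<^sub>R z)) has_real_derivative g x \<bullet> z) (at 0)"
        unfolding has_field_derivative_def by (simp add: mult_commute_abs)
      then have "((\<lambda>t. (f (x + t *\<^sub>R z) - f x) / t) \<longlongrightarrow> g x \<bullet> z) (at 0)"
        by (simp add: DERIV_def)
      then have "(\<lambda>k. (f (x + \<epsilon> k *\<^sub>R z) - f x) / \<epsilon> k) \<longlonglongrightarrow> g x \<bullet> z"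
        by (rule filterlim_compose[OF _ fl])
      then have "(\<lambda>k. ennreal (((f (x + \<epsilon> k *\<^sub>R z) - f x) / \<epsilon> k)\<^sup>2)) \<longlonglongrightarrow> ennreal ((g x \<bullet> z)\<^sup>2)"
        by (intro tendsto_intros)
      then show ?thesis unfolding p F_def G_def fst_conv snd_conv
        by (cases "z \<in> ball 0 1") simp_all
    qed
    then show "AE p in lborel \<Otimes>\<^sub>M lborel. (\<lambda>k. F k p) \<longlonglongrightarrow> G p" by simp
  qed measurable
  then have "ennreal \<kappa> * (\<integral>\<^sup>+x. ennreal ((norm (g x))\<^sup>2) \<partial>lborel) \<le> ennreal \<kappa> * B" by (simp add: G_int)
  then show ?thesis using \<kappa> by (subst (asm) ennreal_mult_le_mult_iff) auto
qed

text \<open>The difference quotients have integral zero by translation invariance.\<close>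
lemma integral_derivative_zero:
  assumes supp: "\<And>x. norm x \<ge> R \<Longrightarrow> f x = 0" and i: "norm i = 1"
  shows "(\<integral>x. g x \<bullet> i \<partial>lborel) = 0"
proof -
  define D where "D n x = (f (x + (1 / real (Suc n)) *\<^sub>R i) - f x) * real (Suc n)" for n x
  have "bounded (g ` cball 0 (R + 2))"
    using cont by (intro compact_imp_bounded compact_continuous_image continuous_on_subset[OF cont]) auto
  then obtain B where B: "\<And>x. x \<in> cball 0 (R + 2) \<Longrightarrow> norm (g x) \<le> B" unfolding bounded_iff by blast
  \<comment> \<open>The shift has length at most 1. Outside radius R + 1 both values of
    \<open>f\<close> vanish; inside it the segment stays within R + 2, where the gradient is
    bounded.\<close>
  have bnd: "norm (D n x) \<le> indicator (cball 0 (R + 1)) x * \<bar>B\<bar>" for n x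
  proof (cases "norm x \<le> R + 1")
    case True
    define t where "t = 1 / real (Suc n)"
    have t: "0 < t" "t \<le> 1" by (auto simp: t_def)
    have "norm (f (x + t *\<^sub>R i) - f x) \<le> \<bar>B\<bar> * norm ((x + t *\<^sub>R i) - x)"
    proof (rule differentiable_bound[of "cball 0 (R + 2)" f "\<lambda>y h. g y \<bullet> h"])
      show "x \<in> cball 0 (R + 2)" using True by simp
      show "x + t *\<^sub>R i \<in> cball 0 (R + 2)"
        using True norm_triangle_ineq[of x "t *\<^sub>R i"] i t by simp
      show "(f has_derivative (\<lambda>h. g y \<bullet> h)) (at y within cball 0 (R + 2))" for y
        by (rule has_derivative_at_withinI[OF der])
      show "onorm (\<lambda>h. g y \<bullet> h) \<le> \<bar>B\<bar>" if "y \<in> cball 0 (R + 2)" for y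
        using onorm_inner_right[OF bounded_linear_ident, of "g y"] B[OF that] by (auto simp: onorm_id intro: order_trans)
    qed simp
    then have "norm (f (x + t *\<^sub>R i) - f x) \<le> \<bar>B\<bar> * t" using i t by simp
    then show ?thesis using True t by (simp add: D_def t_def[symmetric] abs_mult) (simp add: t_def field_simps)
  next
    case False
    have "norm (x + (1 / real (Suc n)) *\<^sub>R i) \<ge> norm x - 1"
    proof -
      have "norm ((1 / real (Suc n)) *\<^sub>R i) \<le> 1" using i by simp
      then show ?thesis using norm_diff_ineq[of x "(1 / real (Suc n)) *\<^sub>R i"] by linarith
    qed
    then have "f (x + (1 / real (Suc n)) *\<^sub>R i) = 0" using False by (intro supp) simp
    moreover have "f x = 0" using False by (intro supp) simp
    ultimately show ?thesis by (simp add: D_def)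
  qed
  have [measurable]: "D n \<in> borel_measurable borel" for n unfolding D_def by measurable
  have lim: "(\<lambda>n. \<integral>x. D n x \<partial>lborel) \<longlonglongrightarrow> (\<integral>x. g x \<bullet> i \<partial>lborel)"
  proof (rule integral_dominated_convergence)
    show "integrable lborel (\<lambda>x. indicator (cball (0::'a) (R + 1)) x * \<bar>B\<bar>)"
      using emeasure_lborel_cball_finite[of "0::'a" "R + 1"]
      by (intro integrable_mult_left integrable_real_indicator) auto
    have "(\<lambda>n. D n x) \<longlonglongrightarrow> g x \<bullet> i" for x
    proof -
      have "((\<lambda>t. f (x + t *\<^sub>R i)) has_derivative (\<lambda>t. g (x + 0 *\<^sub>R i) \<bullet> (t *\<^sub>R i))) (at 0)"
        by (rule has_derivative_compose[OF _ der]) (auto intro!: derivative_eq_intros)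
      then have "((\<lambda>t. f (x + t *\<^sub>R i)) has_real_derivative g x \<bullet> i) (at 0)"
        unfolding has_field_derivative_def by (simp add: mult_commute_abs)
      then have "((\<lambda>t. (f (x + t *\<^sub>R i) - f x) / t) \<longlongrightarrow> g x \<bullet> i) (at 0)"
        by (simp add: DERIV_def)
      moreover have "filterlim (\<lambda>n. 1 / real (Suc n)) (at 0) sequentially"
        using LIMSEQ_inverse_real_of_nat by (auto simp: filterlim_at inverse_eq_divide)
      ultimately have "(\<lambda>n. (f (x + (1 / real (Suc n)) *\<^sub>R i) - f x) / (1 / real (Suc n))) \<longlonglongrightarrow> g x \<bullet> i"
        by (rule filterlim_compose)
      then show ?thesis by (simp add: D_def)
    qed
    then show "AE x in lborel. (\<lambda>n. D n x) \<longlonglongrightarrow> g x \<bullet> i" by simp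
    show "AE x in lborel. norm (D n x) \<le> indicator (cball 0 (R + 1)) x * \<bar>B\<bar>" for n using bnd by simp
  qed measurable
  have "integrable lborel f"
  proof (rule integrable_of_sq_bounded[where R="R"])
    show "(\<integral>\<^sup>+x. ennreal ((f x)\<^sup>2) \<partial>lborel) < \<infinity>"
      using cont_f supp by (rule nn_integral_sq_finite)
  qed (use supp in auto)
  then have "(\<integral>x. D n x \<partial>lborel) = 0" for n
    unfolding D_def using integral_lborel_add[of f "(1 / real (Suc n)) *\<^sub>R i"] integrable_lborel_add[of f "(1 / real (Suc n)) *\<^sub>R i"]
    by (simp add: Bochner_Integration.integral_diff)
  then show ?thesis using lim by (simp add: LIMSEQ_const_iff)
qed

end

section \<open>Existence of weak gradients\<close>

lemma integrable_mult_L2: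
  fixes f g :: "'a \<Rightarrow> real"
  assumes [measurable]: "f \<in> borel_measurable M" "g \<in> borel_measurable M"
    and f: "(\<integral>\<^sup>+x. ennreal ((f x)\<^sup>2) \<partial>M) < \<infinity>" and g: "(\<integral>\<^sup>+x. ennreal ((g x)\<^sup>2) \<partial>M) < \<infinity>"
  shows "integrable M (\<lambda>x. f x * g x)"
proof (rule Bochner_Integration.integrable_bound)
  show "integrable M (\<lambda>x. (f x)\<^sup>2 + (g x)\<^sup>2)"
    using f g by (intro Bochner_Integration.integrable_add integrable_sq_nn_integral) auto
  have "\<bar>a * b\<bar> \<le> a\<^sup>2 + b\<^sup>2" for a b :: real
  proof -
    have "2 * (\<bar>a\<bar> * \<bar>b\<bar>) \<le> a\<^sup>2 + b\<^sup>2"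
      using sum_squares_bound[of "\<bar>a\<bar>" "\<bar>b\<bar>"] by (simp add: mult.assoc)
    moreover have "0 \<le> \<bar>a\<bar> * \<bar>b\<bar>" by simp
    ultimately show ?thesis unfolding abs_mult by linarith
  qed
  then show "AE x in M. norm (f x * g x) \<le> norm ((f x)\<^sup>2 + (g x)\<^sup>2)" by simp
qed simp

lemma L2_pairing_tendsto:
  fixes f :: "nat \<Rightarrow> 'a \<Rightarrow> real"
  assumes [measurable]: "\<And>k. f k \<in> borel_measurable M" "g \<in> borel_measurable M" "\<psi> \<in> borel_measurable M"
    and fin: "\<And>k. (\<integral>\<^sup>+x. ennreal ((f k x)\<^sup>2) \<partial>M) < \<infinity>" "(\<integral>\<^sup>+x. ennreal ((g x)\<^sup>2) \<partial>M) < \<infinity>"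
      "(\<integral>\<^sup>+x. ennreal ((\<psi> x)\<^sup>2) \<partial>M) < \<infinity>"
    and lim: "(\<lambda>k. \<integral>\<^sup>+x. ennreal ((f k x - g x)\<^sup>2) \<partial>M) \<longlonglongrightarrow> 0"
  shows "(\<lambda>k. \<integral>x. f k x * \<psi> x \<partial>M) \<longlonglongrightarrow> (\<integral>x. g x * \<psi> x \<partial>M)"
proof -
  define d where "d k = (\<integral>x. f k x * \<psi> x \<partial>M) - (\<integral>x. g x * \<psi> x \<partial>M)" for k
  define Y where "Y = (\<integral>\<^sup>+x. ennreal ((\<psi> x)\<^sup>2) \<partial>M)"
  have le: "ennreal ((d k)\<^sup>2) \<le> (\<integral>\<^sup>+x. ennreal ((f k x - g x)\<^sup>2) \<partial>M) * Y" for k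
  proof -
    have i: "integrable M (\<lambda>x. f k x * \<psi> x)" "integrable M (\<lambda>x. g x * \<psi> x)"
      using fin by (auto intro!: integrable_mult_L2)
    have d: "d k = (\<integral>x. (f k x - g x) * \<psi> x \<partial>M)" using i by (simp add: d_def left_diff_distrib)
    have "ennreal \<bar>d k\<bar> \<le> (\<integral>\<^sup>+x. ennreal \<bar>(f k x - g x) * \<psi> x\<bar> \<partial>M)"
      unfolding d using integral_norm_bound_ennreal[of M "\<lambda>x. (f k x - g x) * \<psi> x"] i by (simp add: left_diff_distrib)
    then have "(ennreal \<bar>d k\<bar>)\<^sup>2 \<le> (\<integral>\<^sup>+x. ennreal \<bar>f k x - g x\<bar> * ennreal \<bar>\<psi> x\<bar> \<partial>M)\<^sup>2"
      by (intro power_mono) (auto simp: abs_mult ennreal_mult)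
    also have "\<dots> \<le> (\<integral>\<^sup>+x. (ennreal \<bar>f k x - g x\<bar>)\<^sup>2 \<partial>M) * (\<integral>\<^sup>+x. (ennreal \<bar>\<psi> x\<bar>)\<^sup>2 \<partial>M)"
      by (rule Cauchy_Schwarz_nn_integral) auto
    finally show ?thesis by (simp add: ennreal_power Y_def)
  qed
  have "(\<lambda>k. (\<integral>\<^sup>+x. ennreal ((f k x - g x)\<^sup>2) \<partial>M) * Y) \<longlonglongrightarrow> 0 * Y"
    using fin(3) by (intro tendsto_mult_ennreal lim tendsto_const) (auto simp: Y_def)
  then have "(\<lambda>k. (\<integral>\<^sup>+x. ennreal ((f k x - g x)\<^sup>2) \<partial>M) * Y) \<longlonglongrightarrow> 0" by simp
  then have "(\<lambda>k. ennreal ((d k)\<^sup>2)) \<longlonglongrightarrow> 0"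
    by (rule tendsto_sandwich[OF _ _ tendsto_const, rotated 2]) (auto simp: le)
  then have "(\<lambda>k. (d k)\<^sup>2) \<longlonglongrightarrow> 0" by (simp add: tendsto_ennreal_iff[where x=0, simplified])
  then have "(\<lambda>k. sqrt ((d k)\<^sup>2)) \<longlonglongrightarrow> sqrt 0" by (rule tendsto_real_sqrt)
  then have "d \<longlonglongrightarrow> 0" by (simp add: tendsto_rabs_zero_iff)
  then have "(\<lambda>k. d k + (\<integral>x. g x * \<psi> x \<partial>M)) \<longlonglongrightarrow> 0 + (\<integral>x. g x * \<psi> x \<partial>M)" by (intro tendsto_intros)
  then show ?thesis by (simp add: d_def)
qed

lemma Cc1_test_support:
  assumes "Cc1_test \<phi> \<phi>'"
  obtains R where "\<And>x. norm x \<ge> R \<Longrightarrow> \<phi> x = 0" "\<And>x. norm x \<ge> R \<Longrightarrow> \<phi>' x = 0"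
proof -
  define S where "S = closure {x. \<phi> x \<noteq> 0}"
  have der: "\<And>x. (\<phi> has_derivative (\<lambda>h. \<phi>' x \<bullet> h)) (at x)" and S: "compact S"
    using assms by (auto simp: Cc1_test_def S_def)
  obtain R where R: "\<And>x. x \<in> S \<Longrightarrow> norm x \<le> R" using compact_imp_bounded[OF S] by (auto simp: bounded_iff)
  have 0: "\<phi> x = 0" if "x \<notin> S" for x using that closure_subset[of "{x. \<phi> x \<noteq> 0}"] by (auto simp: S_def)
  have out: "x \<notin> S" if "norm x \<ge> R + 1" for x using R[of x] that by force
  have "\<phi>' x = 0" if "x \<notin> S" for x
  proof -
    have "((\<lambda>_. 0) has_derivative (\<lambda>h. \<phi>' x \<bullet> h)) (at x)"
      by (rule has_derivative_transform_within_open[OF der[of x], of "- S"])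
         (use that 0 S in \<open>auto simp: compact_imp_closed open_Compl\<close>)
    then have "(\<lambda>h. \<phi>' x \<bullet> h) = (\<lambda>_. 0)" using has_derivative_unique has_derivative_const by blast
    then have "\<phi>' x \<bullet> \<phi>' x = 0" by metis
    then show ?thesis by simp
  qed
  then show ?thesis using that[of "R + 1"] 0 out by blast
qed

text \<open>The product with the test function has compact support and class C1, so the integral of
  its derivative vanishes; the product rule splits it.\<close>

lemma (in C1_fun) integral_by_parts:
  assumes \<phi>: "Cc1_test \<phi> \<phi>'" and i: "norm i = 1"
  shows "(\<integral>x. f x * (\<phi>' x \<bullet> i) \<partial>lborel) = - (\<integral>x. (g x \<bullet> i) * \<phi> x \<partial>lborel)"
proof -
  obtain R where R: "\<And>x. norm x \<ge> R \<Longrightarrow> \<phi> x = 0" "\<And>x. norm x \<ge> R \<Longrightarrow> \<phi>' x = 0"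
    using Cc1_test_support[OF \<phi>] by blast
  interpret p: C1_fun \<phi> \<phi>' using \<phi> by unfold_locales (auto simp: Cc1_test_def)
  interpret F: C1_fun "\<lambda>x. f x * \<phi> x" "\<lambda>x. f x *\<^sub>R \<phi>' x + \<phi> x *\<^sub>R g x"
  proof
    fix x
    show "((\<lambda>x. f x * \<phi> x) has_derivative (\<lambda>h. (f x *\<^sub>R \<phi>' x + \<phi> x *\<^sub>R g x) \<bullet> h)) (at x)"
      by (rule has_derivative_eq_rhs[OF has_derivative_mult[OF der[of x] p.der[of x]]])
         (auto simp: inner_add_left algebra_simps)
    show "continuous_on UNIV (\<lambda>x. f x *\<^sub>R \<phi>' x + \<phi> x *\<^sub>R g x)"
      by (intro continuous_intros cont cont_f p.cont p.cont_f)
  qed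
  have int: "integrable lborel h" if h: "continuous_on UNIV h" "\<And>x. norm x \<ge> R \<Longrightarrow> h x = 0" for h :: "'a \<Rightarrow> real"
    using nn_integral_sq_finite[OF h] h
    by (intro integrable_of_sq_bounded[where R=R] borel_measurable_continuous_onI) auto
  have "(\<integral>x. (f x *\<^sub>R \<phi>' x + \<phi> x *\<^sub>R g x) \<bullet> i \<partial>lborel) = 0"
    by (rule F.integral_derivative_zero[of R]) (use R i in auto)
  also have "(\<lambda>x. (f x *\<^sub>R \<phi>' x + \<phi> x *\<^sub>R g x) \<bullet> i) = (\<lambda>x. f x * (\<phi>' x \<bullet> i) + (g x \<bullet> i) * \<phi> x)"
    by (auto simp: inner_add_left)
  also have "(\<integral>x. f x * (\<phi>' x \<bullet> i) + (g x \<bullet> i) * \<phi> x \<partial>lborel) = (\<integral>x. f x * (\<phi>' x \<bullet> i) \<partial>lborel) + (\<integral>x. (g x \<bullet> i) * \<phi> x \<partial>lborel)"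
    by (intro Bochner_Integration.integral_add int continuous_intros cont cont_f p.cont p.cont_f) (use R in auto)
  finally show ?thesis by simp
qed

section \<open>Strong convergence of the mollified gradients\<close>

lemma locq_le_L2:
  assumes \<epsilon>: "\<epsilon> > 0"
  obtains K where "K \<ge> 0" "\<And>w::'a::euclidean_space \<Rightarrow> real. w \<in> borel_measurable borel \<Longrightarrow>
    locq \<epsilon> w \<le> ennreal K * (\<integral>\<^sup>+x. ennreal ((w x)\<^sup>2) \<partial>lborel)"
proof -
  define c where "c = 1 / (ballmom TYPE('a) * \<epsilon> ^ (DIM('a) + 2))"
  have c: "c \<ge> 0" using ballmom_pos[where 'a='a] \<epsilon> by (simp add: c_def)
  define b where "b = measure lborel (ball (0::'a) \<epsilon>)"
  have b: "emeasure lborel (ball (0::'a) \<epsilon>) = ennreal b" "b \<ge> 0"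
    using emeasure_lborel_ball_finite[of "0::'a" \<epsilon>] by (auto simp: b_def emeasure_eq_ennreal_measure)
  have "locq \<epsilon> w \<le> ennreal (c * b * 4) * (\<integral>\<^sup>+x. ennreal ((w x)\<^sup>2) \<partial>lborel)"
    if [measurable]: "w \<in> borel_measurable borel" for w :: "'a \<Rightarrow> real"
  proof -
    define I where "I = (\<integral>\<^sup>+x. ennreal ((w x)\<^sup>2) \<partial>lborel)"
    have "(\<integral>\<^sup>+x. ennreal ((w (x + h) - w x)\<^sup>2) \<partial>lborel) \<le> 4 * I" for h
    proof -
      have "ennreal ((w (x + h) - w x)\<^sup>2) \<le> 2 * ennreal ((w (x + h))\<^sup>2) + 2 * ennreal ((w x)\<^sup>2)" for x
      proof -
        have "(w (x + h) - w x)\<^sup>2 \<le> 2 * (w (x + h))\<^sup>2 + 2 * (w x)\<^sup>2"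
          using zero_le_power2[of "w (x + h) + w x"] unfolding power2_diff power2_sum by linarith
        then show ?thesis
          by (simp add: ennreal_plus[symmetric] ennreal_mult''[symmetric] ennreal_leI flip: ennreal_numeral del: ennreal_plus)
      qed
      then have "(\<integral>\<^sup>+x. ennreal ((w (x + h) - w x)\<^sup>2) \<partial>lborel) \<le> (\<integral>\<^sup>+x. 2 * ennreal ((w (x + h))\<^sup>2) + 2 * ennreal ((w x)\<^sup>2) \<partial>lborel)"
        by (intro nn_integral_mono)
      also have "\<dots> = 2 * I + 2 * I"
        using nn_integral_lborel_add[of "\<lambda>x. ennreal ((w x)\<^sup>2)" h]
        by (simp add: nn_integral_add nn_integral_cmult I_def)
      also have "\<dots> = 4 * I" by (simp add: distrib_right[symmetric])
      finally show ?thesis .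
    qed
    then have "locq \<epsilon> w \<le> ennreal c * (\<integral>\<^sup>+h. indicator (ball (0::'a) \<epsilon>) h * (4 * I) \<partial>lborel)"
      unfolding locq_shift[OF that \<epsilon>] c_def[symmetric] by (intro mult_left_mono nn_integral_mono) auto
    also have "(\<integral>\<^sup>+h. indicator (ball (0::'a) \<epsilon>) h * (4 * I) \<partial>lborel) = ennreal b * (4 * I)"
      by (subst nn_integral_multc) (auto simp: b)
    also have "ennreal c * (ennreal b * (4 * I)) = ennreal (c * b * 4) * I"
      using b c by (simp add: ennreal_mult mult.assoc flip: ennreal_numeral)
    finally show ?thesis by (simp add: I_def)
  qed
  then show ?thesis using that[of "c * b * 4"] b c by simp
qed

text \<open>Young's inequality with a free parameter: a small \<tau> keeps the factor of the main
  part near 1, at the cost of a large factor on the part that is made small.\<close>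

lemma qform_add_le:
  assumes [measurable]: "a \<in> borel_measurable borel" "b \<in> borel_measurable borel" "k \<in> borel_measurable borel"
    and k: "\<And>r. k r \<ge> 0" and \<tau>: "\<tau> > 0"
  shows "qform k (\<lambda>x. a x + b x) \<le> ennreal (1 + \<tau>) * qform k a + ennreal (1 + 1 / \<tau>) * qform k b"
proof -
  have "ennreal ((a x + b x - (a y + b y))\<^sup>2 * k (norm (x - y)))
     \<le> ennreal (1 + \<tau>) * ennreal ((a x - a y)\<^sup>2 * k (norm (x - y))) + ennreal (1 + 1 / \<tau>) * ennreal ((b x - b y)\<^sup>2 * k (norm (x - y)))" for x y
  proof -
    define p q where "p = a x - a y" and "q = b x - b y"
    have "0 \<le> (\<tau> * p - q)\<^sup>2 / \<tau>" using \<tau> by simp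
    also have "\<dots> = \<tau> * p\<^sup>2 + 1 / \<tau> * q\<^sup>2 - 2 * p * q"
      using \<tau> by (simp add: power2_eq_square field_simps)
    finally have "(p + q)\<^sup>2 \<le> (1 + \<tau>) * p\<^sup>2 + (1 + 1 / \<tau>) * q\<^sup>2"
      unfolding power2_sum by (simp add: algebra_simps)
    then have "(p + q)\<^sup>2 * k (norm (x - y)) \<le> ((1 + \<tau>) * p\<^sup>2 + (1 + 1 / \<tau>) * q\<^sup>2) * k (norm (x - y))"
      using k by (rule mult_right_mono)
    also have "\<dots> = (1 + \<tau>) * (p\<^sup>2 * k (norm (x - y))) + (1 + 1 / \<tau>) * (q\<^sup>2 * k (norm (x - y)))"
      by (simp add: distrib_right mult.assoc)
    finally have "ennreal ((p + q)\<^sup>2 * k (norm (x - y))) \<le> ennreal ((1 + \<tau>) * (p\<^sup>2 * k (norm (x - y))) + (1 + 1 / \<tau>) * (q\<^sup>2 * k (norm (x - y))))"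
      by (rule ennreal_leI)
    also have "\<dots> = ennreal (1 + \<tau>) * ennreal (p\<^sup>2 * k (norm (x - y))) + ennreal (1 + 1 / \<tau>) * ennreal (q\<^sup>2 * k (norm (x - y)))"
      using k \<tau> by (subst ennreal_plus) (auto simp: ennreal_mult add_nonneg_nonneg simp del: ennreal_plus)
    finally show ?thesis by (simp add: p_def q_def algebra_simps)
  qed
  then have "qform k (\<lambda>x. a x + b x) \<le> (\<integral>\<^sup>+x. \<integral>\<^sup>+y. ennreal (1 + \<tau>) * ennreal ((a x - a y)\<^sup>2 * k (norm (x - y))) + ennreal (1 + 1 / \<tau>) * ennreal ((b x - b y)\<^sup>2 * k (norm (x - y))) \<partial>lborel \<partial>lborel)"
    unfolding qform_def by (intro nn_integral_mono)
  also have "\<dots> = (\<integral>\<^sup>+x. ennreal (1 + \<tau>) * (\<integral>\<^sup>+y. ennreal ((a x - a y)\<^sup>2 * k (norm (x - y))) \<partial>lborel) + ennreal (1 + 1 / \<tau>) * (\<integral>\<^sup>+y. ennreal ((b x - b y)\<^sup>2 * k (norm (x - y))) \<partial>lborel) \<partial>lborel)"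
    by (simp add: nn_integral_add nn_integral_cmult)
  also have "\<dots> = ennreal (1 + \<tau>) * qform k a + ennreal (1 + 1 / \<tau>) * qform k b"
    by (simp add: nn_integral_add nn_integral_cmult qform_def)
  finally show ?thesis .
qed

lemma C1_fun_mconv:
  assumes "\<delta> > 0" "integrable lborel u"
  shows "C1_fun (mconv \<delta> u) (mconvg \<delta> u)"
  using assms by unfold_locales (auto intro: mconv_has_derivative continuous_mconvg)

lemma C1_fun_add: "C1_fun f g \<Longrightarrow> C1_fun f' g' \<Longrightarrow> C1_fun (\<lambda>x. f x + f' x) (\<lambda>x. g x + g' x)"
  unfolding C1_fun_def by (auto intro!: continuous_intros derivative_eq_intros simp: inner_add_left)

text \<open>Uniform convexity takes the place of weak compactness. With \<open>D\<close> the value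
  of \<open>dirichlet v\<close>, every mollified gradient has squared L2 norm at most
  \<open>D\<close>. The sum of two mollifications is close to \<open>2 v\<close> in L2, so its form
  at a fixed scale, and hence its squared gradient norm, is nearly at least \<open>4 D\<close>; the
  parallelogram law leaves little for the difference.\<close>

lemma mconvg_Cauchy:
  fixes v :: "'a::euclidean_space \<Rightarrow> real"
  assumes s: "s > 0" and vm[measurable]: "v \<in> borel_measurable borel" and vi: "integrable lborel v"
    and fin: "gagl s v < \<infinity>" "dirichlet v < \<infinity>" and \<eta>: "\<eta> > 0"
  shows "\<exists>N. \<forall>m\<ge>N. \<forall>n\<ge>N. (\<integral>\<^sup>+x. ennreal ((norm (mconvg ((1/2)^m) v x - mconvg ((1/2)^n) v x))\<^sup>2) \<partial>lborel) \<le> ennreal \<eta>"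
proof -
  let ?f = "\<lambda>k. mconv ((1/2)^k) v" and ?g = "\<lambda>k. mconvg ((1/2)^k) v"
  define D where "D = enn2real (dirichlet v)"
  have D: "dirichlet v = ennreal D" "D \<ge> 0" using fin by (auto simp: D_def)
  have C1: "C1_fun (?f k) (?g k)" for k by (rule C1_fun_mconv[OF _ vi]) simp
  have gD: "(\<integral>\<^sup>+x. ennreal ((norm (?g k x))\<^sup>2) \<partial>lborel) \<le> ennreal D" for k
    unfolding D(1)[symmetric]
    by (rule C1_fun.gradient_le_locq[OF C1]) (meson locq_mconv_le locq_le_dirichlet order_trans vi zero_less_power half_gt_zero zero_less_one)
  \<comment> \<open>The budget is \<eta> / 4 for nearly attaining the supremum, \<eta> / 4 for the
    factor 1 + \<tau>, and \<eta> / 2 for the L2 error \<open>r\<close>. The summand 1 in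
    \<open>D + 1\<close> keeps a divisor positive, and that in \<open>K + 1\<close> does the same
    for \<open>Q\<close>.\<close>
  define \<eta>' where "\<eta>' = \<eta> / 16"
  have \<eta>': "\<eta>' > 0" using \<eta> by (simp add: \<eta>'_def)
  \<comment> \<open>The scale is fixed before the mollification index, because the constant
    \<open>K\<close> comparing \<open>locq \<epsilon>\<close> with the L2 norm depends on
    it.\<close>
  obtain \<epsilon> where \<epsilon>: "\<epsilon> > 0" "ennreal (D - \<eta>') \<le> locq \<epsilon> v"
  proof (cases "D - \<eta>' \<le> 0")
    case True
    then show ?thesis using that[of 1] by (simp add: ennreal_neg)
  next
    case False
    then have "ennreal (D - \<eta>') < (SUP \<epsilon>\<in>{0<..}. locq \<epsilon> v)"
      unfolding dirichlet_def[symmetric] D(1) using \<eta>' by (intro ennreal_lessI) auto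
    then show ?thesis unfolding less_SUP_iff using that by (auto intro: less_imp_le)
  qed
  obtain K where K: "K \<ge> 0" and Kw: "\<And>w::'a \<Rightarrow> real. w \<in> borel_measurable borel \<Longrightarrow>
    locq \<epsilon> w \<le> ennreal K * (\<integral>\<^sup>+x. ennreal ((w x)\<^sup>2) \<partial>lborel)"
    using locq_le_L2[OF \<epsilon>(1)] by blast
  define \<tau> where "\<tau> = \<eta>' / (D + 1)"
  have \<tau>: "\<tau> > 0" using \<eta>' D by (simp add: \<tau>_def)
  define Q where "Q = (1 + 1 / \<tau>) * (K + 1)"
  have Q: "Q > 0" using \<tau> K by (simp add: Q_def add_pos_pos)
  define r where "r = \<eta> / (8 * Q)"
  have r: "r > 0" using \<eta> Q by (simp add: r_def)
  obtain A \<theta> where A: "A \<ge> 0" "0 < \<theta>" "\<theta> < 1"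
    and bound: "\<And>k. (\<integral>\<^sup>+x. ennreal ((v x - ?f k x)\<^sup>2) \<partial>lborel) \<le> ennreal (A * \<theta> ^ k)"
    using mconv_L2_geometric[OF s vm fin(1)] by blast
  have "(\<lambda>k. A * \<theta> ^ k) \<longlonglongrightarrow> A * 0" using A by (intro tendsto_intros LIMSEQ_power_zero) auto
  then have "\<forall>\<^sub>F k in sequentially. A * \<theta> ^ k < r" using r by (intro order_tendstoD) auto
  then obtain N where N: "\<And>k. k \<ge> N \<Longrightarrow> A * \<theta> ^ k < r" by (auto simp: eventually_sequentially)
  have e: "(\<integral>\<^sup>+x. ennreal ((v x - ?f k x)\<^sup>2) \<partial>lborel) \<le> ennreal r" if "k \<ge> N" for k
    using bound[of k] N[OF that] by (meson ennreal_leI less_imp_le order_trans)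
  have "(\<integral>\<^sup>+x. ennreal ((norm (?g m x - ?g n x))\<^sup>2) \<partial>lborel) \<le> ennreal \<eta>" if mn: "m \<ge> N" "n \<ge> N" for m n
  proof -
    define X where "X = (\<integral>\<^sup>+x. ennreal ((norm (?g m x + ?g n x))\<^sup>2) \<partial>lborel)"
    define Z where "Z = (\<integral>\<^sup>+x. ennreal ((norm (?g m x - ?g n x))\<^sup>2) \<partial>lborel)"
    have "ennreal ((norm (a - b))\<^sup>2) + ennreal ((norm (a + b))\<^sup>2) = 2 * ennreal ((norm a)\<^sup>2) + 2 * ennreal ((norm b)\<^sup>2)" for a b :: 'a
    proof -
      have "(norm (a - b))\<^sup>2 + (norm (a + b))\<^sup>2 = 2 * (norm a)\<^sup>2 + 2 * (norm b)\<^sup>2"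
        unfolding power2_norm_eq_inner by (simp add: inner_diff_left inner_diff_right inner_add_left inner_add_right inner_commute)
      then show ?thesis
        by (simp add: ennreal_plus[symmetric] ennreal_mult''[symmetric] flip: ennreal_numeral del: ennreal_plus)
    qed
    then have "Z + X = (\<integral>\<^sup>+x. 2 * ennreal ((norm (?g m x))\<^sup>2) + 2 * ennreal ((norm (?g n x))\<^sup>2) \<partial>lborel)"
      unfolding Z_def X_def by (subst nn_integral_add[symmetric]) auto
    also have "\<dots> = 2 * (\<integral>\<^sup>+x. ennreal ((norm (?g m x))\<^sup>2) \<partial>lborel) + 2 * (\<integral>\<^sup>+x. ennreal ((norm (?g n x))\<^sup>2) \<partial>lborel)"
      by (simp add: nn_integral_add nn_integral_cmult)
    also have "\<dots> \<le> 2 * ennreal D + 2 * ennreal D"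
      by (intro add_mono mult_left_mono gD) auto
    also have "\<dots> = ennreal (4 * D)"
      using D(2) by (simp add: ennreal_plus[symmetric] ennreal_mult''[symmetric] flip: ennreal_numeral del: ennreal_plus)
    finally have ZX: "Z + X \<le> ennreal (4 * D)" .
    then have "Z < \<infinity>" "X < \<infinity>" by (auto simp: le_less_trans[OF _ ennreal_less_top] ennreal_add_eq_top less_top[symmetric] top_unique)
    then obtain z x where z: "Z = ennreal z" "z \<ge> 0" and x: "X = ennreal x" "x \<ge> 0"
      by (cases Z; cases X) auto
    have zx: "z + x \<le> 4 * D"
      using ZX z x D(2) by (simp add: ennreal_plus[symmetric] del: ennreal_plus)
    have fX: "locq \<epsilon> (\<lambda>y. ?f m y + ?f n y) \<le> X"
      unfolding X_def by (rule C1_fun.locq_le_gradient[OF C1_fun_add[OF C1 C1] \<epsilon>(1)])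
    \<comment> \<open>The error \<open>2 v - (f m + f n)\<close>: small in L2 and therefore small in
      \<open>locq \<epsilon>\<close>.\<close>
    define w where "w y = (v y - ?f m y) + (v y - ?f n y)" for y
    have [measurable]: "w \<in> borel_measurable borel" unfolding w_def by measurable
    have "(\<integral>\<^sup>+y. ennreal ((w y)\<^sup>2) \<partial>lborel) \<le> (\<integral>\<^sup>+y. 2 * ennreal ((v y - ?f m y)\<^sup>2) + 2 * ennreal ((v y - ?f n y)\<^sup>2) \<partial>lborel)"
    proof (rule nn_integral_mono)
      fix y
      have "(w y)\<^sup>2 \<le> 2 * (v y - ?f m y)\<^sup>2 + 2 * (v y - ?f n y)\<^sup>2"
        using zero_le_power2[of "(v y - ?f m y) - (v y - ?f n y)"] unfolding w_def power2_diff[of "v y - ?f m y"] power2_sum[of "v y - ?f m y"] by linarith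
      then show "ennreal ((w y)\<^sup>2) \<le> 2 * ennreal ((v y - ?f m y)\<^sup>2) + 2 * ennreal ((v y - ?f n y)\<^sup>2)"
        by (simp add: ennreal_plus[symmetric] ennreal_mult''[symmetric] ennreal_leI flip: ennreal_numeral del: ennreal_plus)
    qed
    also have "\<dots> = 2 * (\<integral>\<^sup>+y. ennreal ((v y - ?f m y)\<^sup>2) \<partial>lborel) + 2 * (\<integral>\<^sup>+y. ennreal ((v y - ?f n y)\<^sup>2) \<partial>lborel)"
      by (simp add: nn_integral_add nn_integral_cmult)
    also have "\<dots> \<le> 2 * ennreal r + 2 * ennreal r" using mn by (intro add_mono mult_left_mono e) auto
    also have "\<dots> = ennreal (4 * r)"
      using r by (simp add: ennreal_plus[symmetric] ennreal_mult''[symmetric] flip: ennreal_numeral del: ennreal_plus)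
    finally have w2: "(\<integral>\<^sup>+y. ennreal ((w y)\<^sup>2) \<partial>lborel) \<le> ennreal (4 * r)" .
    have wK: "locq \<epsilon> w \<le> ennreal (K * (4 * r))"
    proof -
      have "locq \<epsilon> w \<le> ennreal K * (\<integral>\<^sup>+y. ennreal ((w y)\<^sup>2) \<partial>lborel)" by (rule Kw) measurable
      also have "\<dots> \<le> ennreal K * ennreal (4 * r)" using w2 by (rule mult_left_mono) simp
      finally show ?thesis using K r by (simp add: ennreal_mult)
    qed
    have "ennreal (4 * (D - \<eta>')) = 4 * ennreal (D - \<eta>')"
      by (subst ennreal_mult') auto
    also have "\<dots> \<le> 4 * locq \<epsilon> v" using \<epsilon>(2) by (rule mult_left_mono) simp
    also have "\<dots> = locq \<epsilon> (\<lambda>y. 2 * v y)"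
      unfolding locq_def by (subst qform_cmult) auto
    also have "(\<lambda>y. 2 * v y) = (\<lambda>y. (?f m y + ?f n y) + w y)" by (auto simp: w_def)
    also have "locq \<epsilon> (\<lambda>y. (?f m y + ?f n y) + w y) \<le> ennreal (1 + \<tau>) * locq \<epsilon> (\<lambda>y. ?f m y + ?f n y) + ennreal (1 + 1 / \<tau>) * locq \<epsilon> w"
      unfolding locq_def by (rule qform_add_le) (auto simp: kloc_nonneg[OF \<epsilon>(1)] \<tau>)
    also have "\<dots> \<le> ennreal (1 + \<tau>) * ennreal x + ennreal (1 + 1 / \<tau>) * ennreal (K * (4 * r))"
      using fX wK unfolding x(1) by (intro add_mono mult_left_mono) auto
    also have "\<dots> = ennreal ((1 + \<tau>) * x + (1 + 1 / \<tau>) * (K * (4 * r)))"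
      using \<tau> x(2) K r by (subst ennreal_plus) (auto simp: ennreal_mult add_nonneg_nonneg simp del: ennreal_plus)
    finally have "ennreal (4 * (D - \<eta>')) \<le> ennreal ((1 + \<tau>) * x + (1 + 1 / \<tau>) * (K * (4 * r)))" .
    then have main: "4 * (D - \<eta>') \<le> (1 + \<tau>) * x + (1 + 1 / \<tau>) * (K * (4 * r))"
      using \<tau> x(2) K r by (subst (asm) ennreal_le_iff) (auto intro!: add_nonneg_nonneg mult_nonneg_nonneg)
    have "\<tau> * x \<le> \<tau> * (4 * D)" using zx z(2) \<tau> by (intro mult_left_mono) auto
    also have "\<dots> \<le> 4 * \<eta>'" using D(2) \<eta>' by (simp add: \<tau>_def field_simps)
    finally have t1: "\<tau> * x \<le> 4 * \<eta>'" .
    have "(1 + 1 / \<tau>) * (K * (4 * r)) \<le> (1 + 1 / \<tau>) * ((K + 1) * (4 * r))"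
      using \<tau> r by (intro mult_left_mono mult_right_mono) (auto simp: add_nonneg_nonneg)
    also have "\<dots> = 4 * r * Q" by (simp only: Q_def mult_ac)
    also have "\<dots> = \<eta> / 2" using Q by (simp add: r_def)
    finally have t2: "(1 + 1 / \<tau>) * (K * (4 * r)) \<le> \<eta> / 2" .
    have "z \<le> 4 * D - x" using zx by simp
    also have "\<dots> \<le> \<eta>"
    proof -
      define T where "T = (1 + 1 / \<tau>) * (K * (4 * r))"
      define y where "y = \<tau> * x"
      have "4 * D - 4 * \<eta>' \<le> x + y + T" using main by (simp add: T_def y_def distrib_right)
      moreover have "T \<le> \<eta> / 2" using t2 by (simp only: T_def)
      moreover have "y \<le> \<eta> / 4" "4 * \<eta>' = \<eta> / 4" using t1 by (simp_all add: y_def \<eta>'_def)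
      ultimately show ?thesis by linarith
    qed
    finally show ?thesis using z(1) by (simp add: Z_def[symmetric] ennreal_leI)
  qed
  then show ?thesis by blast
qed

text \<open>The gradients of the mollifications converge strongly in L2. Integration by parts for
  each mollification passes to the limit on both sides, and Fatou keeps the bound by
  \<open>dirichlet v\<close>.\<close>

theorem weak_gradient_exists:
  fixes v :: "'a::euclidean_space \<Rightarrow> real"
  assumes s: "s > 0" and vm[measurable]: "v \<in> borel_measurable borel"
    and supp: "\<And>x. x \<notin> ball 0 R \<Longrightarrow> v x = 0" and v2: "(\<integral>\<^sup>+x. ennreal ((v x)\<^sup>2) \<partial>lborel) < \<infinity>"
    and fin: "gagl s v < \<infinity>" "dirichlet v < \<infinity>"
  obtains G where "G \<in> borel_measurable borel" "(\<integral>\<^sup>+x. ennreal ((norm (G x))\<^sup>2) \<partial>lborel) \<le> dirichlet v"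
    "weak_gradient v G"
proof -
  let ?f = "\<lambda>k. mconv ((1/2)^k) v" and ?g = "\<lambda>k. mconvg ((1/2)^k) v"
  have vi: "integrable lborel v" by (rule integrable_of_sq_bounded[OF vm supp v2])
  have C1: "C1_fun (?f k) (?g k)" for k by (rule C1_fun_mconv[OF _ vi]) simp
  have gD: "(\<integral>\<^sup>+x. ennreal ((norm (?g k x))\<^sup>2) \<partial>lborel) \<le> dirichlet v" for k
    by (rule C1_fun.gradient_le_locq[OF C1]) (meson locq_mconv_le locq_le_dirichlet order_trans vi zero_less_power half_gt_zero zero_less_one)
  obtain G \<phi> where \<phi>: "strict_mono \<phi>" and G[measurable]: "G \<in> borel_measurable borel"
    and AE: "AE x in lborel. (\<lambda>n. ?g (\<phi> n) x) \<longlonglongrightarrow> G x"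
    and lim: "(\<lambda>n. \<integral>\<^sup>+x. ennreal ((norm (?g n x - G x))\<^sup>2) \<partial>lborel) \<longlonglongrightarrow> 0"
    using mconvg_Cauchy[OF s vm vi fin] by (rule L2_complete[rotated]) auto
  have G2: "(\<integral>\<^sup>+x. ennreal ((norm (G x))\<^sup>2) \<partial>lborel) \<le> dirichlet v"
  proof (rule fatou_bound)
    show "AE x in lborel. (\<lambda>n. ennreal ((norm (?g (\<phi> n) x))\<^sup>2)) \<longlonglongrightarrow> ennreal ((norm (G x))\<^sup>2)"
      using AE by eventually_elim (intro tendsto_intros)
  qed (use gD in auto)
  obtain A \<theta> where A: "A \<ge> 0" "0 < \<theta>" "\<theta> < 1"
    and bound: "\<And>k. (\<integral>\<^sup>+x. ennreal ((v x - ?f k x)\<^sup>2) \<partial>lborel) \<le> ennreal (A * \<theta> ^ k)"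
    using mconv_L2_geometric[OF s vm fin(1)] by blast
  have flim: "(\<lambda>k. \<integral>\<^sup>+x. ennreal ((?f k x - v x)\<^sup>2) \<partial>lborel) \<longlonglongrightarrow> 0"
  proof (rule tendsto_sandwich[OF _ _ tendsto_const])
    have "(\<lambda>k. A * \<theta> ^ k) \<longlonglongrightarrow> A * 0" using A by (intro tendsto_intros LIMSEQ_power_zero) auto
    then show "(\<lambda>k. ennreal (A * \<theta> ^ k)) \<longlonglongrightarrow> 0" by (metis ennreal_0 mult_zero_right tendsto_ennrealI)
    show "\<forall>\<^sub>F k in sequentially. (\<integral>\<^sup>+x. ennreal ((?f k x - v x)\<^sup>2) \<partial>lborel) \<le> ennreal (A * \<theta> ^ k)"
      using bound by (simp add: power2_commute)
  qed simp
  have f2: "(\<integral>\<^sup>+x. ennreal ((?f k x)\<^sup>2) \<partial>lborel) < \<infinity>" for k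
  \<comment> \<open>All dyadic scales are at most 1, so mollification enlarges the support by at
    most 1.\<close>
  proof (rule nn_integral_sq_finite[where R="R + 1"])
    show "continuous_on UNIV (?f k)" by (rule C1_fun.cont_f[OF C1])
    fix x :: 'a assume x: "norm x \<ge> R + 1"
    have "moll ((1/2)^k) (x - y) * v y = 0" for y
    proof (cases "y \<in> ball 0 R")
      case True
      have "(1/2::real)^k \<le> 1" by (simp add: power_le_one)
      then have "(1/2::real)^k \<le> norm (x - y)" using True x norm_triangle_ineq2[of x y] by simp
      then show ?thesis using moll_zero[of "(1/2)^k" "x - y"] by simp
    qed (use supp in simp)
    then show "?f k x = 0" unfolding mconv_def by (simp only: Bochner_Integration.integral_zero)
  qed
  have "weak_gradient v G"
    unfolding weak_gradient_def
  proof (intro allI impI ballI)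
    fix \<psi> :: "'a \<Rightarrow> real" and \<psi>' and i :: 'a assume \<psi>: "Cc1_test \<psi> \<psi>'" and i: "i \<in> Basis"
    interpret p: C1_fun \<psi> \<psi>' using \<psi> by unfold_locales (auto simp: Cc1_test_def)
    obtain R' where R': "\<And>x. norm x \<ge> R' \<Longrightarrow> \<psi> x = 0" "\<And>x. norm x \<ge> R' \<Longrightarrow> \<psi>' x = 0"
      using Cc1_test_support[OF \<psi>] by blast
    have p2: "(\<integral>\<^sup>+x. ennreal ((\<psi> x)\<^sup>2) \<partial>lborel) < \<infinity>"
      by (rule nn_integral_sq_finite[where R=R', OF p.cont_f]) (use R' in auto)
    have p3: "(\<integral>\<^sup>+x. ennreal ((\<psi>' x \<bullet> i)\<^sup>2) \<partial>lborel) < \<infinity>"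
      by (rule nn_integral_sq_finite[where R=R']) (use R' in \<open>auto intro!: continuous_intros p.cont\<close>)
    have comp: "ennreal ((a \<bullet> i)\<^sup>2) \<le> ennreal ((norm a)\<^sup>2)" for a :: 'a
      using Basis_le_norm[OF i, of a] by (intro ennreal_leI) (metis abs_ge_zero power2_abs power_mono)
    have l1: "(\<lambda>k. \<integral>x. ?f k x * (\<psi>' x \<bullet> i) \<partial>lborel) \<longlonglongrightarrow> (\<integral>x. v x * (\<psi>' x \<bullet> i) \<partial>lborel)"
      by (rule L2_pairing_tendsto) (use f2 v2 p3 flim in auto)
    have l2: "(\<lambda>k. \<integral>x. (?g k x \<bullet> i) * \<psi> x \<partial>lborel) \<longlonglongrightarrow> (\<integral>x. (G x \<bullet> i) * \<psi> x \<partial>lborel)"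
    proof (rule L2_pairing_tendsto)
      have "(\<integral>\<^sup>+x. ennreal ((?g k x \<bullet> i)\<^sup>2) \<partial>lborel) \<le> (\<integral>\<^sup>+x. ennreal ((norm (?g k x))\<^sup>2) \<partial>lborel)" for k
        by (intro nn_integral_mono comp)
      then show "(\<integral>\<^sup>+x. ennreal ((?g k x \<bullet> i)\<^sup>2) \<partial>lborel) < \<infinity>" for k
        using gD[of k] fin(2) by (meson order_le_less_trans)
      have "(\<integral>\<^sup>+x. ennreal ((G x \<bullet> i)\<^sup>2) \<partial>lborel) \<le> (\<integral>\<^sup>+x. ennreal ((norm (G x))\<^sup>2) \<partial>lborel)"
        by (intro nn_integral_mono comp)
      then show "(\<integral>\<^sup>+x. ennreal ((G x \<bullet> i)\<^sup>2) \<partial>lborel) < \<infinity>"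
        using G2 fin(2) by (meson order_le_less_trans)
      show "(\<lambda>k. \<integral>\<^sup>+x. ennreal ((?g k x \<bullet> i - G x \<bullet> i)\<^sup>2) \<partial>lborel) \<longlonglongrightarrow> 0"
      proof (rule tendsto_sandwich[OF _ _ tendsto_const lim])
        show "\<forall>\<^sub>F k in sequentially. (\<integral>\<^sup>+x. ennreal ((?g k x \<bullet> i - G x \<bullet> i)\<^sup>2) \<partial>lborel) \<le> (\<integral>\<^sup>+x. ennreal ((norm (?g k x - G x))\<^sup>2) \<partial>lborel)"
          unfolding inner_diff_left[symmetric] by (intro always_eventually allI nn_integral_mono comp)
      qed simp
    qed (use p2 in auto)
    have "(\<integral>x. ?f k x * (\<psi>' x \<bullet> i) \<partial>lborel) = - (\<integral>x. (?g k x \<bullet> i) * \<psi> x \<partial>lborel)" for k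
      by (rule C1_fun.integral_by_parts[OF C1 \<psi>]) (use i in simp)
    then have "(\<lambda>k. \<integral>x. ?f k x * (\<psi>' x \<bullet> i) \<partial>lborel) \<longlonglongrightarrow> - (\<integral>x. (G x \<bullet> i) * \<psi> x \<partial>lborel)"
      using tendsto_minus[OF l2] by simp
    then have "(\<integral>x. v x * (\<psi>' x \<bullet> i) \<partial>lborel) = - (\<integral>x. (G x \<bullet> i) * \<psi> x \<partial>lborel)"
      using l1 LIMSEQ_unique by blast
    then show "(\<integral>x. v x * (\<psi>' x \<bullet> i) \<partial>lebesgue) = - (\<integral>x. (G x \<bullet> i) * \<psi> x \<partial>lebesgue)"
      by (simp add: integral_completion)
  qed
  then show ?thesis using that[OF G G2] by blast
qed

section \<open>Upper bound by weak gradients and domains with \<open>C\<^sup>1\<close> boundary\<close>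

text \<open>The definition of the weak gradient is used with the mollifier centred at
  \<open>x\<close> as test function; its gradient in \<open>y\<close> is
  \<open>- mollg \<delta> (x - y)\<close>.\<close>

lemma mconvg_weak_gradient:
  fixes u :: "'a::euclidean_space \<Rightarrow> real"
  assumes \<delta>: "\<delta> > 0" and u: "integrable lborel u" and [measurable]: "G \<in> borel_measurable borel"
    and w: "weak_gradient u G" and i: "i \<in> Basis"
  shows "mconvg \<delta> u x \<bullet> i = mconv \<delta> (\<lambda>y. G y \<bullet> i) x"
proof -
  have [measurable]: "u \<in> borel_measurable borel" using borel_measurable_integrable[OF u] by simp
  have "(\<integral>y. u y * ((- mollg \<delta> (x - y)) \<bullet> i) \<partial>lebesgue) = - (\<integral>y. (G y \<bullet> i) * moll \<delta> (x - y) \<partial>lebesgue)"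
    using w Cc1_test_moll[OF \<delta>, of x] i unfolding weak_gradient_def by blast
  then have "(\<integral>y. u y * ((- mollg \<delta> (x - y)) \<bullet> i) \<partial>lborel) = - (\<integral>y. (G y \<bullet> i) * moll \<delta> (x - y) \<partial>lborel)"
    by (simp add: integral_completion)
  then have "(\<integral>y. (u y *\<^sub>R mollg \<delta> (x - y)) \<bullet> i \<partial>lborel) = (\<integral>y. moll \<delta> (x - y) * (G y \<bullet> i) \<partial>lborel)"
    by (simp add: mult.commute)
  then show ?thesis
    unfolding mconvg_def mconv_def by (simp only: integral_inner_left[OF integrable_mollg_mult[OF \<delta> u, of x]])
qed

text \<open>By Jensen the squared gradient of a mollification is at most the mollified squared norm
  of \<open>G\<close>. At distance at least \<delta> from \<open>\<Omega>\<close> the mollified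
  gradient is zero, so only values of \<open>G\<close> within 2 \<delta> of \<open>\<Omega>\<close>
  enter, and these neighbourhoods shrink to the closure. Values of \<open>G\<close> farther out are
  thus discarded without a proof that they vanish.\<close>

theorem dirichlet_le_weak_gradient:
  fixes u :: "'a::euclidean_space \<Rightarrow> real"
  assumes s: "s > 0" and um[measurable]: "u \<in> borel_measurable borel" and Gm[measurable]: "G \<in> borel_measurable borel"
    and ne: "\<Omega> \<noteq> {}" and \<Omega>: "\<Omega> \<subseteq> ball 0 R"
    and supp: "\<And>x. x \<notin> \<Omega> \<Longrightarrow> u x = 0" and u2: "(\<integral>\<^sup>+x. ennreal ((u x)\<^sup>2) \<partial>lborel) < \<infinity>"
    and G2: "(\<integral>\<^sup>+x. ennreal ((norm (G x))\<^sup>2) \<partial>lborel) < \<infinity>"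
    and w: "weak_gradient u G" and fin: "gagl s u < \<infinity>"
  shows "dirichlet u \<le> (\<integral>\<^sup>+x. indicator (closure \<Omega>) x * ennreal ((norm (G x))\<^sup>2) \<partial>lborel)"
proof -
  let ?f = "\<lambda>k. mconv ((1/2)^k) u" and ?g = "\<lambda>k. mconvg ((1/2)^k) u"
  have ui: "integrable lborel u" by (rule integrable_of_sq_bounded[OF um _ u2, of R]) (rule supp, use \<Omega> in blast)
  have C1: "C1_fun (?f k) (?g k)" for k by (rule C1_fun_mconv[OF _ ui]) simp
  \<comment> \<open>The radius is 2 \<delta> because \<open>x\<close> lies within \<delta> of
    \<open>\<Omega>\<close> and \<open>y\<close> within \<delta> of \<open>x\<close>.\<close>
  define E where "E k = {y. infdist y \<Omega> \<le> 2 * (1/2)^k}" for k :: nat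
  have Em[measurable]: "E k \<in> sets borel" for k
    unfolding E_def by (intro borel_closed closed_Collect_le continuous_intros)
  define B where "B k = (\<integral>\<^sup>+y. indicator (E k) y * ennreal ((norm (G y))\<^sup>2) \<partial>lborel)" for k
  define L where "L = (\<integral>\<^sup>+x. indicator (closure \<Omega>) x * ennreal ((norm (G x))\<^sup>2) \<partial>lborel)"
  have gB: "(\<integral>\<^sup>+x. ennreal ((norm (?g k x))\<^sup>2) \<partial>lborel) \<le> B k" for k
  proof -
    define \<delta> where "\<delta> = (1/2::real)^k"
    have \<delta>: "\<delta> > 0" by (simp add: \<delta>_def)
    have pt: "ennreal ((norm (mconvg \<delta> u x))\<^sup>2) \<le> (\<integral>\<^sup>+y. ennreal (moll \<delta> (x - y)) * (indicator (E k) y * ennreal ((norm (G y))\<^sup>2)) \<partial>lborel)" for x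
    proof (cases "infdist x \<Omega> \<ge> \<delta>")
      case True
      have "u y *\<^sub>R mollg \<delta> (x - y) = 0" for y
      proof (cases "y \<in> \<Omega>")
        case y: True
        then have "\<delta> \<le> dist x y" using infdist_le[OF y, of x] True by linarith
        then show ?thesis using mollg_zero[OF \<delta>, of "x - y"] by (simp add: dist_norm)
      qed (simp add: supp)
      then have "mconvg \<delta> u x = 0" unfolding mconvg_def by (simp only: Bochner_Integration.integral_zero)
      then show ?thesis by simp
    next
      case False
      have sub: "ennreal (moll \<delta> (x - y)) * ennreal ((norm (G y))\<^sup>2) = ennreal (moll \<delta> (x - y)) * (indicator (E k) y * ennreal ((norm (G y))\<^sup>2))" for y
      proof (cases "y \<in> E k")
        case n: False
        have "\<delta> \<le> norm (x - y)"
          using infdist_triangle[of y \<Omega> x] n False by (simp add: E_def \<delta>_def[symmetric] dist_norm norm_minus_commute)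
        then show ?thesis using moll_zero[OF \<delta>, of "x - y"] by simp
      qed simp
      have "ennreal ((norm (mconvg \<delta> u x))\<^sup>2) = (\<Sum>i\<in>Basis. ennreal ((mconv \<delta> (\<lambda>y. G y \<bullet> i) x)\<^sup>2))"
      proof -
        have "(norm (mconvg \<delta> u x))\<^sup>2 = (\<Sum>i\<in>Basis. (mconvg \<delta> u x \<bullet> i)\<^sup>2)"
          unfolding power2_norm_eq_inner by (subst euclidean_inner) (simp add: power2_eq_square)
        also have "\<dots> = (\<Sum>i\<in>Basis. (mconv \<delta> (\<lambda>y. G y \<bullet> i) x)\<^sup>2)"
          using mconvg_weak_gradient[OF \<delta> ui Gm w] by simp
        finally show ?thesis by simp
      qed
      also have "\<dots> \<le> (\<Sum>i\<in>Basis. \<integral>\<^sup>+y. ennreal (moll \<delta> (x - y) * (G y \<bullet> i)\<^sup>2) \<partial>lborel)"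
      proof (rule sum_mono)
        fix i :: 'a assume "i \<in> Basis"
        have "ennreal ((0 - (\<integral>y. moll \<delta> (x - y) * (G y \<bullet> i) \<partial>lborel))\<^sup>2) \<le> (\<integral>\<^sup>+y. ennreal (moll \<delta> (x - y) * (0 - (G y \<bullet> i))\<^sup>2) \<partial>lborel)"
          by (rule jensen_sq) (auto simp: moll_nonneg[OF \<delta>] nn_integral_moll[OF \<delta>])
        then show "ennreal ((mconv \<delta> (\<lambda>y. G y \<bullet> i) x)\<^sup>2) \<le> (\<integral>\<^sup>+y. ennreal (moll \<delta> (x - y) * (G y \<bullet> i)\<^sup>2) \<partial>lborel)"
          by (simp add: mconv_def)
      qed
      also have "\<dots> = (\<integral>\<^sup>+y. (\<Sum>i\<in>Basis. ennreal (moll \<delta> (x - y) * (G y \<bullet> i)\<^sup>2)) \<partial>lborel)"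
        by (rule nn_integral_sum[symmetric]) auto
      also have "\<dots> = (\<integral>\<^sup>+y. ennreal (moll \<delta> (x - y)) * (indicator (E k) y * ennreal ((norm (G y))\<^sup>2)) \<partial>lborel)"
      proof (rule nn_integral_cong)
        fix y
        have "(\<Sum>i\<in>Basis. ennreal (moll \<delta> (x - y) * (G y \<bullet> i)\<^sup>2)) = ennreal (moll \<delta> (x - y) * (\<Sum>i\<in>Basis. (G y \<bullet> i)\<^sup>2))"
          using moll_nonneg[OF \<delta>, of "x - y"] by (simp add: sum_distrib_left)
        also have "(\<Sum>i\<in>Basis. (G y \<bullet> i)\<^sup>2) = (norm (G y))\<^sup>2"
          unfolding power2_norm_eq_inner by (subst euclidean_inner) (simp add: power2_eq_square)
        finally show "(\<Sum>i\<in>Basis. ennreal (moll \<delta> (x - y) * (G y \<bullet> i)\<^sup>2)) = ennreal (moll \<delta> (x - y)) * (indicator (E k) y * ennreal ((norm (G y))\<^sup>2))"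
          using moll_nonneg[OF \<delta>, of "x - y"] by (simp add: ennreal_mult sub[symmetric])
      qed
      finally show ?thesis .
    qed
    have "(\<integral>\<^sup>+x. ennreal ((norm (mconvg \<delta> u x))\<^sup>2) \<partial>lborel)
       \<le> (\<integral>\<^sup>+x. \<integral>\<^sup>+y. ennreal (moll \<delta> (x - y)) * (indicator (E k) y * ennreal ((norm (G y))\<^sup>2)) \<partial>lborel \<partial>lborel)"
      by (intro nn_integral_mono pt)
    also have "\<dots> = (\<integral>\<^sup>+y. \<integral>\<^sup>+x. ennreal (moll \<delta> (x - y)) * (indicator (E k) y * ennreal ((norm (G y))\<^sup>2)) \<partial>lborel \<partial>lborel)"
      by (rule lborel_pair.Fubini') measurable
    also have "\<dots> = B k"
      unfolding B_def
    proof (rule nn_integral_cong)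
      fix y :: 'a
      have "(\<integral>\<^sup>+x. ennreal (moll \<delta> (x - y)) \<partial>lborel) = 1"
      proof -
        have "moll \<delta> (x - y) = moll \<delta> (y - x)" for x using moll_minus[of \<delta> "y - x"] by simp
        then have "(\<integral>\<^sup>+x. ennreal (moll \<delta> (x - y)) \<partial>lborel) = (\<integral>\<^sup>+x. ennreal (moll \<delta> (y - x)) \<partial>lborel)"
          by (simp only:)
        then show ?thesis using nn_integral_moll[OF \<delta>, of y] by (simp only:)
      qed
      then show "(\<integral>\<^sup>+x. ennreal (moll \<delta> (x - y)) * (indicator (E k) y * ennreal ((norm (G y))\<^sup>2)) \<partial>lborel) = indicator (E k) y * ennreal ((norm (G y))\<^sup>2)"
        by (subst nn_integral_multc) auto
    qed
    finally show ?thesis by (simp add: \<delta>_def)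
  qed
  have BL: "B \<longlonglongrightarrow> L"
    unfolding B_def L_def
  proof (rule nn_integral_dominated_convergence)
    show "AE y in lborel. (\<lambda>k. indicator (E k) y * ennreal ((norm (G y))\<^sup>2)) \<longlonglongrightarrow> indicator (closure \<Omega>) y * ennreal ((norm (G y))\<^sup>2)"
    proof (rule always_eventually, rule allI, rule tendsto_eventually)
      fix y
      show "\<forall>\<^sub>F k in sequentially. indicator (E k) y * ennreal ((norm (G y))\<^sup>2) = indicator (closure \<Omega>) y * ennreal ((norm (G y))\<^sup>2)"
      proof (cases "y \<in> closure \<Omega>")
        case True
        then have "infdist y \<Omega> = 0" using in_closure_iff_infdist_zero[OF ne] by blast
        then have "y \<in> E k" for k by (simp add: E_def)
        then show ?thesis using True by simp
      next
        case False
        then have "infdist y \<Omega> > 0"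
          using in_closure_iff_infdist_zero[OF ne] infdist_nonneg[of y \<Omega>] by (metis less_eq_real_def)
        moreover have "(\<lambda>k. 2 * (1/2::real)^k) \<longlonglongrightarrow> 2 * 0" by (intro tendsto_intros LIMSEQ_power_zero) simp
        ultimately have "\<forall>\<^sub>F k in sequentially. 2 * (1/2::real)^k < infdist y \<Omega>" by (intro order_tendstoD) auto
        then show ?thesis by (rule eventually_mono) (use False in \<open>simp add: E_def\<close>)
      qed
    qed
    show "(\<integral>\<^sup>+y. ennreal ((norm (G y))\<^sup>2) \<partial>lborel) < \<infinity>" by (rule G2)
    show "AE y in lborel. indicator (E k) y * ennreal ((norm (G y))\<^sup>2) \<le> ennreal ((norm (G y))\<^sup>2)" for k
      by (simp add: indicator_def)
  qed auto
  have "L \<le> (\<integral>\<^sup>+x. ennreal ((norm (G x))\<^sup>2) \<partial>lborel)"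
    unfolding L_def by (intro nn_integral_mono) (simp add: indicator_def)
  then have Lfin: "L < \<infinity>" using G2 by (rule order_le_less_trans)
  \<comment> \<open>The bound holds up to \<open>e\<close> for all fine mollifications, and Fatou
    hands it to \<open>u\<close>; finiteness of the Gagliardo term supplies the a.e.
    convergence.\<close>
  have "locq \<epsilon> u \<le> L" if \<epsilon>: "\<epsilon> > 0" for \<epsilon>
  proof (rule ennreal_le_epsilon)
    fix e :: real assume "e > 0"
    then have "L < L + ennreal e" using Lfin by (simp add: ennreal_add_left_cancel_less[of L 0, simplified] less_top[symmetric])
    then have "\<forall>\<^sub>F k in sequentially. B k < L + ennreal e" using BL by (intro order_tendstoD)
    then have "\<forall>\<^sub>F k in sequentially. locq \<epsilon> (?f k) \<le> L + ennreal e"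
    proof eventually_elim
      case (elim k)
      have "locq \<epsilon> (?f k) \<le> (\<integral>\<^sup>+x. ennreal ((norm (?g k x))\<^sup>2) \<partial>lborel)"
        by (rule C1_fun.locq_le_gradient[OF C1 \<epsilon>])
      also have "\<dots> \<le> B k" by (rule gB)
      finally show ?case using elim by simp
    qed
    then show "locq \<epsilon> u \<le> L + ennreal e"
      unfolding locq_def by (intro qform_fatou[OF _ _ mconv_AE_tendsto[OF s um fin]]) auto
  qed
  then show ?thesis unfolding dirichlet_def L_def by (intro SUP_least) auto
qed

section \<open>Null boundary and removal of null sets for domains with C1 boundary\<close>

lemma emeasure_lborel_translate:
  fixes S :: "'a::euclidean_space set"
  assumes [measurable]: "S \<in> sets borel"
  shows "emeasure lborel {x. x - c \<in> S} = emeasure lborel S"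
proof -
  have "(\<integral>\<^sup>+x. indicator S (x + - c) \<partial>lborel) = (\<integral>\<^sup>+x. indicator S x \<partial>lborel)"
    by (rule nn_integral_lborel_add) measurable
  moreover have "(\<lambda>x. indicator S (x + - c)) = (indicator {x. x - c \<in> S} :: 'a \<Rightarrow> ennreal)"
    by (auto simp: indicator_def)
  ultimately show ?thesis by simp
qed

text \<open>The translates of a graph in the direction of its axis are disjoint.\<close>
lemma graph_null_set:
  fixes \<nu> :: "'a::euclidean_space" and \<gamma> :: "'a \<Rightarrow> real"
  assumes \<nu>: "norm \<nu> = 1" and inv: "\<And>x t. \<gamma> (x + t *\<^sub>R \<nu>) = \<gamma> x" and [measurable]: "\<gamma> \<in> borel_measurable borel"
  shows "{x \<in> ball p r. x \<bullet> \<nu> = \<gamma> x} \<in> null_sets lborel"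
proof -
  define S where "S = {x \<in> ball p r. x \<bullet> \<nu> = \<gamma> x}"
  have Sm[measurable]: "S \<in> sets borel" unfolding S_def by measurable
  define t where "t k = 1 / real (Suc k)" for k :: nat
  define T where "T k = {x. x - t k *\<^sub>R \<nu> \<in> S}" for k
  have Tm[measurable]: "T k \<in> sets borel" for k unfolding T_def by measurable
  have Tt: "x \<bullet> \<nu> - \<gamma> x = t k" if "x \<in> T k" for x k
  proof -
    have "(x - t k *\<^sub>R \<nu>) \<bullet> \<nu> = \<gamma> (x - t k *\<^sub>R \<nu>)" using that by (simp add: T_def S_def)
    moreover have "\<gamma> (x - t k *\<^sub>R \<nu>) = \<gamma> x" using inv[of x "- t k"] by simp
    ultimately show ?thesis using \<nu> by (simp add: inner_diff_left norm_eq_1)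
  qed
  have dis: "disjoint_family T"
    unfolding disjoint_family_on_def
  proof (intro ballI impI)
    fix k l :: nat assume "k \<noteq> l"
    then have "t k \<noteq> t l" by (simp add: t_def)
    then show "T k \<inter> T l = {}" by (metis Tt disjoint_iff)
  qed
  have sub: "T k \<subseteq> ball p (r + 1)" for k
  proof
    fix x assume "x \<in> T k"
    then have "norm (x - t k *\<^sub>R \<nu> - p) < r" by (simp add: T_def S_def dist_norm norm_minus_commute)
    moreover have "norm (t k *\<^sub>R \<nu>) \<le> 1" using \<nu> by (simp add: t_def)
    ultimately have "norm (x - p) < r + 1"
      using norm_triangle_ineq[of "x - t k *\<^sub>R \<nu> - p" "t k *\<^sub>R \<nu>"] by simp
    then show "x \<in> ball p (r + 1)" by (simp add: dist_norm norm_minus_commute)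
  qed
  have meas: "emeasure lborel (T k) = emeasure lborel S" for k
    unfolding T_def by (rule emeasure_lborel_translate) measurable
  have "emeasure lborel S = 0"
  proof (rule ccontr)
    assume nz: "emeasure lborel S \<noteq> 0"
    have "(\<Sum>k. emeasure lborel (T k)) = emeasure lborel (\<Union>k. T k)"
      by (rule suminf_emeasure[OF _ dis]) auto
    also have "\<dots> \<le> emeasure lborel (ball p (r + 1))" using sub by (intro emeasure_mono) auto
    also have "\<dots> < \<infinity>" by (rule emeasure_lborel_ball_finite)
    finally have "(\<Sum>k::nat. emeasure lborel S) < \<infinity>" by (simp add: meas)
    then have fin: "(\<Sum>k::nat. emeasure lborel S) \<noteq> top" by simp
    have "emeasure lborel S \<le> (\<Sum>k::nat. emeasure lborel S)"
      using sum_le_suminf[of "\<lambda>k::nat. emeasure lborel S" "{0}"] by simp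
    then obtain m where m: "emeasure lborel S = ennreal m" "m \<ge> 0"
      using fin by (cases "emeasure lborel S") (auto simp: top_unique)
    have "summable (\<lambda>k::nat. m)" using fin m by (intro summable_suminf_not_top) auto
    then have "m = 0" by (simp add: summable_const_iff)
    then show False using nz m by simp
  qed
  then show ?thesis unfolding S_def[symmetric] by (simp add: null_sets_def)
qed

lemma C1_boundary_chart:
  assumes "C1_boundary \<Omega>" "p \<in> frontier \<Omega>"
  obtains r \<nu> \<gamma> where "r > 0" "norm \<nu> = 1" "\<And>x t. \<gamma> (x + t *\<^sub>R \<nu>) = \<gamma> x" "continuous_on UNIV \<gamma>"
    "\<And>x. x \<in> ball p r \<Longrightarrow> x \<in> \<Omega> \<longleftrightarrow> x \<bullet> \<nu> > \<gamma> x"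
proof -
  obtain r \<nu> \<gamma> g where *: "r > 0" "norm \<nu> = 1" "\<forall>x t. \<gamma> (x + t *\<^sub>R \<nu>) = \<gamma> x"
    "\<forall>x. (\<gamma> has_derivative (\<lambda>h. g x \<bullet> h)) (at x)" "\<Omega> \<inter> ball p r = {x \<in> ball p r. x \<bullet> \<nu> > \<gamma> x}"
    using assms unfolding C1_boundary_def by blast
  show ?thesis
  proof (rule that[of r \<nu> \<gamma>])
    show "continuous_on UNIV \<gamma>"
      using *(4) has_derivative_continuous by (intro continuous_at_imp_continuous_on) blast
    show "x \<in> \<Omega> \<longleftrightarrow> x \<bullet> \<nu> > \<gamma> x" if "x \<in> ball p r" for x using *(5) that by blast
  qed (use * in auto)
qed

text \<open>In a chart the two strict inequalities are open conditions that put a point in the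
  interior or in the exterior, so the frontier lies on the graph. Compactness of the frontier leaves
  finitely many charts.\<close>

lemma C1_boundary_frontier_null:
  assumes C: "C1_boundary \<Omega>" and b: "bounded \<Omega>"
  shows "frontier \<Omega> \<in> null_sets lborel"
proof -
  have "\<exists>r>0. frontier \<Omega> \<inter> ball p r \<in> null_sets lborel" if p: "p \<in> frontier \<Omega>" for p
  proof -
    obtain r \<nu> \<gamma> where r: "r > 0" and \<nu>: "norm \<nu> = 1" and inv: "\<And>x t. \<gamma> (x + t *\<^sub>R \<nu>) = \<gamma> x"
      and cont: "continuous_on UNIV \<gamma>" and ch: "\<And>x. x \<in> ball p r \<Longrightarrow> x \<in> \<Omega> \<longleftrightarrow> x \<bullet> \<nu> > \<gamma> x"
      using C1_boundary_chart[OF C p] by metis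
    have op: "open (ball p r \<inter> {x. x \<bullet> \<nu> > \<gamma> x})" "open (ball p r \<inter> {x. x \<bullet> \<nu> < \<gamma> x})"
      using cont by (auto intro!: open_Int open_Collect_less continuous_intros)
    have "frontier \<Omega> \<inter> ball p r \<subseteq> {x \<in> ball p r. x \<bullet> \<nu> = \<gamma> x}"
    proof
      fix x assume x: "x \<in> frontier \<Omega> \<inter> ball p r"
      have "\<not> x \<bullet> \<nu> > \<gamma> x"
      proof
        assume "x \<bullet> \<nu> > \<gamma> x"
        then have "x \<in> interior \<Omega>" using x ch by (intro interiorI[OF op(1)]) auto
        then show False using x by (simp add: frontier_def)
      qed
      moreover have "\<not> x \<bullet> \<nu> < \<gamma> x"
      proof
        assume "x \<bullet> \<nu> < \<gamma> x"
        then have "x \<in> ball p r \<inter> {x. x \<bullet> \<nu> < \<gamma> x}" using x by simp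
        moreover have "(ball p r \<inter> {x. x \<bullet> \<nu> < \<gamma> x}) \<inter> \<Omega> = {}" using ch by force
        ultimately have "x \<notin> closure \<Omega>" using op(2) open_Int_closure_eq_empty by blast
        then show False using x by (simp add: frontier_def)
      qed
      ultimately show "x \<in> {x \<in> ball p r. x \<bullet> \<nu> = \<gamma> x}" using x by auto
    qed
    moreover have "{x \<in> ball p r. x \<bullet> \<nu> = \<gamma> x} \<in> null_sets lborel"
      using \<nu> inv cont by (intro graph_null_set borel_measurable_continuous_onI)
    ultimately have "frontier \<Omega> \<inter> ball p r \<in> null_sets lborel"
      by (rule null_sets_subset[rotated 2]) (auto intro: borel_closed)
    then show ?thesis using r by blast
  qed
  then obtain r where r: "\<And>p. p \<in> frontier \<Omega> \<Longrightarrow> r p > 0 \<and> frontier \<Omega> \<inter> ball p (r p) \<in> null_sets lborel" by metis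
  have "compact (frontier \<Omega>)" using b by (rule compact_frontier_bounded)
  moreover have "frontier \<Omega> \<subseteq> (\<Union>p\<in>frontier \<Omega>. ball p (r p))" using r by force
  ultimately obtain D where D: "D \<subseteq> frontier \<Omega>" "finite D" "frontier \<Omega> \<subseteq> (\<Union>p\<in>D. ball p (r p))"
    using compactE_image[of "frontier \<Omega>" "frontier \<Omega>" "\<lambda>p. ball p (r p)"] by (metis open_ball)
  have "(\<Union>p\<in>D. frontier \<Omega> \<inter> ball p (r p)) \<in> null_sets lborel"
    using D r by (intro null_sets_UN' countable_finite) auto
  also have "(\<Union>p\<in>D. frontier \<Omega> \<inter> ball p (r p)) = frontier \<Omega>" using D by blast
  finally show ?thesis .
qed

lemma open_AE_notin_imp_empty:
  fixes W :: "'a::euclidean_space set"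
  assumes "open W" "AE x in lborel. x \<notin> W"
  shows "W = {}"
proof (rule ccontr)
  assume "W \<noteq> {}"
  then obtain x where "x \<in> W" by blast
  then obtain e where xe: "e > 0" "ball x e \<subseteq> W" using assms(1) open_contains_ball by blast
  have "AE y in lborel. y \<notin> ball x e" using assms(2) xe by (auto elim!: eventually_mono)
  then have "emeasure lborel (ball x e) = 0"
    by (subst (asm) AE_iff_null_sets[symmetric]) auto
  then show False using content_ball_pos[OF xe(1), of x] by (simp add: measure_def)
qed

text \<open>An open set equal a.e. to the ball could still miss points of it, such as a puncture or
  a slit. A missing point would be a boundary point with a chart, and the part of the chart below
  the graph would be a nonempty open subset of the ball outside \<open>\<Omega>\<close>.\<close>

lemma C1_domain_eq_ball:
  fixes \<Omega> :: "'a::euclidean_space set"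
  assumes op: "open \<Omega>" and C: "C1_boundary \<Omega>" and r: "r > 0"
    and AE: "AE x in lborel. x \<in> \<Omega> \<longleftrightarrow> x \<in> ball c r"
  shows "\<Omega> = ball c r"
proof
  have "\<Omega> - cball c r = {}"
    using op AE by (intro open_AE_notin_imp_empty open_Diff) (auto elim!: eventually_mono)
  then have "\<Omega> \<subseteq> interior (cball c r)" using op by (intro interior_maximal) auto
  then show "\<Omega> \<subseteq> ball c r" by simp
  show "ball c r \<subseteq> \<Omega>"
  proof
    fix p assume p: "p \<in> ball c r"
    show "p \<in> \<Omega>"
    proof (rule ccontr)
      assume np: "p \<notin> \<Omega>"
      have "ball c r - closure \<Omega> = {}"
      proof (rule open_AE_notin_imp_empty)
        show "AE x in lborel. x \<notin> ball c r - closure \<Omega>"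
          using AE by eventually_elim (use closure_subset in auto)
      qed auto
      then have "p \<in> frontier \<Omega>" using p np op by (auto simp: frontier_def interior_open)
      then obtain r' \<nu> \<gamma> where r': "r' > 0" and \<nu>: "norm \<nu> = 1" and inv: "\<And>x t. \<gamma> (x + t *\<^sub>R \<nu>) = \<gamma> x"
        and cont: "continuous_on UNIV \<gamma>" and ch: "\<And>x. x \<in> ball p r' \<Longrightarrow> x \<in> \<Omega> \<longleftrightarrow> x \<bullet> \<nu> > \<gamma> x"
        using C1_boundary_chart[OF C] by metis
      define W where "W = ball p r' \<inter> ball c r \<inter> {x. x \<bullet> \<nu> < \<gamma> x}"
      have "W = {}"
      proof (rule open_AE_notin_imp_empty)
        show "open W" unfolding W_def using cont by (auto intro!: open_Int open_Collect_less continuous_intros)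
        show "AE x in lborel. x \<notin> W" using AE by eventually_elim (use ch in \<open>force simp: W_def\<close>)
      qed
      moreover obtain \<eta> where \<eta>: "\<eta> > 0" "ball p \<eta> \<subseteq> ball c r" using p open_ball[of c r] by (metis open_contains_ball)
      \<comment> \<open>Stepping from \<open>p\<close> against the axis lowers the inner product and
        keeps \<gamma>, so the point falls strictly below the graph; halving both radii keeps it in
        the two balls.\<close>
      define t where "t = min (\<eta> / 2) (r' / 2)"
      have t: "t > 0" "t < \<eta>" "t < r'" using \<eta> r' by (auto simp: t_def)
      have "p - t *\<^sub>R \<nu> \<in> W"
      proof -
        have "p \<bullet> \<nu> \<le> \<gamma> p" using ch[of p] np r' by auto
        moreover have "\<gamma> (p - t *\<^sub>R \<nu>) = \<gamma> p" using inv[of p "- t"] by simp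
        moreover have "(p - t *\<^sub>R \<nu>) \<bullet> \<nu> = p \<bullet> \<nu> - t" using \<nu> by (simp add: inner_diff_left norm_eq_1)
        moreover have "dist p (p - t *\<^sub>R \<nu>) = t" using \<nu> t by (simp add: dist_norm)
        ultimately show ?thesis using t \<eta> by (auto simp: W_def subset_iff)
      qed
      ultimately show False by blast
    qed
  qed
qed

section \<open>Compactness and a function of finite energy\<close>

text \<open>A measurable choice of a net point near \<open>x\<close>. It serves as the map
  \<open>q\<close> of \<open>mconv_poincare\<close>, so that a function is approximated by finitely
  many of its mollified values.\<close>

lemma finite_selector:
  fixes F :: "'a::euclidean_space set"
  assumes "finite F"
  shows "\<exists>q\<in>borel_measurable borel. \<forall>x\<in>(\<Union>p\<in>F. ball p \<delta>). q x \<in> F \<and> norm (q x - x) \<le> \<delta>"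
  using assms
proof (induction F rule: finite_induct)
  case empty
  then show ?case by (intro bexI[of _ "\<lambda>_. 0"]) auto
next
  case (insert p F)
  then obtain q where [measurable]: "q \<in> borel_measurable borel"
    and q: "\<And>x. x \<in> (\<Union>p\<in>F. ball p \<delta>) \<Longrightarrow> q x \<in> F \<and> norm (q x - x) \<le> \<delta>" by blast
  show ?case
  proof (rule bexI[of _ "\<lambda>x. if x \<in> ball p \<delta> then p else q x"])
    show "\<forall>x\<in>(\<Union>p\<in>insert p F. ball p \<delta>). (if x \<in> ball p \<delta> then p else q x) \<in> insert p F \<and> norm ((if x \<in> ball p \<delta> then p else q x) - x) \<le> \<delta>"
    proof
      fix x assume x: "x \<in> (\<Union>p\<in>insert p F. ball p \<delta>)"
      show "(if x \<in> ball p \<delta> then p else q x) \<in> insert p F \<and> norm ((if x \<in> ball p \<delta> then p else q x) - x) \<le> \<delta>"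
      proof (cases "x \<in> ball p \<delta>")
        case True
        then show ?thesis by (simp add: dist_norm)
      next
        case False
        then show ?thesis using x q[of x] by simp
      qed
    qed
  qed measurable
qed

lemma gagl_diff_le:
  fixes a b :: "'a::euclidean_space \<Rightarrow> real"
  assumes [measurable]: "a \<in> borel_measurable borel" "b \<in> borel_measurable borel"
  shows "gagl s (\<lambda>x. a x - b x) \<le> 2 * gagl s a + 2 * gagl s b"
proof -
  have "gagl s (\<lambda>x. a x + (-1) * b x) \<le> ennreal (1 + 1) * gagl s a + ennreal (1 + 1 / 1) * gagl s (\<lambda>x. (-1) * b x)"
    unfolding gagl_def by (rule qform_add_le) auto
  also have "gagl s (\<lambda>x. (-1) * b x) = gagl s b"
    unfolding gagl_def by (subst qform_cmult) auto
  finally show ?thesis by simp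
qed

text \<open>Jensen moves the square inside, and the mollifier is bounded by its peak. The bound
  makes the mollified values at a net point a bounded sequence of reals.\<close>

lemma mconv_bound:
  fixes u :: "'a::euclidean_space \<Rightarrow> real"
  assumes \<delta>: "\<delta> > 0" and [measurable]: "u \<in> borel_measurable borel" and u2: "(\<integral>\<^sup>+x. ennreal ((u x)\<^sup>2) \<partial>lborel) \<le> 1"
  shows "\<bar>mconv \<delta> u p\<bar> \<le> sqrt (1 / (bump_mass TYPE('a) * \<delta> ^ DIM('a)))"
proof -
  define B where "B = 1 / (bump_mass TYPE('a) * \<delta> ^ DIM('a))"
  have B: "B \<ge> 0" using bump_mass_pos[where 'a='a] \<delta> by (simp add: B_def)
  have "ennreal ((0 - (\<integral>y. moll \<delta> (p - y) * u y \<partial>lborel))\<^sup>2) \<le> (\<integral>\<^sup>+y. ennreal (moll \<delta> (p - y) * (0 - u y)\<^sup>2) \<partial>lborel)"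
    by (rule jensen_sq) (auto simp: moll_nonneg[OF \<delta>] nn_integral_moll[OF \<delta>])
  then have "ennreal ((mconv \<delta> u p)\<^sup>2) \<le> (\<integral>\<^sup>+y. ennreal (moll \<delta> (p - y) * (u y)\<^sup>2) \<partial>lborel)"
    by (simp add: mconv_def)
  also have "\<dots> \<le> (\<integral>\<^sup>+y. ennreal B * ennreal ((u y)\<^sup>2) \<partial>lborel)"
  proof (rule nn_integral_mono)
    fix y
    have "moll \<delta> (p - y) * (u y)\<^sup>2 \<le> B * (u y)\<^sup>2"
      unfolding B_def by (rule mult_right_mono[OF moll_le[OF \<delta>]]) simp
    then show "ennreal (moll \<delta> (p - y) * (u y)\<^sup>2) \<le> ennreal B * ennreal ((u y)\<^sup>2)"
      using B by (simp only: ennreal_mult[symmetric] zero_le_power2 ennreal_leI)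
  qed
  also have "\<dots> = ennreal B * (\<integral>\<^sup>+y. ennreal ((u y)\<^sup>2) \<partial>lborel)" by (rule nn_integral_cmult) measurable
  also have "\<dots> \<le> ennreal B * 1" using u2 by (rule mult_left_mono) simp
  finally have "(mconv \<delta> u p)\<^sup>2 \<le> B" using B by simp
  then show ?thesis using real_sqrt_le_mono[of "(mconv \<delta> u p)\<^sup>2" B] by (simp add: B_def)
qed

text \<open>Up to an L2 error of order \<delta>^s, a function with bounded seminorm is determined by
  its mollified values at a finite \<delta>-net. A diagonal subsequence makes these values converge
  for every net in a countable family, and the sequence is then Cauchy in L2.\<close>

theorem fractional_compactness:
  fixes u :: "nat \<Rightarrow> 'a::euclidean_space \<Rightarrow> real"
  assumes s: "s > 0" and um[measurable]: "\<And>n. u n \<in> borel_measurable borel"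
    and supp: "\<And>n x. x \<notin> ball 0 R \<Longrightarrow> u n x = 0" and u2: "\<And>n. (\<integral>\<^sup>+x. ennreal ((u n x)\<^sup>2) \<partial>lborel) \<le> 1"
    and M: "M \<ge> 0" "\<And>n. gagl s (u n) \<le> ennreal M"
  obtains \<phi> v where "strict_mono \<phi>" "v \<in> borel_measurable borel"
    "AE x in lborel. (\<lambda>n. u (\<phi> n) x) \<longlonglongrightarrow> v x"
    "(\<lambda>n. \<integral>\<^sup>+x. ennreal ((u (\<phi> n) x - v x)\<^sup>2) \<partial>lborel) \<longlonglongrightarrow> 0"
proof -
  define \<delta> where "\<delta> j = (1/2::real)^j" for j :: nat
  have \<delta>: "\<delta> j > 0" for j by (simp add: \<delta>_def)
  have "\<exists>F. finite F \<and> ball (0::'a) R \<subseteq> (\<Union>p\<in>F. ball p (\<delta> j))" for j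
  proof -
    have "cball (0::'a) R \<subseteq> (\<Union>p\<in>cball 0 R. ball p (\<delta> j))" using \<delta>[of j] by force
    then obtain F where "F \<subseteq> cball (0::'a) R" "finite F" "cball (0::'a) R \<subseteq> (\<Union>p\<in>F. ball p (\<delta> j))"
      using compactE_image[of "cball (0::'a) R" "cball 0 R" "\<lambda>p. ball p (\<delta> j)"] by (metis open_ball compact_cball)
    then show ?thesis using ball_subset_cball[of "0::'a" R] by blast
  qed
  then obtain F :: "nat \<Rightarrow> 'a set" where F: "\<And>j. finite (F j)" "\<And>j. ball 0 R \<subseteq> (\<Union>p\<in>F j. ball p (\<delta> j))" by metis
  have "\<forall>j. \<exists>q\<in>borel_measurable borel. \<forall>x\<in>(\<Union>p\<in>F j. ball p (\<delta> j)). q x \<in> F j \<and> norm (q x - x) \<le> \<delta> j"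
    using finite_selector[OF F(1)] by blast
  then obtain q where qm[measurable]: "\<And>j. q j \<in> borel_measurable borel"
    and q: "\<And>j x. x \<in> ball 0 R \<Longrightarrow> q j x \<in> F j \<and> norm (q j x - x) \<le> \<delta> j"
    using F(2) by (metis subsetD)
  have ui: "integrable lborel (u n)" for n
    by (rule integrable_of_sq_bounded[OF um supp]) (use u2[of n] in \<open>auto intro: order_le_less_trans\<close>)
  define B where "B j = sqrt (1 / (bump_mass TYPE('a) * \<delta> j ^ DIM('a)))" for j
  have B: "B j > 0" for j using bump_mass_pos[where 'a='a] \<delta>[of j] by (simp add: B_def)
  \<comment> \<open>Pairs of a scale and a net point form one countable set, so a single diagonal
    extraction by \<open>function_convergent_subsequence\<close> serves all scales; dividing by
    \<open>B\<close> normalizes the bound to 1.\<close>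
  have "countable (SIGMA j:UNIV. F j)" using F(1) by (intro countable_SIGMA) (auto simp: countable_finite)
  moreover have "norm (mconv (\<delta> (fst z)) (u n) (snd z) / B (fst z)) \<le> 1" if "z \<in> (SIGMA j:UNIV. F j)" for n z
    using mconv_bound[OF \<delta> um u2, of "fst z" n "snd z"] B[of "fst z"] by (simp add: B_def[symmetric] field_simps)
  ultimately obtain k where k: "strict_mono k"
    and kl: "\<And>z. z \<in> (SIGMA j:UNIV. F j) \<Longrightarrow> \<exists>l. (\<lambda>n. mconv (\<delta> (fst z)) (u (k n)) (snd z) / B (fst z)) \<longlonglongrightarrow> l"
    by (rule function_convergent_subsequence[of _ "\<lambda>n z. mconv (\<delta> (fst z)) (u n) (snd z) / B (fst z)" 1]) auto
  have kc: "Cauchy (\<lambda>n. mconv (\<delta> j) (u (k n)) p)" if pF: "p \<in> F j" for j p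
  proof -
    obtain l where "(\<lambda>n. mconv (\<delta> j) (u (k n)) p / B j) \<longlonglongrightarrow> l" using kl[of "(j, p)"] pF by auto
    then have "(\<lambda>n. mconv (\<delta> j) (u (k n)) p / B j * B j) \<longlonglongrightarrow> l * B j" by (intro tendsto_intros)
    then show ?thesis using B[of j] by (intro LIMSEQ_imp_Cauchy) simp
  qed
  define \<beta> where "\<beta> = measure lborel (ball (0::'a) R)"
  have \<beta>: "emeasure lborel (ball (0::'a) R) = ennreal \<beta>" "\<beta> \<ge> 0"
    using emeasure_lborel_ball_finite[of "0::'a" R] by (auto simp: \<beta>_def emeasure_eq_ennreal_measure)
  define C where "C = 2 powr (real DIM('a) + 2 * s) / bump_mass TYPE('a)"
  have C: "C \<ge> 0" using bump_mass_pos[where 'a='a] by (simp add: C_def)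
  define \<theta> where "\<theta> = (1/2::real) powr (2 * s)"
  have \<theta>: "0 < \<theta>" "\<theta> < 1" using s powr_less_mono'[of "1/2" 0 "2 * s"] by (auto simp: \<theta>_def)
  have \<delta>\<theta>: "\<delta> j powr (2 * s) = \<theta> ^ j" for j
    by (simp add: \<delta>_def \<theta>_def powr_realpow[symmetric] powr_powr mult.commute)
  have cauchy: "\<exists>N. \<forall>m\<ge>N. \<forall>n\<ge>N. (\<integral>\<^sup>+x. ennreal ((norm (u (k m) x - u (k n) x))\<^sup>2) \<partial>lborel) \<le> ennreal \<epsilon>" if \<epsilon>: "\<epsilon> > 0" for \<epsilon>
  proof -
    have "(\<lambda>j. 2 * (C * \<theta> ^ j * (4 * M))) \<longlonglongrightarrow> 2 * (C * 0 * (4 * M))" using \<theta> by (intro tendsto_intros LIMSEQ_power_zero) auto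
    then have "\<forall>\<^sub>F j in sequentially. 2 * (C * \<theta> ^ j * (4 * M)) < \<epsilon> / 2" by (rule order_tendstoD(2)) (use \<epsilon> in simp)
    then obtain j where j: "2 * (C * \<theta> ^ j * (4 * M)) < \<epsilon> / 2" by (auto simp: eventually_sequentially)
    \<comment> \<open>Both error sources are allowed \<epsilon> / 2: the Poincare term through the
      choice of \<open>j\<close>, where \<open>4 * M\<close> bounds the seminorm of a difference,
      and the net values through 2 \<beta> \<eta>^2 \<le> \<epsilon> / 2.\<close>
    define \<eta> where "\<eta> = sqrt (\<epsilon> / (4 * (\<beta> + 1)))"
    have \<eta>: "\<eta> > 0" using \<epsilon> \<beta> by (simp add: \<eta>_def)
    have \<eta>2: "\<eta>\<^sup>2 = \<epsilon> / (4 * (\<beta> + 1))" using \<epsilon> \<beta> by (simp add: \<eta>_def)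
    have "\<forall>p\<in>F j. \<exists>N. \<forall>m\<ge>N. \<forall>n\<ge>N. \<bar>mconv (\<delta> j) (u (k m)) p - mconv (\<delta> j) (u (k n)) p\<bar> < \<eta>"
      using kc \<eta> by (auto simp: Cauchy_def dist_real_def)
    then obtain N where N: "\<And>p m n. p \<in> F j \<Longrightarrow> m \<ge> N p \<Longrightarrow> n \<ge> N p \<Longrightarrow> \<bar>mconv (\<delta> j) (u (k m)) p - mconv (\<delta> j) (u (k n)) p\<bar> < \<eta>"
      by metis
    define N0 where "N0 = (\<Sum>p\<in>F j. N p)"
    have N0: "N p \<le> N0" if "p \<in> F j" for p unfolding N0_def using F(1) that by (intro member_le_sum) auto
    have "(\<integral>\<^sup>+x. ennreal ((norm (u (k m) x - u (k n) x))\<^sup>2) \<partial>lborel) \<le> ennreal \<epsilon>" if mn: "m \<ge> N0" "n \<ge> N0" for m n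
    proof -
      define w where "w x = u (k m) x - u (k n) x" for x
      have wm[measurable]: "w \<in> borel_measurable borel" unfolding w_def by measurable
      have wl: "mconv (\<delta> j) w p = mconv (\<delta> j) (u (k m)) p - mconv (\<delta> j) (u (k n)) p" for p
        unfolding mconv_def w_def right_diff_distrib
        by (intro Bochner_Integration.integral_diff integrable_moll_mult[OF \<delta> ui])
      have gw: "gagl s w \<le> ennreal (4 * M)"
      proof -
        have "gagl s w \<le> 2 * gagl s (u (k m)) + 2 * gagl s (u (k n))" unfolding w_def by (rule gagl_diff_le) auto
        also have "\<dots> \<le> 2 * ennreal M + 2 * ennreal M" by (intro add_mono mult_left_mono M(2)) auto
        also have "\<dots> = ennreal (4 * M)"
          using M(1) by (simp add: ennreal_plus[symmetric] ennreal_mult''[symmetric] flip: ennreal_numeral del: ennreal_plus)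
        finally show ?thesis .
      qed
      \<comment> \<open>The difference \<open>w\<close> is split at the mollified value of its net
        point; the first part is a Poincare error, the second is below \<eta> by the choice of the
        subsequence.\<close>
      have pt: "ennreal ((w x)\<^sup>2) \<le> 2 * (indicator (ball 0 R) x * ennreal ((w x - mconv (\<delta> j) w (q j x))\<^sup>2)) + 2 * (indicator (ball 0 R) x * ennreal (\<eta>\<^sup>2))" for x
      proof (cases "x \<in> ball 0 R")
        case True
        define a where "a = mconv (\<delta> j) w (q j x)"
        have "\<bar>a\<bar> < \<eta>"
          unfolding a_def wl using q[OF True, of j] N0 mn by (intro N) (auto intro: order_trans)
        then have "a\<^sup>2 \<le> \<eta>\<^sup>2" using power_mono[of "\<bar>a\<bar>" \<eta> 2] by simp
        moreover have "(w x)\<^sup>2 \<le> 2 * (w x - a)\<^sup>2 + 2 * a\<^sup>2"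
          using zero_le_power2[of "w x - 2 * a"] by (simp add: power2_eq_square algebra_simps)
        ultimately have "(w x)\<^sup>2 \<le> 2 * (w x - a)\<^sup>2 + 2 * \<eta>\<^sup>2" by linarith
        then show ?thesis using True unfolding a_def[symmetric]
          by (simp add: ennreal_plus[symmetric] ennreal_mult''[symmetric] ennreal_leI flip: ennreal_numeral del: ennreal_plus)
      next
        case False
        then show ?thesis by (simp add: w_def supp)
      qed
      have "(\<integral>\<^sup>+x. ennreal ((w x)\<^sup>2) \<partial>lborel)
         \<le> (\<integral>\<^sup>+x. 2 * (indicator (ball 0 R) x * ennreal ((w x - mconv (\<delta> j) w (q j x))\<^sup>2)) + 2 * (indicator (ball 0 R) x * ennreal (\<eta>\<^sup>2)) \<partial>lborel)"
        by (intro nn_integral_mono pt)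
      also have "\<dots> = 2 * (\<integral>\<^sup>+x. indicator (ball 0 R) x * ennreal ((w x - mconv (\<delta> j) w (q j x))\<^sup>2) \<partial>lborel) + 2 * (ennreal \<beta> * ennreal (\<eta>\<^sup>2))"
        by (simp add: nn_integral_add nn_integral_cmult nn_integral_multc \<beta>)
      also have "\<dots> \<le> 2 * (ennreal (C * \<delta> j powr (2 * s)) * ennreal (4 * M)) + 2 * (ennreal \<beta> * ennreal (\<eta>\<^sup>2))"
      proof -
        have "(\<integral>\<^sup>+x. indicator (ball 0 R) x * ennreal ((w x - mconv (\<delta> j) w (q j x))\<^sup>2) \<partial>lborel) \<le> ennreal (C * \<delta> j powr (2 * s)) * gagl s w"
          unfolding C_def by (rule mconv_poincare[OF \<delta> s]) (use q in auto)
        also have "\<dots> \<le> ennreal (C * \<delta> j powr (2 * s)) * ennreal (4 * M)" using gw by (rule mult_left_mono) simp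
        finally show ?thesis by (intro add_mono mult_left_mono) auto
      qed
      also have "\<dots> = ennreal (2 * (C * \<theta> ^ j * (4 * M)) + 2 * (\<beta> * \<eta>\<^sup>2))"
      proof -
        define X Y where "X = C * \<theta> ^ j" and "Y = 4 * M"
        have "X \<ge> 0" "Y \<ge> 0" using C \<theta> M(1) by (auto simp: X_def Y_def)
        then show ?thesis
          unfolding \<delta>\<theta> X_def[symmetric] Y_def[symmetric] using \<beta>(2) by (simp add: ennreal_plus ennreal_mult)
      qed
      also have "\<dots> \<le> ennreal \<epsilon>"
      proof (rule ennreal_leI)
        have "\<beta> * \<eta>\<^sup>2 \<le> (\<beta> + 1) * \<eta>\<^sup>2" by (intro mult_right_mono) auto
        also have "\<dots> = \<epsilon> / 4" using \<beta>(2) by (simp add: \<eta>2 field_simps)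
        finally show "2 * (C * \<theta> ^ j * (4 * M)) + 2 * (\<beta> * \<eta>\<^sup>2) \<le> \<epsilon>" using j by linarith
      qed
      finally show ?thesis by (simp add: w_def)
    qed
    then show ?thesis by blast
  qed
  obtain v \<psi> where \<psi>: "strict_mono \<psi>" and v: "v \<in> borel_measurable borel"
    and AE: "AE x in lborel. (\<lambda>n. u (k (\<psi> n)) x) \<longlonglongrightarrow> v x"
    and lim: "(\<lambda>n. \<integral>\<^sup>+x. ennreal ((norm (u (k n) x - v x))\<^sup>2) \<partial>lborel) \<longlonglongrightarrow> 0"
    using cauchy by (rule L2_complete[of "\<lambda>n. u (k n)", rotated]) auto
  have lim': "(\<lambda>n. \<integral>\<^sup>+x. ennreal ((u (k (\<psi> n)) x - v x)\<^sup>2) \<partial>lborel) \<longlonglongrightarrow> 0"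
    using LIMSEQ_subseq_LIMSEQ[OF lim \<psi>] by (simp add: comp_def)
  show ?thesis
    by (rule that[of "\<lambda>n. k (\<psi> n)" v]) (use strict_mono_o[OF k \<psi>] v AE lim' in \<open>auto simp: comp_def\<close>)
qed

lemma ennreal_le_suminf: "f k \<le> (\<Sum>k. f k :: ennreal)"
  using sum_le_suminf[of f "{k}"] by simp

section \<open>Finite energy of the tent function\<close>

lemma dyadic_below_1:
  fixes x :: real
  assumes "0 < x" "x < 1"
  obtains k where "(1/2)^Suc k \<le> x" "x < (1/2)^k"
proof -
  define n where "n = (LEAST n. (1/2::real)^n \<le> x)"
  have ex: "\<exists>n. (1/2::real)^n \<le> x" using real_arch_pow_inv[of x "1/2"] assms(1) by (auto intro: less_imp_le)
  have n: "(1/2)^n \<le> x" unfolding n_def by (rule LeastI_ex[OF ex])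
  have "n \<noteq> 0" using n assms(2) by (cases n) auto
  then obtain k where k: "n = Suc k" by (cases n) auto
  have "\<not> (1/2)^k \<le> x" using not_less_Least[of k "\<lambda>n. (1/2::real)^n \<le> x"] k by (simp add: n_def)
  then show ?thesis using that[of k] n k by simp
qed

lemma dyadic_above_1:
  fixes x :: real
  assumes "1 \<le> x"
  obtains k where "2^k \<le> x" "x < 2^Suc k"
proof -
  define n where "n = (LEAST n. x < (2::real)^n)"
  have ex: "\<exists>n. x < (2::real)^n" using real_arch_pow[of 2 x] by simp
  have n: "x < 2^n" unfolding n_def by (rule LeastI_ex[OF ex])
  have "n \<noteq> 0" using n assms by (cases n) auto
  then obtain k where k: "n = Suc k" by (cases n) auto
  have "\<not> x < 2^k" using not_less_Least[of k "\<lambda>n. x < (2::real)^n"] k by (simp add: n_def)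
  then show ?thesis using that[of k] n k by simp
qed

lemma emeasure_ball_scale:
  assumes "r \<ge> 0"
  shows "emeasure lborel (ball (c::'a::euclidean_space) r) = ennreal (r ^ DIM('a) * measure lborel (ball (0::'a) 1))"
proof -
  have "emeasure lborel (ball c r) = ennreal (measure lborel (ball c r))"
    using emeasure_lborel_ball_finite[of c r] by (simp add: emeasure_eq_ennreal_measure)
  also have "measure lborel (ball c r) = r ^ DIM('a) * measure lborel (ball (0::'a) 1)"
    using content_ball_conv_unit_ball[OF assms, of c] by simp
  finally show ?thesis .
qed

text \<open>The shell of radius about 2^-k contributes a term of order 2^(-k (2 - 2 s)), that of
  radius about 2^k a term of order 2^(-2 s k). The first series converges because s < 1, the second
  because s > 0. Each shell is enlarged to a ball, which affects constants only.\<close>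

lemma levy_integral_finite:
  assumes s: "0 < s" "s < 1"
  shows "(\<integral>\<^sup>+h. ennreal (min ((norm h)\<^sup>2) 1 * (1 / norm h powr (real DIM('a) + 2 * s))) \<partial>(lborel :: 'a::euclidean_space measure)) < \<infinity>"
proof -
  define p where "p = real DIM('a) + 2 * s"
  have p: "p > 0" using s by (simp add: p_def add_nonneg_pos)
  define V where "V = measure lborel (ball (0::'a) 1)"
  have V: "V \<ge> 0" by (simp add: V_def)
  \<comment> \<open>Near 0 the numerator is bounded by its value at the outer radius of the shell
    and the kernel by its value at the inner radius; hence the mismatch between \<open>k\<close> and
    \<open>Suc k\<close>.\<close>
  define a where "a k = ((1/2)^k)\<^sup>2 / ((1/2)^Suc k) powr p" for k :: nat
  define b where "b k = 1 / (2^k :: real) powr p" for k :: nat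
  have ab: "a k \<ge> 0" "b k \<ge> 0" for k by (auto simp: a_def b_def)
  have pt: "ennreal (min ((norm h)\<^sup>2) 1 * (1 / norm h powr p))
     \<le> (\<Sum>k. ennreal (a k) * indicator (ball 0 ((1/2)^k)) h) + (\<Sum>k. ennreal (b k) * indicator (ball 0 (2^Suc k)) h)" for h :: 'a
  proof -
    consider "h = 0" | "h \<noteq> 0" "norm h < 1" | "norm h \<ge> 1" by linarith
    then show ?thesis
    proof cases
      case 2
      then obtain k where k: "(1/2)^Suc k \<le> norm h" "norm h < (1/2)^k" using dyadic_below_1[of "norm h"] by auto
      have "min ((norm h)\<^sup>2) 1 * (1 / norm h powr p) \<le> ((1/2)^k)\<^sup>2 * (1 / ((1/2)^Suc k) powr p)"
      proof (rule mult_mono)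
        show "min ((norm h)\<^sup>2) 1 \<le> ((1/2)^k)\<^sup>2" using k power_mono[of "norm h" "(1/2)^k" 2] by (simp add: min_le_iff_disj)
        show "1 / norm h powr p \<le> 1 / ((1/2)^Suc k) powr p"
          using k p by (intro divide_left_mono powr_mono2 mult_pos_pos) (use 2 in auto)
      qed auto
      then have "ennreal (min ((norm h)\<^sup>2) 1 * (1 / norm h powr p)) \<le> ennreal (a k) * indicator (ball 0 ((1/2)^k)) h"
        using k by (simp add: a_def ennreal_leI)
      also have "\<dots> \<le> (\<Sum>k. ennreal (a k) * indicator (ball 0 ((1/2)^k)) h)"
        by (rule ennreal_le_suminf)
      finally show ?thesis by (simp add: add_increasing2)
    next
      case 3
      then obtain k where k: "2^k \<le> norm h" "norm h < 2^Suc k" using dyadic_above_1[of "norm h"] by auto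
      have "min ((norm h)\<^sup>2) 1 * (1 / norm h powr p) \<le> 1 * (1 / (2^k) powr p)"
      proof (rule mult_mono)
        show "1 / norm h powr p \<le> 1 / (2^k) powr p"
          using k p 3 by (intro divide_left_mono powr_mono2 mult_pos_pos) auto
      qed auto
      then have "ennreal (min ((norm h)\<^sup>2) 1 * (1 / norm h powr p)) \<le> ennreal (b k) * indicator (ball 0 (2^Suc k)) h"
        using k by (simp add: b_def ennreal_leI)
      also have "\<dots> \<le> (\<Sum>k. ennreal (b k) * indicator (ball 0 (2^Suc k)) h)"
        by (rule ennreal_le_suminf)
      finally show ?thesis by (simp add: add_increasing)
    qed simp
  qed
  have a': "a k * ((1/2)^k) ^ DIM('a) = 2 powr p * ((1/2) powr (2 - 2 * s)) ^ k" for k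
  proof -
    define x where "x = (1/2::real)^k"
    have x: "x > 0" by (simp add: x_def)
    have pw: "x powr 2 = x\<^sup>2" "x powr real DIM('a) = x ^ DIM('a)" "(1/2::real)^Suc k = x * (1/2)"
      using x by (simp_all add: powr_realpow x_def)
    have "a k * x ^ DIM('a) = x powr 2 / (x * (1/2)) powr p * x powr real DIM('a)"
      unfolding a_def pw x_def[symmetric] ..
    also have "\<dots> = (1 / (1/2) powr p) * (x powr 2 * x powr real DIM('a) / x powr p)"
      using x by (subst powr_mult) auto
    also have "x powr 2 * x powr real DIM('a) / x powr p = x powr (2 - 2 * s)"
      by (simp add: powr_add[symmetric] powr_diff[symmetric] p_def)
    also have "1 / (1/2) powr p = 2 powr p" by (simp add: powr_divide)
    also have "x powr (2 - 2 * s) = ((1/2) powr (2 - 2 * s)) ^ k"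
      by (simp add: x_def powr_realpow[symmetric] powr_powr mult.commute)
    finally show ?thesis by (simp add: x_def)
  qed
  have b': "b k * (2^Suc k) ^ DIM('a) = 2 ^ DIM('a) * ((1/2) powr (2 * s)) ^ k" for k
  proof -
    define x where "x = (2::real)^k"
    have x: "x > 0" by (simp add: x_def)
    have pw: "x powr real DIM('a) = x ^ DIM('a)" "(2::real)^Suc k = 2 * x"
      using x by (simp_all add: powr_realpow x_def)
    have "b k * (2^Suc k) ^ DIM('a) = 2 ^ DIM('a) * (x powr real DIM('a) / x powr p)"
      unfolding b_def pw x_def[symmetric] power_mult_distrib by simp
    also have "x powr real DIM('a) / x powr p = x powr (- (2 * s))"
      by (simp add: powr_diff[symmetric] p_def)
    also have "\<dots> = ((1/2) powr (2 * s)) ^ k"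
    proof -
      have "((1/2::real) powr (2 * s)) ^ k = ((1/2)^k) powr (2 * s)"
        by (simp add: powr_realpow[symmetric] powr_powr mult.commute)
      also have "(1/2::real)^k = inverse x" by (simp add: x_def power_one_over inverse_eq_divide)
      finally show ?thesis using x by (simp add: powr_minus inverse_powr)
    qed
    finally show ?thesis .
  qed
  have \<theta>: "(1/2::real) powr (2 - 2 * s) < 1" "(1/2::real) powr (2 * s) < 1"
    using s powr_less_mono'[of "1/2" 0 "2 * s"] powr_less_mono'[of "1/2" 0 "2 - 2 * s"] by auto
  have "(\<integral>\<^sup>+h. ennreal (min ((norm h)\<^sup>2) 1 * (1 / norm h powr p)) \<partial>(lborel :: 'a measure))
    \<le> (\<integral>\<^sup>+h. (\<Sum>k. ennreal (a k) * indicator (ball (0::'a) ((1/2)^k)) h) + (\<Sum>k. ennreal (b k) * indicator (ball (0::'a) (2^Suc k)) h) \<partial>lborel)"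
    by (intro nn_integral_mono pt)
  also have "\<dots> = (\<Sum>k. ennreal (a k) * emeasure lborel (ball (0::'a) ((1/2)^k))) + (\<Sum>k. ennreal (b k) * emeasure lborel (ball (0::'a) (2^Suc k)))"
    by (subst nn_integral_add) (auto simp: nn_integral_suminf nn_integral_cmult_indicator simp del: power_Suc)
  also have "(\<Sum>k. ennreal (a k) * emeasure lborel (ball (0::'a) ((1/2)^k))) = (\<Sum>k. ennreal (V * 2 powr p * ((1/2) powr (2 - 2 * s)) ^ k))"
  proof (rule suminf_cong)
    fix k
    have "ennreal (a k) * emeasure lborel (ball (0::'a) ((1/2)^k)) = ennreal (a k * ((1/2)^k) ^ DIM('a) * V)"
      using ab V by (subst emeasure_ball_scale) (auto simp: V_def[symmetric] ennreal_mult[symmetric] mult.assoc)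
    then show "ennreal (a k) * emeasure lborel (ball (0::'a) ((1/2)^k)) = ennreal (V * 2 powr p * ((1/2) powr (2 - 2 * s)) ^ k)"
      unfolding a' by (simp add: mult_ac)
  qed
  also have "(\<Sum>k. ennreal (b k) * emeasure lborel (ball (0::'a) (2^Suc k))) = (\<Sum>k. ennreal (V * 2 ^ DIM('a) * ((1/2) powr (2 * s)) ^ k))"
  proof (rule suminf_cong)
    fix k
    have "ennreal (b k) * emeasure lborel (ball (0::'a) (2^Suc k)) = ennreal (b k * (2^Suc k) ^ DIM('a) * V)"
      using ab V by (subst emeasure_ball_scale) (auto simp: V_def[symmetric] ennreal_mult[symmetric] mult.assoc)
    then show "ennreal (b k) * emeasure lborel (ball (0::'a) (2^Suc k)) = ennreal (V * 2 ^ DIM('a) * ((1/2) powr (2 * s)) ^ k)"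
      unfolding b' by (simp add: mult_ac)
  qed
  also have "(\<Sum>k. ennreal (V * 2 powr p * ((1/2) powr (2 - 2 * s)) ^ k)) + (\<Sum>k. ennreal (V * 2 ^ DIM('a) * ((1/2) powr (2 * s)) ^ k)) < \<infinity>"
    using V \<theta> by (subst (1 2) suminf_ennreal2) (auto intro!: summable_mult summable_geometric)
  finally show ?thesis by (simp add: p_def)
qed

definition mixed :: "real \<Rightarrow> ('a::euclidean_space \<Rightarrow> real) \<Rightarrow> ennreal" where
  "mixed s u = dirichlet u + gagl s u"

definition tent :: "real \<Rightarrow> 'a::euclidean_space \<Rightarrow> real" where
  "tent \<rho> x = max 0 (\<rho> - norm x)"

text \<open>The tent is bounded and Lipschitz, and the difference with its translate by
  \<open>h\<close> lives on at most two balls. Its squared L2 norm is therefore at most a constant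
  times min(|h|^2, 1), which suits both energy terms.\<close>

lemma mixed_tent_finite:
  assumes s: "0 < s" "s < 1" and \<rho>: "\<rho> > 0"
  shows "mixed s (tent \<rho> :: 'a::euclidean_space \<Rightarrow> real) < \<infinity>"
proof -
  let ?u = "tent \<rho> :: 'a \<Rightarrow> real"
  have [measurable]: "?u \<in> borel_measurable borel" unfolding tent_def by measurable
  have lip: "\<bar>?u x - ?u y\<bar> \<le> norm (x - y)" for x y
    unfolding tent_def using norm_triangle_ineq3[of x y] by linarith
  have bd: "\<bar>?u x - ?u y\<bar> \<le> \<rho>" for x y
    unfolding tent_def using norm_ge_zero[of x] norm_ge_zero[of y] \<rho> by linarith
  define \<beta> where "\<beta> = measure lborel (ball (0::'a) \<rho>)"
  have \<beta>: "emeasure lborel (ball (0::'a) \<rho>) = ennreal \<beta>" "\<beta> \<ge> 0"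
    using emeasure_lborel_ball_finite[of "0::'a" \<rho>] by (auto simp: \<beta>_def emeasure_eq_ennreal_measure)
  have T: "(\<integral>\<^sup>+x. ennreal ((?u (x + h) - ?u x)\<^sup>2) \<partial>lborel) \<le> ennreal (C\<^sup>2 * (2 * \<beta>))"
    if C: "\<And>x. \<bar>?u (x + h) - ?u x\<bar> \<le> C" for C h
  proof -
    have "ennreal ((?u (x + h) - ?u x)\<^sup>2) \<le> ennreal (C\<^sup>2) * (indicator (ball 0 \<rho>) (x + h) + indicator (ball 0 \<rho>) x)" for x
    proof (cases "x \<in> ball 0 \<rho> \<or> x + h \<in> ball 0 \<rho>")
      case True
      have "ennreal ((?u (x + h) - ?u x)\<^sup>2) \<le> ennreal (C\<^sup>2) * 1"
        using power_mono[OF C[of x], of 2] by (simp add: ennreal_leI)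
      also have "\<dots> \<le> ennreal (C\<^sup>2) * (indicator (ball 0 \<rho>) (x + h) + indicator (ball 0 \<rho>) x)"
        using True by (intro mult_left_mono) (auto simp: indicator_def)
      finally show ?thesis .
    next
      case False
      then show ?thesis by (simp add: tent_def)
    qed
    then have "(\<integral>\<^sup>+x. ennreal ((?u (x + h) - ?u x)\<^sup>2) \<partial>lborel) \<le> (\<integral>\<^sup>+x. ennreal (C\<^sup>2) * (indicator (ball 0 \<rho>) (x + h) + indicator (ball 0 \<rho>) x) \<partial>lborel)"
      by (intro nn_integral_mono)
    also have "\<dots> = ennreal (C\<^sup>2) * (ennreal \<beta> + ennreal \<beta>)"
      using nn_integral_lborel_add[of "indicator (ball (0::'a) \<rho>)" h]
      by (subst nn_integral_cmult) (auto simp: nn_integral_add \<beta>)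
    also have "\<dots> = ennreal (C\<^sup>2 * (\<beta> + \<beta>))" using \<beta>(2) by (simp only: ennreal_mult ennreal_plus zero_le_power2 add_nonneg_nonneg)
    finally show ?thesis by (simp only: mult_2)
  qed
  have "dirichlet ?u < \<infinity>"
  proof -
    define \<kappa> where "\<kappa> = ballmom TYPE('a)"
    have \<kappa>: "\<kappa> > 0" using ballmom_pos[where 'a='a] by (simp add: \<kappa>_def)
    define V where "V = measure lborel (ball (0::'a) 1)"
    have V: "V \<ge> 0" by (simp add: V_def)
    have "locq \<epsilon> ?u \<le> ennreal (2 * \<beta> * V / \<kappa>)" if \<epsilon>: "\<epsilon> > 0" for \<epsilon>
    proof -
      have "locq \<epsilon> ?u \<le> ennreal (1 / (\<kappa> * \<epsilon> ^ (DIM('a) + 2))) * (\<integral>\<^sup>+h. indicator (ball (0::'a) \<epsilon>) h * ennreal (\<epsilon>\<^sup>2 * (2 * \<beta>)) \<partial>lborel)"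
        unfolding locq_shift[OF \<open>?u \<in> borel_measurable borel\<close> \<epsilon>] \<kappa>_def[symmetric]
      proof (rule mult_left_mono, rule nn_integral_mono)
        fix h :: 'a
        show "indicator (ball 0 \<epsilon>) h * (\<integral>\<^sup>+x. ennreal ((?u (x + h) - ?u x)\<^sup>2) \<partial>lborel) \<le> indicator (ball 0 \<epsilon>) h * ennreal (\<epsilon>\<^sup>2 * (2 * \<beta>))"
        proof (cases "h \<in> ball 0 \<epsilon>")
          case True
          have "\<bar>?u (x + h) - ?u x\<bar> \<le> \<epsilon>" for x using lip[of "x + h" x] True by simp
          from T[OF this] show ?thesis by (intro mult_left_mono) auto
        qed simp
      qed simp
      also have "(\<integral>\<^sup>+h. indicator (ball (0::'a) \<epsilon>) h * ennreal (\<epsilon>\<^sup>2 * (2 * \<beta>)) \<partial>lborel) = ennreal (\<epsilon> ^ DIM('a) * V) * ennreal (\<epsilon>\<^sup>2 * (2 * \<beta>))"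
        using \<epsilon> by (subst nn_integral_multc) (auto simp: emeasure_ball_scale V_def)
      also have "ennreal (1 / (\<kappa> * \<epsilon> ^ (DIM('a) + 2))) * (ennreal (\<epsilon> ^ DIM('a) * V) * ennreal (\<epsilon>\<^sup>2 * (2 * \<beta>))) = ennreal (1 / (\<kappa> * \<epsilon> ^ (DIM('a) + 2)) * (\<epsilon> ^ DIM('a) * V * (\<epsilon>\<^sup>2 * (2 * \<beta>))))"
      proof -
        have "1 / (\<kappa> * \<epsilon> ^ (DIM('a) + 2)) \<ge> 0" "\<epsilon> ^ DIM('a) * V \<ge> 0" "\<epsilon>\<^sup>2 * (2 * \<beta>) \<ge> 0"
          using \<epsilon> \<kappa> V \<beta> by auto
        then show ?thesis by (simp only: ennreal_mult mult_nonneg_nonneg)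
      qed
      also have "1 / (\<kappa> * \<epsilon> ^ (DIM('a) + 2)) * (\<epsilon> ^ DIM('a) * V * (\<epsilon>\<^sup>2 * (2 * \<beta>))) = 2 * \<beta> * V / \<kappa>"
        using \<epsilon> \<kappa> by (simp add: power_add power2_eq_square)
      finally show ?thesis .
    qed
    then have "dirichlet ?u \<le> ennreal (2 * \<beta> * V / \<kappa>)" unfolding dirichlet_def by (intro SUP_least) auto
    then show ?thesis by (rule order_le_less_trans) simp
  qed
  moreover have "gagl s ?u < \<infinity>"
  proof -
    define p where "p = real DIM('a) + 2 * s"
    define J where "J = (\<integral>\<^sup>+h. ennreal (min ((norm h)\<^sup>2) 1 * (1 / norm h powr p)) \<partial>(lborel :: 'a measure))"
    define K where "K = 2 * \<beta> * (1 + \<rho>\<^sup>2)"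
    have K: "K \<ge> 0" using \<beta> by (simp add: K_def)
    have "gagl s ?u = (\<integral>\<^sup>+h. ennreal (1 / norm h powr p) * (\<integral>\<^sup>+x. ennreal ((?u (x + h) - ?u x)\<^sup>2) \<partial>lborel) \<partial>lborel)"
      unfolding gagl_def p_def by (rule qform_shift) auto
    also have "\<dots> \<le> (\<integral>\<^sup>+h. ennreal K * ennreal (min ((norm h)\<^sup>2) 1 * (1 / norm h powr p)) \<partial>(lborel :: 'a measure))"
    proof (rule nn_integral_mono)
      fix h :: 'a
      define m where "m = min (norm h) \<rho>"
      have "\<bar>?u (x + h) - ?u x\<bar> \<le> m" for x using lip[of "x + h" x] bd[of "x + h" x] by (simp add: m_def)
      from T[OF this] have T1: "(\<integral>\<^sup>+x. ennreal ((?u (x + h) - ?u x)\<^sup>2) \<partial>lborel) \<le> ennreal (m\<^sup>2 * (2 * \<beta>))" .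
      have "m\<^sup>2 \<le> (1 + \<rho>\<^sup>2) * min ((norm h)\<^sup>2) 1"
      proof (cases "norm h \<le> 1")
        case True
        then have "min ((norm h)\<^sup>2) 1 = (norm h)\<^sup>2" by (simp add: power_le_one min_def)
        moreover have "m\<^sup>2 \<le> (norm h)\<^sup>2" using \<rho> by (intro power_mono) (auto simp: m_def)
        moreover have "0 \<le> \<rho>\<^sup>2 * (norm h)\<^sup>2" by simp
        ultimately show ?thesis by (simp only: distrib_right mult_1)
      next
        case False
        then have "min ((norm h)\<^sup>2) 1 = 1" using one_le_power[of "norm h" 2] by (intro min_absorb2) simp
        moreover have "m\<^sup>2 \<le> \<rho>\<^sup>2" using \<rho> by (intro power_mono) (auto simp: m_def)
        ultimately show ?thesis by simp
      qed
      then have "m\<^sup>2 * (2 * \<beta>) \<le> ((1 + \<rho>\<^sup>2) * min ((norm h)\<^sup>2) 1) * (2 * \<beta>)"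
        using \<beta>(2) by (intro mult_right_mono) auto
      also have "\<dots> = K * min ((norm h)\<^sup>2) 1" by (simp only: K_def mult_ac)
      finally have "ennreal (m\<^sup>2 * (2 * \<beta>)) \<le> ennreal (K * min ((norm h)\<^sup>2) 1)" by (rule ennreal_leI)
      with T1 have "(\<integral>\<^sup>+x. ennreal ((?u (x + h) - ?u x)\<^sup>2) \<partial>lborel) \<le> ennreal (K * min ((norm h)\<^sup>2) 1)"
        by (rule order_trans)
      then have "ennreal (1 / norm h powr p) * (\<integral>\<^sup>+x. ennreal ((?u (x + h) - ?u x)\<^sup>2) \<partial>lborel) \<le> ennreal (1 / norm h powr p) * ennreal (K * min ((norm h)\<^sup>2) 1)"
        by (intro mult_left_mono) auto
      also have "\<dots> = ennreal (K * (min ((norm h)\<^sup>2) 1 * (1 / norm h powr p)))"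
        using K by (subst ennreal_mult[symmetric]) (auto simp: mult_ac)
      also have "\<dots> = ennreal K * ennreal (min ((norm h)\<^sup>2) 1 * (1 / norm h powr p))"
        using K by (intro ennreal_mult) auto
      finally show "ennreal (1 / norm h powr p) * (\<integral>\<^sup>+x. ennreal ((?u (x + h) - ?u x)\<^sup>2) \<partial>lborel) \<le> ennreal K * ennreal (min ((norm h)\<^sup>2) 1 * (1 / norm h powr p))" .
    qed
    also have "\<dots> = ennreal K * J" unfolding J_def by (rule nn_integral_cmult) measurable
    also have "\<dots> < \<infinity>"
      using levy_integral_finite[OF s, where 'a='a] by (simp add: J_def p_def ennreal_mult_less_top)
    finally show ?thesis .
  qed
  ultimately show ?thesis by (simp add: mixed_def)
qed

section \<open>Minimizers under a volume constraint\<close>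

lemma frac_kernel:
  assumes "s > 0"
  shows "(\<lambda>r. 1 / r powr (real n + 2 * s)) \<in> borel_measurable borel" "1 / r powr (real n + 2 * s) \<ge> 0"
    and "0 < r \<Longrightarrow> r < t \<Longrightarrow> 1 / t powr (real n + 2 * s) < 1 / r powr (real n + 2 * s)"
proof -
  assume "0 < r" "r < t"
  then show "1 / t powr (real n + 2 * s) < 1 / r powr (real n + 2 * s)"
    using assms by (intro divide_strict_left_mono powr_less_mono2 mult_pos_pos) auto
qed auto

text \<open>The total energy becomes one supremum of forms with kernel \<open>kloc\<close> plus the
  Gagliardo kernel, which makes it lower semicontinuous under a.e. convergence.\<close>

lemma mixed_eq_SUP: "mixed s u = (SUP \<epsilon>\<in>{0<..}. locq \<epsilon> u + gagl s u)"
proof -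
  have "{0<..} \<noteq> ({} :: real set)" using greaterThan_non_empty by blast
  then show ?thesis by (simp add: mixed_def dirichlet_def ennreal_SUP_add_left)
qed

lemma mixed_cong_AE: "AE x in lborel. u x = v x \<Longrightarrow> mixed s u = mixed s v"
  by (simp add: mixed_def dirichlet_def locq_def gagl_def qform_cong_AE[of u v])

lemma dirichlet_mono: "(\<And>\<epsilon>. \<epsilon> > 0 \<Longrightarrow> locq \<epsilon> u \<le> locq \<epsilon> v) \<Longrightarrow> dirichlet u \<le> dirichlet v"
  unfolding dirichlet_def by (rule SUP_mono) auto

lemma mixed_abs_le: "mixed s (\<lambda>x. \<bar>u x\<bar>) \<le> mixed s u"
  unfolding mixed_def
proof (rule add_mono)
  show "dirichlet (\<lambda>x. \<bar>u x\<bar>) \<le> dirichlet u"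
    unfolding locq_def by (rule dirichlet_mono) (simp add: locq_def qform_abs_le kloc_nonneg)
  show "gagl s (\<lambda>x. \<bar>u x\<bar>) \<le> gagl s u"
    unfolding gagl_def by (rule qform_abs_le) simp
qed

lemma mixed_cmult:
  assumes [measurable]: "u \<in> borel_measurable borel"
  shows "mixed s (\<lambda>x. c * u x) = ennreal (c\<^sup>2) * mixed s u"
  unfolding mixed_def dirichlet_def locq_def gagl_def
  by (simp add: qform_cmult SUP_mult_left_ennreal distrib_left)

lemma mixed_translate:
  assumes [measurable]: "u \<in> borel_measurable borel"
  shows "mixed s (\<lambda>x. u (x + c)) = mixed s u"
  unfolding mixed_def dirichlet_def locq_def gagl_def
  by (simp add: qform_translate)

lemma qform_kernel_add:
  assumes [measurable]: "u \<in> borel_measurable borel" "k \<in> borel_measurable borel" "l \<in> borel_measurable borel"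
    and "\<And>r. k r \<ge> 0" "\<And>r. l r \<ge> 0"
  shows "qform (\<lambda>r. k r + l r) u = qform k u + qform l u"
proof -
  have "ennreal ((u x - u y)\<^sup>2 * (k (norm (x - y)) + l (norm (x - y))))
    = ennreal ((u x - u y)\<^sup>2 * k (norm (x - y))) + ennreal ((u x - u y)\<^sup>2 * l (norm (x - y)))" for x y
    using assms by (simp add: distrib_left)
  then show ?thesis by (simp add: qform_def nn_integral_add)
qed

lemma qform_kernel_cmult:
  assumes [measurable]: "u \<in> borel_measurable borel" "k \<in> borel_measurable borel" and "c \<ge> 0"
  shows "qform (\<lambda>r. c * k r) u = ennreal c * qform k u"
proof -
  have "ennreal ((u x - u y)\<^sup>2 * (c * k (norm (x - y)))) = ennreal c * ennreal ((u x - u y)\<^sup>2 * k (norm (x - y)))" for x y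
    using assms(3) by (subst ennreal_mult'[symmetric]) (auto simp: mult_ac)
  then show ?thesis by (simp add: qform_def nn_integral_cmult)
qed

section \<open>Scaling of the two energy terms\<close>

lemma locq_scale:
  fixes u :: "'a::euclidean_space \<Rightarrow> real"
  assumes [measurable]: "u \<in> borel_measurable borel" and t: "t > 0" and \<epsilon>: "\<epsilon> > 0"
  shows "locq \<epsilon> (\<lambda>x. u (x /\<^sub>R t)) = ennreal (t ^ DIM('a) / t\<^sup>2) * locq (\<epsilon> / t) u"
proof -
  have keq: "(\<lambda>r. kloc TYPE('a) \<epsilon> (t * r)) = (\<lambda>r. (1 / t ^ (DIM('a) + 2)) * kloc TYPE('a) (\<epsilon> / t) r)"
  proof
    fix r
    show "kloc TYPE('a) \<epsilon> (t * r) = (1 / t ^ (DIM('a) + 2)) * kloc TYPE('a) (\<epsilon> / t) r"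
      using t by (simp add: kloc_def field_simps power_divide)
  qed
  have "locq \<epsilon> (\<lambda>x. u (x /\<^sub>R t)) = ennreal (t ^ (2 * DIM('a))) * qform (\<lambda>r. kloc TYPE('a) \<epsilon> (t * r)) u"
    unfolding locq_def by (rule qform_scale) (use t in auto)
  also have "\<dots> = ennreal (t ^ (2 * DIM('a))) * (ennreal (1 / t ^ (DIM('a) + 2)) * locq (\<epsilon> / t) u)"
    unfolding keq locq_def by (subst qform_kernel_cmult) (use t in auto)
  also have "\<dots> = ennreal (t ^ (2 * DIM('a)) * (1 / t ^ (DIM('a) + 2))) * locq (\<epsilon> / t) u"
    using t by (subst ennreal_mult) (auto simp: mult.assoc)
  also have "t ^ (2 * DIM('a)) * (1 / t ^ (DIM('a) + 2)) = t ^ DIM('a) / t\<^sup>2"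
    using t by (simp add: power_add mult_2 power2_eq_square)
  finally show ?thesis .
qed

lemma gagl_scale:
  fixes u :: "'a::euclidean_space \<Rightarrow> real"
  assumes [measurable]: "u \<in> borel_measurable borel" and t: "t > 0"
  shows "gagl s (\<lambda>x. u (x /\<^sub>R t)) = ennreal (t ^ DIM('a) * t powr (- 2 * s)) * gagl s u"
proof -
  define p where "p = real DIM('a) + 2 * s"
  \<comment> \<open>The identity is needed for all real \<open>r\<close>, including negative ones,
    because the kernels are compared as functions.\<close>
  have "(t * r) powr p = t powr p * r powr p" for r
    using t by (cases "r \<ge> 0") (auto simp: powr_mult mult_pos_neg powr_def ln_mult distrib_left exp_add)
  then have "(\<lambda>r. 1 / (t * r) powr p) = (\<lambda>r. (1 / t powr p) * (1 / r powr p))"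
    by (simp add: fun_eq_iff)
  then have "gagl s (\<lambda>x. u (x /\<^sub>R t)) = ennreal (t ^ (2 * DIM('a))) * (ennreal (1 / t powr p) * gagl s u)"
    unfolding gagl_def p_def[symmetric] using t qform_kernel_cmult[of u "\<lambda>r. 1 / r powr p" "1 / t powr p"]
    by (simp add: qform_scale)
  also have "\<dots> = ennreal (t ^ (2 * DIM('a)) * (1 / t powr p)) * gagl s u"
    using t by (subst ennreal_mult) (auto simp: mult.assoc)
  also have "t ^ (2 * DIM('a)) * (1 / t powr p) = t ^ DIM('a) * t powr (- 2 * s)"
  proof -
    have "t powr p = t ^ DIM('a) * t powr (2 * s)" using t by (simp add: p_def powr_add powr_realpow)
    moreover have "t powr (- 2 * s) = 1 / t powr (2 * s)" using powr_minus_divide[of t "2 * s"] by simp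
    moreover have "t ^ (2 * DIM('a)) = t ^ DIM('a) * t ^ DIM('a)" by (simp add: mult_2 power_add)
    ultimately show ?thesis using t by simp
  qed
  finally show ?thesis .
qed

text \<open>The volume constraint is an inequality, since the positivity set of a limit may be
  smaller. The fixed ball provides compactness, and the normalization excludes the zero
  function.\<close>

definition admissible :: "real \<Rightarrow> real \<Rightarrow> ('a::euclidean_space \<Rightarrow> real) set" where
  "admissible m R = {u. u \<in> borel_measurable borel \<and> (\<forall>x. u x \<ge> 0) \<and> (\<forall>x. x \<notin> ball 0 R \<longrightarrow> u x = 0) \<and>
     emeasure lborel {x. u x \<noteq> 0} \<le> ennreal m \<and> (\<integral>\<^sup>+x. ennreal ((u x)\<^sup>2) \<partial>lborel) = 1}"

lemma admissibleD:
  assumes "u \<in> admissible m R"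
  shows "u \<in> borel_measurable borel" "\<And>x. u x \<ge> 0" "\<And>x. x \<notin> ball 0 R \<Longrightarrow> u x = 0"
    "emeasure lborel {x. u x \<noteq> 0} \<le> ennreal m" "(\<integral>\<^sup>+x. ennreal ((u x)\<^sup>2) \<partial>lborel) = 1" "integrable lborel u"
    "\<not> (AE x in lborel. u x = 0)"
proof -
  show u: "u \<in> borel_measurable borel" "\<And>x. u x \<ge> 0" "\<And>x. x \<notin> ball 0 R \<Longrightarrow> u x = 0"
    "emeasure lborel {x. u x \<noteq> 0} \<le> ennreal m" and u1: "(\<integral>\<^sup>+x. ennreal ((u x)\<^sup>2) \<partial>lborel) = 1"
    using assms by (auto simp: admissible_def)
  show "integrable lborel u" by (rule integrable_of_sq_bounded[OF u(1) u(3)]) (use u1 in auto)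
  show "\<not> (AE x in lborel. u x = 0)"
  proof
    assume "AE x in lborel. u x = 0"
    then have "(\<integral>\<^sup>+x. ennreal ((u x)\<^sup>2) \<partial>lborel) = (\<integral>\<^sup>+x. 0 \<partial>(lborel :: 'a measure))"
      by (intro nn_integral_cong_AE) (auto elim!: eventually_mono)
    then show False using u1 by simp
  qed
qed

text \<open>Existence by compactness for a sequence with energies below L + 2^-n. The set
  \<open>W\<close> allows two uses: the whole space yields a minimizer, and a domain yields one that
  still vanishes outside that domain.\<close>

lemma admissible_limit:
  fixes u :: "nat \<Rightarrow> 'a::euclidean_space \<Rightarrow> real"
  assumes s: "s > 0" and adm: "\<And>n. u n \<in> admissible m R" and L: "L \<ge> 0"
    and E: "\<And>n. mixed s (u n) \<le> ennreal (L + (1/2)^n)"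
    and W[measurable]: "W \<in> sets borel" and uW: "\<And>n x. x \<notin> W \<Longrightarrow> u n x = 0"
  obtains v where "v \<in> admissible m R" "mixed s v \<le> ennreal L" "\<And>x. x \<notin> W \<Longrightarrow> v x = 0"
proof -
  note u = admissibleD[OF adm]
  have um[measurable]: "u n \<in> borel_measurable borel" for n by (rule u)
  have gb: "gagl s (u n) \<le> ennreal (L + 1)" for n
  proof -
    have "gagl s (u n) \<le> mixed s (u n)" by (simp add: mixed_def)
    also have "\<dots> \<le> ennreal (L + (1/2)^n)" by (rule E)
    also have "\<dots> \<le> ennreal (L + 1)" by (intro ennreal_leI) (simp add: power_le_one)
    finally show ?thesis .
  qed
  obtain \<phi> v0 where \<phi>: "strict_mono \<phi>" and v0m[measurable]: "v0 \<in> borel_measurable borel"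
    and AE0: "AE x in lborel. (\<lambda>n. u (\<phi> n) x) \<longlonglongrightarrow> v0 x"
    and lim0: "(\<lambda>n. \<integral>\<^sup>+x. ennreal ((u (\<phi> n) x - v0 x)\<^sup>2) \<partial>lborel) \<longlonglongrightarrow> 0"
    by (rule fractional_compactness[of s u R "L + 1"]) (use s u(3,5) L gb in auto)
  \<comment> \<open>The a.e. limit is changed on a null set so that the sign and the vanishing
    required of admissible functions hold at every point.\<close>
  define v where "v x = indicator (W \<inter> ball 0 R) x * max 0 (v0 x)" for x
  have vm[measurable]: "v \<in> borel_measurable borel" unfolding v_def by measurable
  have eq: "AE x in lborel. v0 x = v x"
    using AE0
  proof eventually_elim
    case (elim x)
    have "v0 x \<ge> 0" by (rule LIMSEQ_le_const[OF elim]) (use u(2) in auto)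
    moreover have "v0 x = 0" if "x \<notin> W \<inter> ball 0 R"
    proof -
      have "(\<lambda>n. u (\<phi> n) x) = (\<lambda>n. 0)" using that uW u(3) by fastforce
      then show ?thesis using elim by (metis LIMSEQ_unique tendsto_const)
    qed
    ultimately show ?case by (cases "x \<in> W \<inter> ball 0 R") (auto simp: v_def)
  qed
  have AE: "AE x in lborel. (\<lambda>n. u (\<phi> n) x) \<longlonglongrightarrow> v x" using AE0 eq by eventually_elim simp
  have "(\<integral>\<^sup>+x. ennreal ((u (\<phi> n) x - v0 x)\<^sup>2) \<partial>lborel) = (\<integral>\<^sup>+x. ennreal ((u (\<phi> n) x - v x)\<^sup>2) \<partial>lborel)" for n
    using eq by (intro nn_integral_cong_AE) (auto elim!: eventually_mono)
  then have lim: "(\<lambda>n. \<integral>\<^sup>+x. ennreal ((u (\<phi> n) x - v x)\<^sup>2) \<partial>lborel) \<longlonglongrightarrow> 0" using lim0 by simp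
  define I where "I = (\<integral>\<^sup>+x. ennreal ((v x)\<^sup>2) \<partial>lborel)"
  have I1: "I \<le> 1"
    unfolding I_def
  proof (rule fatou_bound[where h="\<lambda>n x. ennreal ((u (\<phi> n) x)\<^sup>2)"])
    show "AE x in lborel. (\<lambda>n. ennreal ((u (\<phi> n) x)\<^sup>2)) \<longlonglongrightarrow> ennreal ((v x)\<^sup>2)"
      using AE by eventually_elim (intro tendsto_intros)
  qed (use u(5) in auto)
  \<comment> \<open>Fatou gives only norm at most 1; strong convergence has to exclude a loss of
    mass. Young's inequality with a free \<tau> does so without subtracting infinite
    quantities.\<close>
  have I2: "1 \<le> I + ennreal \<tau>" if \<tau>: "\<tau> > 0" for \<tau>
  proof -
    have step: "1 \<le> ennreal (1 + \<tau>) * I + ennreal (1 + 1 / \<tau>) * (\<integral>\<^sup>+x. ennreal ((u (\<phi> n) x - v x)\<^sup>2) \<partial>lborel)" for n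
    proof -
      have "1 = (\<integral>\<^sup>+x. ennreal ((u (\<phi> n) x)\<^sup>2) \<partial>lborel)" using u(5) by simp
      also have "\<dots> \<le> (\<integral>\<^sup>+x. ennreal (1 + \<tau>) * ennreal ((v x)\<^sup>2) + ennreal (1 + 1 / \<tau>) * ennreal ((u (\<phi> n) x - v x)\<^sup>2) \<partial>lborel)"
      proof (rule nn_integral_mono)
        fix x
        define p q where "p = v x" and "q = u (\<phi> n) x - v x"
        have "0 \<le> (\<tau> * p - q)\<^sup>2 / \<tau>" using \<tau> by simp
        also have "\<dots> = \<tau> * p\<^sup>2 + 1 / \<tau> * q\<^sup>2 - 2 * p * q"
          using \<tau> by (simp add: power2_eq_square field_simps)
        finally have "(p + q)\<^sup>2 \<le> (1 + \<tau>) * p\<^sup>2 + (1 + 1 / \<tau>) * q\<^sup>2"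
          unfolding power2_sum by (simp add: algebra_simps)
        then have "ennreal ((p + q)\<^sup>2) \<le> ennreal ((1 + \<tau>) * p\<^sup>2 + (1 + 1 / \<tau>) * q\<^sup>2)" by (rule ennreal_leI)
        also have "\<dots> = ennreal (1 + \<tau>) * ennreal (p\<^sup>2) + ennreal (1 + 1 / \<tau>) * ennreal (q\<^sup>2)"
          using \<tau> by (subst ennreal_plus) (auto simp: ennreal_mult add_nonneg_nonneg simp del: ennreal_plus)
        finally show "ennreal ((u (\<phi> n) x)\<^sup>2) \<le> ennreal (1 + \<tau>) * ennreal ((v x)\<^sup>2) + ennreal (1 + 1 / \<tau>) * ennreal ((u (\<phi> n) x - v x)\<^sup>2)"
          by (simp add: p_def q_def)
      qed
      also have "\<dots> = ennreal (1 + \<tau>) * I + ennreal (1 + 1 / \<tau>) * (\<integral>\<^sup>+x. ennreal ((u (\<phi> n) x - v x)\<^sup>2) \<partial>lborel)"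
        by (simp add: nn_integral_add nn_integral_cmult I_def)
      finally show ?thesis .
    qed
    have "(\<lambda>n. ennreal (1 + \<tau>) * I + ennreal (1 + 1 / \<tau>) * (\<integral>\<^sup>+x. ennreal ((u (\<phi> n) x - v x)\<^sup>2) \<partial>lborel)) \<longlonglongrightarrow> ennreal (1 + \<tau>) * I + ennreal (1 + 1 / \<tau>) * 0"
      by (intro tendsto_add tendsto_const ennreal_tendsto_cmult lim) simp
    then have "1 \<le> ennreal (1 + \<tau>) * I + ennreal (1 + 1 / \<tau>) * 0"
      by (rule LIMSEQ_le_const) (use step in blast)
    also have "\<dots> = ennreal (1 + \<tau>) * I" by simp
    also have "ennreal (1 + \<tau>) = 1 + ennreal \<tau>" using \<tau> by (subst ennreal_plus) auto
    also have "(1 + ennreal \<tau>) * I = I + ennreal \<tau> * I" by (simp only: distrib_right mult_1)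
    also have "\<dots> \<le> I + ennreal \<tau> * 1" using I1 by (intro add_left_mono mult_left_mono) auto
    finally show ?thesis by simp
  qed
  have "1 \<le> I" by (rule ennreal_le_epsilon) (rule I2)
  then have v1: "(\<integral>\<^sup>+x. ennreal ((v x)\<^sup>2) \<partial>lborel) = 1" using I1 by (simp add: I_def)
  have "emeasure lborel {x. v x \<noteq> 0} = (\<integral>\<^sup>+x. indicator {x. v x \<noteq> 0} x \<partial>lborel)" by simp
  also have "\<dots> \<le> (\<integral>\<^sup>+x. liminf (\<lambda>n. indicator {x. u (\<phi> n) x \<noteq> 0} x) \<partial>lborel)"
  proof (rule nn_integral_mono_AE)
    \<comment> \<open>Where the limit is nonzero the approximants are eventually nonzero, so the
      volume of the positivity set is lower semicontinuous.\<close>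
    show "AE x in lborel. indicator {x. v x \<noteq> 0} x \<le> liminf (\<lambda>n. indicator {x. u (\<phi> n) x \<noteq> 0} x :: ennreal)"
      using AE
    proof eventually_elim
      case (elim x)
      show ?case
      proof (cases "v x = 0")
        case False
        then have "eventually (\<lambda>n. u (\<phi> n) x \<noteq> 0) sequentially"
          using tendsto_imp_eventually_ne[OF elim] by simp
        then have "eventually (\<lambda>n. indicator {x. u (\<phi> n) x \<noteq> 0} x = (1::ennreal)) sequentially"
          by (rule eventually_mono) simp
        then have "(\<lambda>n. indicator {x. u (\<phi> n) x \<noteq> 0} x) \<longlonglongrightarrow> (1::ennreal)" by (rule tendsto_eventually)
        then have "liminf (\<lambda>n. indicator {x. u (\<phi> n) x \<noteq> 0} x) = (1::ennreal)" by (rule lim_imp_Liminf[rotated]) simp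
        then show ?thesis using False by simp
      qed simp
    qed
  qed
  also have "\<dots> \<le> liminf (\<lambda>n. \<integral>\<^sup>+x. indicator {x. u (\<phi> n) x \<noteq> 0} x \<partial>lborel)"
    by (rule nn_integral_liminf) measurable
  also have "\<dots> = liminf (\<lambda>n. emeasure lborel {x. u (\<phi> n) x \<noteq> 0})" by simp
  also have "\<dots> \<le> limsup (\<lambda>n. emeasure lborel {x. u (\<phi> n) x \<noteq> 0})" by (rule Liminf_le_Limsup) simp
  also have "\<dots> \<le> ennreal m" by (rule Limsup_bounded) (use u(4) in auto)
  finally have vm': "emeasure lborel {x. v x \<noteq> 0} \<le> ennreal m" .
  have "v \<in> admissible m R"
    unfolding admissible_def using vm v1 vm' by (auto simp: v_def)
  moreover have "mixed s v \<le> ennreal L"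
    unfolding mixed_eq_SUP
  proof (rule SUP_least)
    fix \<epsilon> :: real assume "\<epsilon> \<in> {0<..}"
    then have \<epsilon>: "\<epsilon> > 0" by simp
    \<comment> \<open>Only the sum of the two terms is nearly bounded by \<open>L\<close>, so Fatou
      has to act on a single kernel carrying both.\<close>
    let ?k = "\<lambda>r. kloc TYPE('a) \<epsilon> r + 1 / r powr (real DIM('a) + 2 * s)"
    have k: "qform ?k w = locq \<epsilon> w + gagl s w" if [measurable]: "w \<in> borel_measurable borel" for w :: "'a \<Rightarrow> real"
      unfolding locq_def gagl_def by (rule qform_kernel_add) (auto simp: kloc_nonneg[OF \<epsilon>])
    have "qform ?k v \<le> ennreal L"
    proof (rule ennreal_le_epsilon)
      fix e :: real assume e: "e > 0"
      have "(\<lambda>n. (1/2::real)^n) \<longlonglongrightarrow> 0" by (rule LIMSEQ_power_zero) simp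
      then have "eventually (\<lambda>n. (1/2::real)^n < e) sequentially" using e by (intro order_tendstoD) auto
      then have ev: "eventually (\<lambda>n. qform ?k (u (\<phi> n)) \<le> ennreal L + ennreal e) sequentially"
      proof eventually_elim
        case (elim n)
        have "qform ?k (u (\<phi> n)) \<le> mixed s (u (\<phi> n))"
          unfolding k[OF um] mixed_eq_SUP using \<epsilon> by (intro SUP_upper) simp
        also have "\<dots> \<le> ennreal (L + (1/2)^(\<phi> n))" by (rule E)
        also have "\<dots> \<le> ennreal (L + e)"
        proof (rule ennreal_leI)
          have "(1/2::real)^(\<phi> n) \<le> (1/2)^n" using seq_suble[OF \<phi>, of n] by (intro power_decreasing) auto
          then show "L + (1/2)^(\<phi> n) \<le> L + e" using elim by linarith
        qed
        finally show ?case using L e by simp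
      qed
      show "qform ?k v \<le> ennreal L + ennreal e" by (rule qform_fatou[OF _ _ AE ev]) auto
    qed
    then show "locq \<epsilon> v + gagl s v \<le> ennreal L" using k[OF vm] by simp
  qed
  ultimately show ?thesis using that[of v] by (auto simp: v_def)
qed

lemma polar_admissible:
  fixes u :: "'a::euclidean_space \<Rightarrow> real"
  assumes e: "norm e = 1" and a: "a \<le> 0" and u: "u \<in> admissible m R"
  shows "polar e a u \<in> admissible m R"
proof -
  note uD = admissibleD[OF u]
  have um[measurable]: "u \<in> borel_measurable borel" by (rule uD)
  have "(\<integral>\<^sup>+x. indicator (- {0::real}) (polar e a u x) \<partial>lborel) = (\<integral>\<^sup>+x. indicator (- {0::real}) (u x) \<partial>lborel)"
    by (rule nn_integral_polar[OF e um]) auto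
  moreover have "(\<integral>\<^sup>+x. indicator (- {0::real}) (w x) \<partial>lborel) = emeasure lborel {x. w x \<noteq> 0}"
    if [measurable]: "w \<in> borel_measurable borel" for w :: "'a \<Rightarrow> real"
  proof -
    have "(\<integral>\<^sup>+x. indicator (- {0::real}) (w x) \<partial>lborel) = (\<integral>\<^sup>+x. indicator {x. w x \<noteq> 0} x \<partial>lborel)"
      by (intro nn_integral_cong) (auto simp: indicator_def)
    then show ?thesis by simp
  qed
  ultimately have "emeasure lborel {x. polar e a u x \<noteq> 0} = emeasure lborel {x. u x \<noteq> 0}" by simp
  moreover have "(\<integral>\<^sup>+x. ennreal ((polar e a u x)\<^sup>2) \<partial>lborel) = (\<integral>\<^sup>+x. ennreal ((u x)\<^sup>2) \<partial>lborel)"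
    by (rule nn_integral_polar[OF e um, of "\<lambda>t. ennreal (t\<^sup>2)"]) auto
  moreover have "polar e a u x \<ge> 0" for x using uD(2) by (simp add: polar_def le_max_iff_disj)
  moreover have "polar e a u x = 0" if "x \<notin> ball 0 R" for x
    by (rule polar_support[OF e a uD(2) uD(3) that])
  ultimately show ?thesis using uD(4,5) by (auto simp: admissible_def)
qed

text \<open>Polarization keeps a minimizer admissible and raises neither energy term. Minimality and
  finiteness then force equality in the Gagliardo term on its own, and its strict kernel yields the
  dichotomy for every hyperplane.\<close>

lemma minimizer_positivity_ball:
  fixes u :: "'a::euclidean_space \<Rightarrow> real"
  assumes s: "s > 0" and u: "u \<in> admissible m R" and fin: "mixed s u < \<infinity>"
    and min: "\<And>w::'a \<Rightarrow> real. w \<in> admissible m R \<Longrightarrow> mixed s u \<le> mixed s w"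
  obtains c \<rho> where "\<rho> \<ge> 0" "AE x in lborel. x \<in> ball c \<rho> \<longrightarrow> u x > 0" "AE x in lborel. x \<notin> cball c \<rho> \<longrightarrow> u x = 0"
proof -
  note uD = admissibleD[OF u]
  have um[measurable]: "u \<in> borel_measurable borel" by (rule uD)
  have gfin: "gagl s u < \<infinity>" and dfin: "dirichlet u < \<infinity>" using fin by (auto simp: mixed_def)
  have dich0: "(AE x in lborel. x \<bullet> e > a \<longrightarrow> u (hrefl e a x) \<le> u x) \<or> (AE x in lborel. x \<bullet> e > a \<longrightarrow> u x \<le> u (hrefl e a x))"
    if e: "norm e = 1" and a: "a \<le> 0" for e a
  proof -
    let ?p = "polar e a u"
    have d: "dirichlet ?p \<le> dirichlet u"
      by (rule dirichlet_mono)
         (auto simp: locq_def intro!: qform_polar_le[OF e] kloc_nonneg kloc_antimono)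
    have g: "gagl s ?p \<le> gagl s u"
      unfolding gagl_def using frac_kernel(3)[OF s]
      by (intro qform_polar_le[OF e]) (auto simp: less_eq_real_def)
    have "dirichlet u + gagl s u \<le> dirichlet ?p + gagl s ?p"
      using min[OF polar_admissible[OF e a u]] by (simp add: mixed_def)
    also have "\<dots> \<le> dirichlet u + gagl s ?p" using d by (rule add_right_mono)
    finally have "gagl s u \<le> gagl s ?p" using dfin by (auto simp: ennreal_add_left_cancel_le)
    then have "gagl s ?p = gagl s u" using g by simp
    then show ?thesis
      unfolding gagl_def using gfin[unfolded gagl_def] frac_kernel(3)[OF s]
      by (intro qform_polar_eq[OF e um]) auto
  qed
  \<comment> \<open>For a > 0 the pair \<open>- e\<close>, \<open>- a\<close> describes the same
    reflection with the half spaces exchanged and satisfies the sign condition; the a.e. statement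
    is carried back by the reflection.\<close>
  have dich: "(AE x in lborel. x \<bullet> e > a \<longrightarrow> u (hrefl e a x) \<le> u x) \<or> (AE x in lborel. x \<bullet> e > a \<longrightarrow> u x \<le> u (hrefl e a x))"
    if e: "norm e = 1" for e a
  proof (cases "a \<le> 0")
    case True
    then show ?thesis by (rule dich0[OF e])
  next
    case False
    have r: "hrefl (- e) (- a) = hrefl e a" by (rule ext) (simp add: hrefl_def algebra_simps)
    have side: "hrefl e a x \<bullet> - e > - a \<longleftrightarrow> x \<bullet> e > a" for x using hrefl_inner[OF e, of a x] by auto
    have "(AE x in lborel. x \<bullet> - e > - a \<longrightarrow> u (hrefl e a x) \<le> u x) \<or> (AE x in lborel. x \<bullet> - e > - a \<longrightarrow> u x \<le> u (hrefl e a x))"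
      using dich0[of "- e" "- a"] e False unfolding r by simp
    then show ?thesis
    proof
      assume "AE x in lborel. x \<bullet> - e > - a \<longrightarrow> u (hrefl e a x) \<le> u x"
      from AE_hrefl[OF e this, of a] show ?thesis unfolding side hrefl_hrefl[OF e] by blast
    next
      assume "AE x in lborel. x \<bullet> - e > - a \<longrightarrow> u x \<le> u (hrefl e a x)"
      from AE_hrefl[OF e this, of a] show ?thesis unfolding side hrefl_hrefl[OF e] by blast
    qed
  qed
  obtain c where c: "decreasing_about c u"
    using dichotomy_imp_decreasing[OF uD(6) uD(2) uD(3) dich] by blast
  show ?thesis
    using decreasing_about_level[OF s uD(6) c gfin uD(7) uD(2) uD(3)] that by blast
qed

lemma AE_cball_ball: "AE x in lborel. x \<in> cball c r \<longrightarrow> x \<in> ball (c::'a::euclidean_space) r"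
proof -
  have "sphere c r \<in> null_sets lebesgue" using negligible_sphere[of c r] by (simp add: negligible_iff_null_sets)
  then have "sphere c r \<in> null_sets lborel" by (subst (asm) null_sets_completion_iff) (auto intro: borel_closed)
  then have "AE x in lborel. x \<notin> sphere c r" by (rule AE_not_in)
  then show ?thesis by (rule eventually_mono) auto
qed

text \<open>A vanishing seminorm makes the function a.e. constant, and the constant is 0 because the
  support is bounded.\<close>

lemma gagl_zero_imp_zero:
  fixes u :: "'a::euclidean_space \<Rightarrow> real"
  assumes um[measurable]: "u \<in> borel_measurable borel" and supp: "\<And>x. x \<notin> ball 0 R \<Longrightarrow> u x = 0" and 0: "gagl s u = 0"
  shows "AE x in lborel. u x = 0"
proof -
  let ?p = "real DIM('a) + 2 * s"
  have "AE x in lborel. (\<integral>\<^sup>+y. ennreal ((u x - u y)\<^sup>2 * (1 / norm (x - y) powr ?p)) \<partial>lborel) = 0"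
    using 0 unfolding gagl_def qform_def by (subst (asm) nn_integral_0_iff_AE) auto
  then have AE: "AE x in lborel. AE y in lborel. ennreal ((u x - u y)\<^sup>2 * (1 / norm (x - y) powr ?p)) = 0"
    by (rule eventually_mono) (rule nn_integral_0_iff_AE[THEN iffD1], measurable)
  have "\<exists>x. AE y in lborel. ennreal ((u x - u y)\<^sup>2 * (1 / norm (x - y) powr ?p)) = 0"
  proof -
    have "\<not> (AE x in (lborel :: 'a measure). False)"
      using open_AE_notin_imp_empty[of "UNIV :: 'a set"] by auto
    then show ?thesis using AE by (metis (mono_tags, lifting) eventually_mono)
  qed
  then obtain x where x: "AE y in lborel. ennreal ((u x - u y)\<^sup>2 * (1 / norm (x - y) powr ?p)) = 0" by blast
  have const: "AE y in lborel. u y = u x"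
    using x
  proof eventually_elim
    case (elim y)
    show ?case
    proof (cases "x = y")
      case False
      have "(u x - u y)\<^sup>2 * (1 / norm (x - y) powr ?p) \<le> 0" using elim by (simp only: ennreal_eq_0_iff)
      moreover have "1 / norm (x - y) powr ?p > 0" using False by simp
      ultimately have "(u x - u y)\<^sup>2 \<le> 0" by (simp only: mult_le_0_iff) (auto simp: not_less)
      then show ?thesis by simp
    qed simp
  qed
  have "u x = 0"
  proof (rule ccontr)
    assume nz: "u x \<noteq> 0"
    obtain b :: 'a where b: "b \<in> Basis" using nonempty_Basis by blast
    define p where "p = (\<bar>R\<bar> + 2) *\<^sub>R b"
    have np: "norm p = \<bar>R\<bar> + 2" using b by (simp add: p_def)
    have "AE y in lborel. y \<notin> ball p 1"
      using const
    proof eventually_elim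
      case (elim y)
      then have "y \<in> ball 0 R" using nz supp[of y] by force
      then show ?case using np norm_triangle_ineq2[of p y] by (auto simp: dist_norm)
    qed
    then have "ball p 1 = {}" by (intro open_AE_notin_imp_empty) auto
    then show False by simp
  qed
  then show ?thesis using const by simp
qed

text \<open>If \<rho> < r, the minimizer could be recentred, dilated by t = r / \<rho> > 1 and
  renormalized within the volume bound. That multiplies the Gagliardo term by t^(-2 s) < 1 and does
  not raise the Dirichlet term, so the Gagliardo term would be 0.\<close>

lemma minimizer_radius:
  fixes u :: "'a::euclidean_space \<Rightarrow> real"
  assumes s: "s > 0" and u: "u \<in> admissible m R" and fin: "mixed s u < \<infinity>"
    and min: "\<And>w::'a \<Rightarrow> real. w \<in> admissible m R \<Longrightarrow> mixed s u \<le> mixed s w"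
    and \<rho>: "\<rho> \<ge> 0" and zero: "AE x in lborel. x \<notin> cball c \<rho> \<longrightarrow> u x = 0"
    and r: "r > 0" "r \<le> R" "emeasure lborel (ball (0::'a) r) \<le> ennreal m"
  shows "r \<le> \<rho>"
proof (rule ccontr)
  assume "\<not> r \<le> \<rho>"
  then have lt: "\<rho> < r" by simp
  note uD = admissibleD[OF u]
  have um[measurable]: "u \<in> borel_measurable borel" by (rule uD)
  define u0 where "u0 x = indicator (cball c \<rho>) x * u x" for x
  have [measurable]: "u0 \<in> borel_measurable borel" unfolding u0_def by measurable
  have u0: "AE x in lborel. u x = u0 x" using zero by (rule eventually_mono) (auto simp: u0_def indicator_def)
  have \<rho>0: "\<rho> \<noteq> 0"
  proof
    assume z: "\<rho> = 0"
    have "AE x in lborel. u x = 0"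
      using u0 AE_lborel_singleton[of c] by eventually_elim (use z in \<open>auto simp: u0_def indicator_def\<close>)
    then show False using uD(7) by simp
  qed
  define t where "t = r / \<rho>"
  have t: "t > 1" using lt \<rho> \<rho>0 by (simp add: t_def)
  define u1 where "u1 x = u0 (x + c)" for x
  have [measurable]: "u1 \<in> borel_measurable borel" unfolding u1_def by measurable
  define u2 where "u2 x = u1 (x /\<^sub>R t)" for x
  have [measurable]: "u2 \<in> borel_measurable borel" unfolding u2_def by measurable
  have u2z: "u2 x = 0" if "x \<notin> cball 0 r" for x
  proof -
    have "norm (x /\<^sub>R t) = norm x / t" using t by (simp add: divide_inverse mult.commute)
    moreover have "norm x / t > \<rho>" using that t r \<rho> \<rho>0 by (simp add: t_def field_simps)
    ultimately have "x /\<^sub>R t + c \<notin> cball c \<rho>" by (simp add: dist_norm)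
    then show ?thesis by (simp add: u2_def u1_def u0_def)
  qed
  \<comment> \<open>The dilation multiplies the squared L2 norm by t^n; this factor restores norm
    1.\<close>
  define a where "a = sqrt (1 / t ^ DIM('a))"
  have a2: "a\<^sup>2 = 1 / t ^ DIM('a)" and a0: "a \<ge> 0" using t by (auto simp: a_def)
  \<comment> \<open>Recentring at the origin keeps the dilated support within radius r \<le> R.
    Cutting to the open ball removes only a null sphere and makes the volume and support conditions
    exact.\<close>
  define w where "w x = indicator (ball 0 r) x * (a * u2 x)" for x
  have [measurable]: "w \<in> borel_measurable borel" unfolding w_def by measurable
  have wAE: "AE x in lborel. w x = a * u2 x"
    using AE_cball_ball[of 0 r] by (rule eventually_mono) (use u2z in \<open>auto simp: w_def indicator_def\<close>)
  have "(\<integral>\<^sup>+x. ennreal ((w x)\<^sup>2) \<partial>lborel) = (\<integral>\<^sup>+x. ennreal (a\<^sup>2) * ennreal ((u2 x)\<^sup>2) \<partial>lborel)"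
    using wAE by (intro nn_integral_cong_AE) (auto elim!: eventually_mono simp: power_mult_distrib ennreal_mult)
  also have "\<dots> = ennreal (a\<^sup>2) * (\<integral>\<^sup>+x. ennreal ((u2 x)\<^sup>2) \<partial>lborel)" by (rule nn_integral_cmult) measurable
  also have "(\<integral>\<^sup>+x. ennreal ((u2 x)\<^sup>2) \<partial>lborel) = ennreal (t ^ DIM('a)) * (\<integral>\<^sup>+x. ennreal ((u1 x)\<^sup>2) \<partial>lborel)"
    unfolding u2_def using t by (subst nn_integral_lborel_scale[of _ t]) auto
  also have "(\<integral>\<^sup>+x. ennreal ((u1 x)\<^sup>2) \<partial>lborel) = (\<integral>\<^sup>+x. ennreal ((u0 x)\<^sup>2) \<partial>lborel)"
    unfolding u1_def by (rule nn_integral_lborel_add) measurable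
  also have "\<dots> = (\<integral>\<^sup>+x. ennreal ((u x)\<^sup>2) \<partial>lborel)"
    using u0 by (intro nn_integral_cong_AE) (auto elim!: eventually_mono)
  finally have w1: "(\<integral>\<^sup>+x. ennreal ((w x)\<^sup>2) \<partial>lborel) = 1"
    using t by (simp add: uD(5) a2 ennreal_mult[symmetric])
  have "emeasure lborel {x. w x \<noteq> 0} \<le> emeasure lborel (ball (0::'a) r)"
    by (intro emeasure_mono) (auto simp: w_def indicator_def split: if_splits)
  also have "\<dots> \<le> ennreal m" by (rule r)
  finally have wm: "emeasure lborel {x. w x \<noteq> 0} \<le> ennreal m" .
  have "w x \<ge> 0" for x using a0 uD(2) by (simp add: w_def u2_def u1_def u0_def)
  moreover have "w x = 0" if "x \<notin> ball 0 R" for x using that r by (auto simp: w_def indicator_def)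
  ultimately have "w \<in> admissible m R" unfolding admissible_def using w1 wm by simp
  then have "mixed s u \<le> mixed s w" by (rule min)
  also have "mixed s w = ennreal (a\<^sup>2) * mixed s u2"
    unfolding mixed_cong_AE[OF wAE] by (rule mixed_cmult) measurable
  also have "mixed s u2 \<le> ennreal (t ^ DIM('a)) * dirichlet u + ennreal (t ^ DIM('a) * t powr (- 2 * s)) * gagl s u"
  proof -
    have locq1: "locq \<epsilon> u1 = locq \<epsilon> u" for \<epsilon>
      unfolding locq_def u1_def by (simp add: qform_translate qform_cong_AE[OF u0])
    have g1: "gagl s u1 = gagl s u"
      unfolding gagl_def u1_def by (simp add: qform_translate qform_cong_AE[OF u0])
    have "dirichlet u2 \<le> ennreal (t ^ DIM('a)) * dirichlet u"
      unfolding dirichlet_def[of u2]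
    proof (rule SUP_least)
      fix \<epsilon> :: real assume "\<epsilon> \<in> {0<..}"
      then have \<epsilon>: "\<epsilon> > 0" by simp
      have "locq \<epsilon> u2 = ennreal (t ^ DIM('a) / t\<^sup>2) * locq (\<epsilon> / t) u"
        unfolding u2_def locq1[symmetric] by (rule locq_scale) (use t \<epsilon> in auto)
      also have "\<dots> \<le> ennreal (t ^ DIM('a)) * dirichlet u"
      proof (rule mult_mono)
        \<comment> \<open>The gain t^-2 of the local term is given up; the gain in the Gagliardo
          term alone yields the contradiction.\<close>
        have "t ^ DIM('a) / t\<^sup>2 \<le> t ^ DIM('a) / 1" using t by (intro divide_left_mono) (auto simp: one_le_power)
        then show "ennreal (t ^ DIM('a) / t\<^sup>2) \<le> ennreal (t ^ DIM('a))" by (intro ennreal_leI) simp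
        show "locq (\<epsilon> / t) u \<le> dirichlet u" using \<epsilon> t by (intro locq_le_dirichlet) simp
      qed auto
      finally show "locq \<epsilon> u2 \<le> ennreal (t ^ DIM('a)) * dirichlet u" .
    qed
    moreover have "gagl s u2 = ennreal (t ^ DIM('a) * t powr (- 2 * s)) * gagl s u"
      unfolding u2_def g1[symmetric] by (rule gagl_scale) (use t in auto)
    ultimately show ?thesis unfolding mixed_def by (intro add_mono) auto
  qed
  finally have "mixed s u \<le> ennreal (a\<^sup>2) * (ennreal (t ^ DIM('a)) * dirichlet u + ennreal (t ^ DIM('a) * t powr (- 2 * s)) * gagl s u)"
    by (simp add: mult_left_mono)
  also have "\<dots> = dirichlet u + ennreal (t powr (- 2 * s)) * gagl s u"
  proof -
    have 1: "ennreal (a\<^sup>2) * ennreal (t ^ DIM('a)) = 1" using t by (simp add: a2 ennreal_mult[symmetric])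
    have 2: "ennreal (t ^ DIM('a) * t powr (- 2 * s)) = ennreal (t ^ DIM('a)) * ennreal (t powr (- 2 * s))"
      using t by (intro ennreal_mult) auto
    show ?thesis unfolding 2 distrib_left mult.assoc[symmetric] 1 by simp
  qed
  finally have "dirichlet u + gagl s u \<le> dirichlet u + ennreal (t powr (- 2 * s)) * gagl s u" by (simp add: mixed_def)
  moreover have dfin: "dirichlet u \<noteq> \<infinity>" and gfin: "gagl s u \<noteq> \<infinity>" using fin by (auto simp: mixed_def)
  ultimately have le: "gagl s u \<le> ennreal (t powr (- 2 * s)) * gagl s u"
    by (auto simp: ennreal_add_left_cancel_le)
  obtain g where g: "gagl s u = ennreal g" "g \<ge> 0" using gfin by (cases "gagl s u") auto
  have "t powr (- 2 * s) < 1" using t s powr_less_mono[of "- 2 * s" 0 t] by simp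
  have "g \<le> t powr (- 2 * s) * g" using le g by (simp add: ennreal_mult[symmetric])
  then have "g = 0" using g(2) \<open>t powr (- 2 * s) < 1\<close> by (metis less_eq_real_def mult_le_cancel_right1 mult.commute not_le)
  then have "AE x in lborel. u x = 0" using g(1) by (intro gagl_zero_imp_zero[where s=s and R=R, OF um uD(3)]) auto
  then show False using uD(7) by simp
qed

section \<open>Borel representatives for the notions of the definition\<close>

lemma sigma_finite_lebesgue: "sigma_finite_measure (lebesgue :: 'a::euclidean_space measure)"
proof
  obtain A :: "'a set set" where A: "countable A" "A \<subseteq> sets lborel" "\<Union>A = space lborel" "\<forall>a\<in>A. emeasure lborel a \<noteq> \<infinity>"
    using lborel.sigma_finite_countable by blast
  show "\<exists>A::'a set set. countable A \<and> A \<subseteq> sets lebesgue \<and> \<Union>A = space lebesgue \<and> (\<forall>a\<in>A. emeasure lebesgue a \<noteq> \<infinity>)"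
    using A by (intro exI[of _ A]) (auto simp: subset_iff)
qed

text \<open>The definition integrates over a product of two completed measures. Writing this as an
  iterated integral lets the completion be dropped in each variable separately, after which a.e.
  equal representatives may be substituted.\<close>

lemma energy_borel:
  fixes u u' :: "'a::euclidean_space \<Rightarrow> real"
  assumes um[measurable]: "u \<in> borel_measurable lebesgue" and u: "AE x in lborel. u x = u' x" and G: "AE x in lborel. G x = G' x"
  shows "energy U s u G = (\<integral>\<^sup>+x. indicator U x * ennreal ((norm (G' x))\<^sup>2) \<partial>lborel) + gagl s u'"
proof -
  let ?p = "real DIM('a) + 2 * s"
  interpret leb: sigma_finite_measure "lebesgue :: 'a measure" by (rule sigma_finite_lebesgue)
  have id[measurable]: "(\<lambda>x. x) \<in> lebesgue \<rightarrow>\<^sub>M (borel :: 'a measure)"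
    by (rule measurable_completion) simp
  have f[measurable]: "(\<lambda>z. fst z) \<in> (lebesgue \<Otimes>\<^sub>M lebesgue) \<rightarrow>\<^sub>M (borel :: 'a measure)"
    using measurable_compose[OF measurable_fst id] by simp
  have g[measurable]: "(\<lambda>z. snd z) \<in> (lebesgue \<Otimes>\<^sub>M lebesgue) \<rightarrow>\<^sub>M (borel :: 'a measure)"
    using measurable_compose[OF measurable_snd id] by simp
  have uf[measurable]: "(\<lambda>z. u (fst z)) \<in> borel_measurable (lebesgue \<Otimes>\<^sub>M (lebesgue :: 'a measure))"
    by (rule measurable_compose[OF measurable_fst um])
  have us[measurable]: "(\<lambda>z. u (snd z)) \<in> borel_measurable ((lebesgue :: 'a measure) \<Otimes>\<^sub>M lebesgue)"
    by (rule measurable_compose[OF measurable_snd um])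
  have "(\<integral>\<^sup>+z. ennreal ((u (fst z) - u (snd z))\<^sup>2 / norm (fst z - snd z) powr ?p) \<partial>(lebesgue \<Otimes>\<^sub>M lebesgue))
     = (\<integral>\<^sup>+x. \<integral>\<^sup>+y. ennreal ((u (fst (x, y)) - u (snd (x, y)))\<^sup>2 / norm (fst (x, y) - snd (x, y)) powr ?p) \<partial>lebesgue \<partial>lebesgue)"
    by (rule leb.nn_integral_fst[symmetric]) measurable
  also have "\<dots> = qform (\<lambda>r. 1 / r powr ?p) u"
    by (simp add: qform_def nn_integral_completion)
  also have "\<dots> = gagl s u'" unfolding gagl_def by (rule qform_cong_AE[OF u])
  finally have 1: "(\<integral>\<^sup>+z. ennreal ((u (fst z) - u (snd z))\<^sup>2 / norm (fst z - snd z) powr ?p) \<partial>(lebesgue \<Otimes>\<^sub>M lebesgue)) = gagl s u'" .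
  have 2: "(\<integral>\<^sup>+x. indicator U x * ennreal ((norm (G x))\<^sup>2) \<partial>lebesgue) = (\<integral>\<^sup>+x. indicator U x * ennreal ((norm (G' x))\<^sup>2) \<partial>lborel)"
    unfolding nn_integral_completion using G by (intro nn_integral_cong_AE) (auto elim!: eventually_mono)
  show ?thesis unfolding energy_def 1 2 ..
qed

lemma borel_version_vector:
  fixes G :: "'a::euclidean_space \<Rightarrow> 'b::euclidean_space"
  assumes [measurable]: "G \<in> borel_measurable lebesgue"
  obtains G' where "G' \<in> borel_measurable borel" "AE x in lborel. G x = G' x"
proof -
  have "\<forall>i. \<exists>g\<in>borel_measurable lborel. AE x in lborel. G x \<bullet> i = g x"
    by (intro allI completion_ex_borel_measurable_real) measurable
  then obtain g where g[measurable]: "\<And>i. g i \<in> borel_measurable lborel" and ge: "\<And>i. AE x in lborel. G x \<bullet> i = g i x" by metis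
  have [measurable]: "g i \<in> borel_measurable borel" for i using g by simp
  define G' where "G' x = (\<Sum>i\<in>Basis. g i x *\<^sub>R i)" for x
  have "AE x in lborel. \<forall>i\<in>Basis. G x \<bullet> i = g i x" using ge by (intro AE_finite_allI) auto
  then have "AE x in lborel. G x = G' x"
  proof eventually_elim
    case (elim x)
    then have "G' x = (\<Sum>i\<in>Basis. (G x \<bullet> i) *\<^sub>R i)" unfolding G'_def by (intro sum.cong) auto
    then show ?case by (simp add: euclidean_representation)
  qed
  moreover have "G' \<in> borel_measurable borel" unfolding G'_def by measurable
  ultimately show ?thesis using that by blast
qed

lemma weak_gradient_cong_AE:
  fixes u u' :: "'a::euclidean_space \<Rightarrow> real"
  assumes w: "weak_gradient u G" and [measurable]: "u \<in> borel_measurable lebesgue" "G \<in> borel_measurable lebesgue"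
    and m: "u' \<in> borel_measurable borel" "G' \<in> borel_measurable borel"
    and u: "AE x in lborel. u x = u' x" and G: "AE x in lborel. G x = G' x"
  shows "weak_gradient u' G'"
  unfolding weak_gradient_def
proof (intro allI impI ballI)
  fix \<phi> :: "'a \<Rightarrow> real" and \<phi>' and i :: 'a assume \<phi>: "Cc1_test \<phi> \<phi>'" and i: "i \<in> Basis"
  interpret p: C1_fun \<phi> \<phi>' using \<phi> by unfold_locales (auto simp: Cc1_test_def)
  have leb: "f \<in> borel_measurable lebesgue" if "f \<in> borel_measurable borel" for f :: "'a \<Rightarrow> 'b::topological_space"
    using that by (intro measurable_completion) simp
  have [measurable]: "\<phi> \<in> borel_measurable lebesgue" "\<phi>' \<in> borel_measurable lebesgue"
    "u' \<in> borel_measurable lebesgue" "G' \<in> borel_measurable lebesgue"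
    using leb p.f_measurable p.g_measurable m by blast+
  have "(\<integral>x. u' x * (\<phi>' x \<bullet> i) \<partial>lebesgue) = (\<integral>x. u x * (\<phi>' x \<bullet> i) \<partial>lebesgue)"
    using AE_completion[OF u] by (intro integral_cong_AE) (auto elim!: eventually_mono)
  moreover have "(\<integral>x. (G' x \<bullet> i) * \<phi> x \<partial>lebesgue) = (\<integral>x. (G x \<bullet> i) * \<phi> x \<partial>lebesgue)"
    using AE_completion[OF G] by (intro integral_cong_AE) (auto elim!: eventually_mono)
  ultimately show "(\<integral>x. u' x * (\<phi>' x \<bullet> i) \<partial>lebesgue) = - (\<integral>x. (G' x \<bullet> i) * \<phi> x \<partial>lebesgue)"
    using w \<phi> i unfolding weak_gradient_def by auto
qed

section \<open>Comparison of the eigenvalues\<close>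

text \<open>Turns a test pair for the eigenvalue of \<open>\<Omega>\<close> into an admissible
  function of no larger energy: a Borel version cut off outside \<open>\<Omega>\<close>, its
  absolute value, and normalization. The null boundary is what replaces the closure in the gradient
  bound by \<open>\<Omega>\<close>.\<close>

lemma domain_competitor:
  fixes u :: "'a::euclidean_space \<Rightarrow> real"
  assumes s: "s > 0" and op: "open \<Omega>" and ne: "\<Omega> \<noteq> {}" and C: "C1_boundary \<Omega>" and \<Omega>: "\<Omega> \<subseteq> ball 0 R"
    and m: "emeasure lborel \<Omega> \<le> ennreal m"
    and XU: "XU_pair \<Omega> u G" and nz: "\<not> (AE x in lebesgue. u x = 0)"
  obtains w where "w \<in> admissible m R" "\<And>x. x \<notin> \<Omega> \<Longrightarrow> w x = 0"
    "mixed s w \<le> energy \<Omega> s u G / ennreal (\<integral>x. indicator \<Omega> x * (u x)\<^sup>2 \<partial>lebesgue)"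
proof -
  have um[measurable]: "u \<in> borel_measurable lebesgue" and ui: "integrable lebesgue (\<lambda>x. (u x)\<^sup>2)"
    and Gm[measurable]: "G \<in> borel_measurable lebesgue" and Gi: "integrable lebesgue (\<lambda>x. (norm (G x))\<^sup>2)"
    and wg: "weak_gradient u G" and u\<Omega>: "AE x in lborel. x \<notin> \<Omega> \<longrightarrow> u x = 0"
    using XU by (auto simp: XU_pair_def H1_pair_def AE_completion_iff)
  have \<Omega>m[measurable]: "\<Omega> \<in> sets borel" using op by (rule borel_open)
  obtain u' where u'm: "u' \<in> borel_measurable lborel" and u': "AE x in lborel. u x = u' x"
    using completion_ex_borel_measurable_real[OF um] by blast
  obtain G' where G'm[measurable]: "G' \<in> borel_measurable borel" and G': "AE x in lborel. G x = G' x"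
    using borel_version_vector[OF Gm] by blast
  define u0 where "u0 x = indicator \<Omega> x * u' x" for x
  have u0m[measurable]: "u0 \<in> borel_measurable borel" unfolding u0_def using u'm by simp
  have u0: "AE x in lborel. u x = u0 x"
    using u' u\<Omega> by eventually_elim (auto simp: u0_def indicator_def)
  have u0z: "u0 x = 0" if "x \<notin> \<Omega>" for x using that by (simp add: u0_def)
  have wg0: "weak_gradient u0 G'" by (rule weak_gradient_cong_AE[OF wg um Gm u0m G'm u0 G'])
  have sq: "(\<integral>\<^sup>+x. ennreal ((u0 x)\<^sup>2) \<partial>lborel) = (\<integral>\<^sup>+x. ennreal ((u x)\<^sup>2) \<partial>lebesgue)"
    unfolding nn_integral_completion using u0 by (intro nn_integral_cong_AE) (auto elim!: eventually_mono)
  also have "\<dots> < \<infinity>" using ui by (simp add: nn_integral_eq_integral)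
  finally have fin: "(\<integral>\<^sup>+x. ennreal ((u0 x)\<^sup>2) \<partial>lborel) < \<infinity>" .
  have "(\<integral>\<^sup>+x. ennreal ((norm (G' x))\<^sup>2) \<partial>lborel) = (\<integral>\<^sup>+x. ennreal ((norm (G x))\<^sup>2) \<partial>lebesgue)"
    unfolding nn_integral_completion using G' by (intro nn_integral_cong_AE) (auto elim!: eventually_mono)
  also have "\<dots> < \<infinity>" using Gi by (simp add: nn_integral_eq_integral)
  finally have G2: "(\<integral>\<^sup>+x. ennreal ((norm (G' x))\<^sup>2) \<partial>lborel) < \<infinity>" .
  define J where "J = (\<integral>x. indicator \<Omega> x * (u x)\<^sup>2 \<partial>lebesgue)"
  have J: "(\<integral>\<^sup>+x. ennreal ((u0 x)\<^sup>2) \<partial>lborel) = ennreal J"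
  proof -
    have "J = (\<integral>x. (u x)\<^sup>2 \<partial>lebesgue)"
      unfolding J_def
    proof (rule integral_cong_AE)
      have [measurable]: "\<Omega> \<in> sets lebesgue" using \<Omega>m by simp
      show "(\<lambda>x. indicator \<Omega> x * (u x)\<^sup>2) \<in> borel_measurable lebesgue" by measurable
      show "AE x in lebesgue. indicator \<Omega> x * (u x)\<^sup>2 = (u x)\<^sup>2"
        using AE_completion[OF u\<Omega>] by (rule eventually_mono) (auto simp: indicator_def)
    qed measurable
    then show ?thesis unfolding sq using ui by (simp add: nn_integral_eq_integral)
  qed
  have J0: "J > 0"
  proof (rule ccontr)
    assume "\<not> J > 0"
    then have "(\<integral>\<^sup>+x. ennreal ((u0 x)\<^sup>2) \<partial>lborel) = 0" using J by (simp add: ennreal_neg)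
    then have "AE x in lborel. ennreal ((u0 x)\<^sup>2) = 0" by (subst (asm) nn_integral_0_iff_AE) auto
    then have "AE x in lborel. u x = 0"
      using u0 by eventually_elim (auto simp: ennreal_eq_0_iff)
    then show False using nz by (simp add: AE_completion_iff)
  qed
  define w where "w x = (1 / sqrt J) * \<bar>u0 x\<bar>" for x
  have [measurable]: "w \<in> borel_measurable borel" unfolding w_def by measurable
  have c2: "(1 / sqrt J)\<^sup>2 = 1 / J" using J0 by (simp add: power_divide)
  have "(\<integral>\<^sup>+x. ennreal ((w x)\<^sup>2) \<partial>lborel) = (\<integral>\<^sup>+x. ennreal (1 / J) * ennreal ((u0 x)\<^sup>2) \<partial>lborel)"
    unfolding w_def power_mult_distrib c2 using J0 by (intro nn_integral_cong) (simp add: ennreal_mult[symmetric])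
  also have "\<dots> = ennreal (1 / J) * ennreal J"
    unfolding J[symmetric] by (rule nn_integral_cmult) measurable
  finally have w1: "(\<integral>\<^sup>+x. ennreal ((w x)\<^sup>2) \<partial>lborel) = 1" using J0 by (simp add: ennreal_mult[symmetric])
  have wz: "w x = 0" if "x \<notin> \<Omega>" for x using u0z[OF that] by (simp add: w_def)
  have "emeasure lborel {x. w x \<noteq> 0} \<le> emeasure lborel \<Omega>" using wz by (intro emeasure_mono) auto
  also note m
  finally have wm: "emeasure lborel {x. w x \<noteq> 0} \<le> ennreal m" .
  have "w \<in> admissible m R"
  proof -
    have "w x = 0" if "x \<notin> ball 0 R" for x using that \<Omega> by (intro wz) blast
    moreover have "w x \<ge> 0" for x using J0 by (simp add: w_def)
    ultimately show ?thesis unfolding admissible_def using w1 wm by simp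
  qed
  moreover have "mixed s w \<le> energy \<Omega> s u G / ennreal J"
  proof -
    have "mixed s w = ennreal (1 / J) * mixed s (\<lambda>x. \<bar>u0 x\<bar>)"
      unfolding w_def c2[symmetric] by (rule mixed_cmult) measurable
    also have "\<dots> \<le> ennreal (1 / J) * energy \<Omega> s u G"
    proof (rule mult_left_mono)
      have E: "energy \<Omega> s u G = (\<integral>\<^sup>+x. indicator \<Omega> x * ennreal ((norm (G' x))\<^sup>2) \<partial>lborel) + gagl s u0"
        by (rule energy_borel[OF um u0 G'])
      have "mixed s u0 \<le> energy \<Omega> s u G"
      \<comment> \<open>The gradient bound presupposes a finite seminorm; otherwise the energy is
        infinite and the inequality is trivial.\<close>
      proof (cases "gagl s u0 < \<infinity>")
        case True
        have "dirichlet u0 \<le> (\<integral>\<^sup>+x. indicator (closure \<Omega>) x * ennreal ((norm (G' x))\<^sup>2) \<partial>lborel)"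
          by (rule dirichlet_le_weak_gradient[OF s u0m G'm ne \<Omega> u0z fin G2 wg0 True])
        also have "\<dots> = (\<integral>\<^sup>+x. indicator \<Omega> x * ennreal ((norm (G' x))\<^sup>2) \<partial>lborel)"
        proof (rule nn_integral_cong_AE)
          have "bounded \<Omega>" using \<Omega> bounded_subset by blast
          then have "AE x in lborel. x \<notin> frontier \<Omega>" by (intro AE_not_in C1_boundary_frontier_null[OF C])
          then show "AE x in lborel. indicator (closure \<Omega>) x * ennreal ((norm (G' x))\<^sup>2) = indicator \<Omega> x * ennreal ((norm (G' x))\<^sup>2)"
          proof eventually_elim
            case (elim x)
            then have "x \<in> closure \<Omega> \<longleftrightarrow> x \<in> \<Omega>"
              using op closure_subset by (auto simp: frontier_def interior_open)
            then show ?case by (simp add: indicator_def)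
          qed
        qed
        finally show ?thesis unfolding E mixed_def by (rule add_right_mono)
      next
        case False
        then show ?thesis unfolding E by (simp add: less_top[symmetric])
      qed
      with mixed_abs_le[of s u0] show "mixed s (\<lambda>x. \<bar>u0 x\<bar>) \<le> energy \<Omega> s u G" by (rule order_trans)
    qed simp
    also have "ennreal (1 / J) * energy \<Omega> s u G = energy \<Omega> s u G / ennreal J"
      using J0 by (simp add: divide_ennreal_def inverse_ennreal mult.commute inverse_eq_divide)
    finally show ?thesis .
  qed
  ultimately show ?thesis using that[of w] wz unfolding J_def by blast
qed

text \<open>The weak gradient built from the finite form energy makes \<open>v\<close> a valid test
  function. It is controlled on the whole space, so restricting its integral to the ball only lowers
  the energy.\<close>

lemma ball_eigenvalue_le:
  fixes v :: "'a::euclidean_space \<Rightarrow> real"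
  assumes s: "s > 0" and vm[measurable]: "v \<in> borel_measurable borel" and z: "\<And>x. x \<notin> ball c r \<Longrightarrow> v x = 0"
    and v1: "(\<integral>\<^sup>+x. ennreal ((v x)\<^sup>2) \<partial>lborel) = 1" and fin: "mixed s v < \<infinity>"
  shows "lambda_L (ball c r) s \<le> mixed s v"
proof -
  obtain R where R: "ball c r \<subseteq> ball 0 R" using bounded_subset_ballD[OF bounded_ball] by blast
  obtain G where Gm[measurable]: "G \<in> borel_measurable borel"
    and G2: "(\<integral>\<^sup>+x. ennreal ((norm (G x))\<^sup>2) \<partial>lborel) \<le> dirichlet v" and wg: "weak_gradient v G"
  proof (rule weak_gradient_exists[OF s vm, of R])
    show "v x = 0" if "x \<notin> ball 0 R" for x using that R by (intro z) auto
  qed (use v1 fin in \<open>auto simp: mixed_def\<close>)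
  have leb: "f \<in> borel_measurable lebesgue" if "f \<in> borel_measurable borel" for f :: "'a \<Rightarrow> 'b::topological_space"
    using that by (intro measurable_completion) simp
  have vi: "integrable lborel (\<lambda>x. (v x)\<^sup>2)" using v1 by (intro integrable_sq_nn_integral) auto
  have "(\<integral>\<^sup>+x. ennreal ((norm (G x))\<^sup>2) \<partial>lborel) < \<infinity>"
    using G2 fin by (auto simp: mixed_def intro: order_le_less_trans)
  then have Gi: "integrable lborel (\<lambda>x. (norm (G x))\<^sup>2)" by (intro integrable_sq_nn_integral) auto
  have "XU_pair (ball c r) v G"
    unfolding XU_pair_def H1_pair_def
    using leb[OF vm] leb[OF Gm] vi Gi wg z by (auto simp: integrable_completion)
  moreover have "\<not> (AE x in lebesgue. v x = 0)"
  proof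
    assume "AE x in lebesgue. v x = 0"
    then have "AE x in lborel. v x = 0" by (simp add: AE_completion_iff)
    then have "(\<integral>\<^sup>+x. ennreal ((v x)\<^sup>2) \<partial>lborel) = (\<integral>\<^sup>+x. 0 \<partial>(lborel :: 'a measure))"
      by (intro nn_integral_cong_AE) (auto elim!: eventually_mono)
    then show False using v1 by simp
  qed
  ultimately have "lambda_L (ball c r) s \<le> energy (ball c r) s v G / ennreal (\<integral>x. indicator (ball c r) x * (v x)\<^sup>2 \<partial>lebesgue)"
    unfolding lambda_L_def by (intro INF_lower2[of "(v, G)"]) auto
  also have "(\<integral>x. indicator (ball c r) x * (v x)\<^sup>2 \<partial>lebesgue) = 1"
  proof -
    have "(\<lambda>x. indicator (ball c r) x * (v x)\<^sup>2) = (\<lambda>x. (v x)\<^sup>2)" using z by (intro ext) (auto simp: indicator_def)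
    then have "(\<integral>x. indicator (ball c r) x * (v x)\<^sup>2 \<partial>lebesgue) = (\<integral>x. (v x)\<^sup>2 \<partial>lborel)"
      by (simp add: integral_completion)
    also have "\<dots> = 1" using v1 vi by (simp add: nn_integral_eq_integral)
    finally show ?thesis .
  qed
  also have "energy (ball c r) s v G / ennreal 1 = energy (ball c r) s v G"
    using inverse_ennreal[of 1] by (simp add: divide_ennreal_def)
  also have "\<dots> = (\<integral>\<^sup>+x. indicator (ball c r) x * ennreal ((norm (G x))\<^sup>2) \<partial>lborel) + gagl s v"
    by (rule energy_borel[OF leb[OF vm]]) auto
  also have "\<dots> \<le> (\<integral>\<^sup>+x. ennreal ((norm (G x))\<^sup>2) \<partial>lborel) + gagl s v"
    by (intro add_right_mono nn_integral_mono) (auto simp: indicator_def)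
  also have "\<dots> \<le> mixed s v" unfolding mixed_def using G2 by (rule add_right_mono)
  finally show ?thesis .
qed

text \<open>A normalized tent shows that the constrained infimum is finite, so that it is a real
  number \<open>L\<close> that minimizing sequences can approach.\<close>

lemma admissible_finite_energy:
  assumes s: "0 < s" "s < 1" and r: "r > 0" "r \<le> R" and m: "emeasure lborel (ball (0::'a::euclidean_space) r) \<le> ennreal m"
  obtains w :: "'a::euclidean_space \<Rightarrow> real" where "w \<in> admissible m R" "mixed s w < \<infinity>"
proof -
  let ?u = "tent r :: 'a \<Rightarrow> real"
  have um[measurable]: "?u \<in> borel_measurable borel" unfolding tent_def by measurable
  have z: "?u x = 0" if "norm x \<ge> r" for x using that by (simp add: tent_def)
  have "(\<integral>\<^sup>+x. ennreal ((?u x)\<^sup>2) \<partial>lborel) < \<infinity>"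
    by (rule nn_integral_sq_finite[OF _ z]) (auto simp: tent_def intro!: continuous_intros)
  then obtain J where J: "(\<integral>\<^sup>+x. ennreal ((?u x)\<^sup>2) \<partial>lborel) = ennreal J" "J \<ge> 0"
    by (cases "\<integral>\<^sup>+x. ennreal ((?u x)\<^sup>2) \<partial>lborel") auto
  have "J \<noteq> 0"
  proof
    assume "J = 0"
    then have "AE x in lborel. ennreal ((?u x)\<^sup>2) = 0" using J by (subst nn_integral_0_iff_AE[symmetric]) auto
    then have "AE x in lborel. x \<notin> ball (0::'a) r" by (rule eventually_mono) (auto simp: tent_def ennreal_eq_0_iff)
    then have "ball (0::'a) r = {}" by (intro open_AE_notin_imp_empty) auto
    then show False using r by simp
  qed
  then have J0: "J > 0" using J by simp
  define w where "w x = (1 / sqrt J) * ?u x" for x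
  have [measurable]: "w \<in> borel_measurable borel" unfolding w_def by measurable
  have c2: "(1 / sqrt J)\<^sup>2 = 1 / J" using J0 by (simp add: power_divide)
  have "(\<integral>\<^sup>+x. ennreal ((w x)\<^sup>2) \<partial>lborel) = (\<integral>\<^sup>+x. ennreal (1 / J) * ennreal ((?u x)\<^sup>2) \<partial>lborel)"
    unfolding w_def power_mult_distrib c2 using J0 by (intro nn_integral_cong) (simp add: ennreal_mult[symmetric])
  also have "\<dots> = ennreal (1 / J) * ennreal J"
    unfolding J(1)[symmetric] by (rule nn_integral_cmult) measurable
  finally have w1: "(\<integral>\<^sup>+x. ennreal ((w x)\<^sup>2) \<partial>lborel) = 1" using J0 by (simp add: ennreal_mult[symmetric])
  have "{x. w x \<noteq> 0} \<subseteq> ball 0 r"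
  proof (rule subsetI, rule ccontr)
    fix x assume "x \<in> {x. w x \<noteq> 0}" "x \<notin> ball 0 r"
    then show False using z[of x] by (simp add: w_def)
  qed
  then have "emeasure lborel {x. w x \<noteq> 0} \<le> emeasure lborel (ball (0::'a) r)" by (intro emeasure_mono) auto
  also note m
  finally have wm: "emeasure lborel {x. w x \<noteq> 0} \<le> ennreal m" .
  have "w x = 0" if "x \<notin> ball 0 R" for x using that r z[of x] by (simp add: w_def)
  moreover have "w x \<ge> 0" for x using J0 by (simp add: w_def tent_def)
  ultimately have "w \<in> admissible m R" unfolding admissible_def using w1 wm by auto
  moreover have "mixed s w < \<infinity>"
    unfolding w_def mixed_cmult[OF um] using mixed_tent_finite[OF s r(1), where 'a='a] by (simp add: ennreal_mult_less_top)
  ultimately show ?thesis using that by blast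
qed

lemma INF_approx_seq:
  fixes f :: "'b \<Rightarrow> ennreal"
  assumes "(INF x\<in>A. f x) = ennreal L" "L \<ge> 0"
  shows "\<exists>x. \<forall>n. x n \<in> A \<and> f (x n) \<le> ennreal (L + (1/2)^n)"
proof -
  have "\<exists>x. x \<in> A \<and> f x \<le> ennreal (L + (1/2)^n)" for n
  proof -
    have "(INF x\<in>A. f x) < ennreal (L + (1/2)^n)" unfolding assms(1) using assms(2) by (intro ennreal_lessI) (auto intro: add_nonneg_pos)
    then show ?thesis by (auto simp: INF_less_iff intro: less_imp_le)
  qed
  then show ?thesis by metis
qed

theorem theorem1p1:
  fixes \<Omega> :: "'a::euclidean_space set" and s :: real
  assumes "0 < s" "s < 1"
    and "open \<Omega>" "bounded \<Omega>" "\<Omega> \<noteq> {}" "C1_boundary \<Omega>"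
  shows "\<forall>(c::'a) r. measure lebesgue (ball c r) = measure lebesgue \<Omega> \<longrightarrow>
           lambda_L \<Omega> s \<ge> lambda_L (ball c r) s \<and>
           (lambda_L \<Omega> s = lambda_L (ball c r) s \<longrightarrow> (\<exists>c' r'. \<Omega> = ball c' r'))"
proof (intro allI impI)
  fix c :: 'a and r
  assume eq0: "measure lebesgue (ball c r) = measure lebesgue \<Omega>"
  have \<Omega>m[measurable]: "\<Omega> \<in> sets borel" using assms(3) by (rule borel_open)
  define m where "m = measure lborel \<Omega>"
  have "emeasure lborel \<Omega> < \<infinity>" using emeasure_bounded_finite[OF assms(4)] .
  then have m: "emeasure lborel \<Omega> = ennreal m" by (simp add: m_def emeasure_eq_ennreal_measure)
  have "emeasure lborel \<Omega> \<noteq> 0"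
  proof
    assume "emeasure lborel \<Omega> = 0"
    then have "AE x in lborel. x \<notin> \<Omega>" by (intro AE_not_in) (auto simp: null_sets_def)
    then show False using open_AE_notin_imp_empty assms(3,5) by blast
  qed
  then have m0: "m > 0" using m by (auto simp: ennreal_neg not_le[symmetric])
  have ball_m: "measure lborel (ball c r) = m" using eq0 by (simp add: m_def)
  \<comment> \<open>A nonpositive radius gives the empty ball, which cannot have the positive volume
    \<open>m\<close>.\<close>
  have r: "r > 0"
  proof (rule ccontr)
    assume "\<not> r > 0"
    then have e: "ball c r = {}" by simp
    show False using ball_m m0 unfolding e by simp
  qed
  have ball_eq: "emeasure lborel (ball x r) = ennreal m" for x :: 'a
    using r emeasure_lborel_ball_finite[of c r] ball_m
    by (simp add: emeasure_ball_scale content_ball_conv_unit_ball[of r c])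
  have ball_le: "\<rho> \<le> r" if "emeasure lborel (ball (x::'a) \<rho>) \<le> ennreal m" "\<rho> \<ge> 0" for x \<rho>
  proof (rule ccontr)
    assume "\<not> \<rho> \<le> r"
    define V where "V = measure lborel (ball (0::'a) 1)"
    have V: "V > 0" using content_ball_pos[of 1 "0::'a"] by (simp add: V_def)
    have "ennreal (\<rho> ^ DIM('a) * V) \<le> ennreal (r ^ DIM('a) * V)"
      using that r ball_eq[of x] by (simp add: emeasure_ball_scale V_def)
    then have "\<rho> ^ DIM('a) * V \<le> r ^ DIM('a) * V"
      by (subst (asm) ennreal_le_iff) (use V r in auto)
    then have "\<rho> ^ DIM('a) \<le> r ^ DIM('a)" using V by simp
    then show False using \<open>\<not> \<rho> \<le> r\<close> r power_strict_mono[of r \<rho> "DIM('a)"] by simp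
  qed
  obtain R0 where R0: "\<Omega> \<subseteq> ball 0 R0" using bounded_subset_ballD[OF assms(4)] by blast
  \<comment> \<open>Large enough for \<open>\<Omega>\<close>, so that its competitors are
    admissible, and for a centred ball of radius \<open>r\<close>, needed by the tent function and
    by the dilation in \<open>minimizer_radius\<close>.\<close>
  define R where "R = max R0 r"
  have \<Omega>R: "\<Omega> \<subseteq> ball 0 R" and rR: "r \<le> R" using R0 by (auto simp: R_def)
  define \<Lambda> where "\<Lambda> = (INF u\<in>(admissible m R :: ('a \<Rightarrow> real) set). mixed s u)"
  obtain w0 :: "'a \<Rightarrow> real" where w0: "w0 \<in> admissible m R" "mixed s w0 < \<infinity>"
    using admissible_finite_energy[OF assms(1,2) r rR eq_refl[OF ball_eq[of 0]]] by blast
  have "\<Lambda> \<le> mixed s w0" unfolding \<Lambda>_def using w0(1) by (rule INF_lower)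
  then have "\<Lambda> < \<infinity>" using w0(2) by (rule order_le_less_trans)
  then obtain L where L: "\<Lambda> = ennreal L" "L \<ge> 0" by (cases \<Lambda>) auto
  have lower: "ennreal L \<le> mixed s u" if "u \<in> admissible m R" for u :: "'a \<Rightarrow> real"
    unfolding L(1)[symmetric] \<Lambda>_def using that by (rule INF_lower)
  obtain U :: "nat \<Rightarrow> 'a \<Rightarrow> real" where U: "\<And>n. U n \<in> admissible m R" "\<And>n. mixed s (U n) \<le> ennreal (L + (1/2)^n)"
    using INF_approx_seq[OF L(1)[unfolded \<Lambda>_def] L(2)] by blast
  obtain u :: "'a \<Rightarrow> real" where u: "u \<in> admissible m R" and uL: "mixed s u \<le> ennreal L"
    by (rule admissible_limit[OF assms(1) U(1) L(2) U(2), of UNIV]) auto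
  note uD = admissibleD[OF u]
  have um[measurable]: "u \<in> borel_measurable borel" by (rule uD)
  have ball_le_L: "lambda_L (ball c r) s \<le> ennreal L"
  proof -
    obtain p \<rho> where \<rho>: "\<rho> \<ge> 0" "AE x in lborel. x \<in> ball p \<rho> \<longrightarrow> u x > 0" "AE x in lborel. x \<notin> cball p \<rho> \<longrightarrow> u x = 0"
    proof (rule minimizer_positivity_ball[OF assms(1) u])
      show "mixed s u < \<infinity>" using uL by (rule order_le_less_trans) simp
      show "mixed s u \<le> mixed s w" if "w \<in> admissible m R" for w :: "'a \<Rightarrow> real" using uL lower[OF that] by (rule order_trans)
    qed
    have "emeasure lborel (ball p \<rho>) \<le> emeasure lborel {x. u x \<noteq> 0}"
      using \<rho>(2) by (intro emeasure_mono_AE) (auto elim!: eventually_mono)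
    also have "\<dots> \<le> ennreal m" by (rule uD)
    finally have \<rho>r: "\<rho> \<le> r" using \<rho>(1) by (rule ball_le)
    define u1 where "u1 x = indicator (cball p \<rho>) x * u x" for x
    have [measurable]: "u1 \<in> borel_measurable borel" unfolding u1_def by measurable
    have u1: "AE x in lborel. u1 x = u x" using \<rho>(3) by (rule eventually_mono) (auto simp: u1_def indicator_def)
    \<comment> \<open>The minimizer is moved from its own centre \<open>p\<close> to the centre
      \<open>c\<close> of the given ball; restriction to the open ball below costs only a null
      set.\<close>
    define u2 where "u2 x = u1 (x + (p - c))" for x
    have [measurable]: "u2 \<in> borel_measurable borel" unfolding u2_def by measurable
    define v where "v x = indicator (ball c r) x * u2 x" for x
    have [measurable]: "v \<in> borel_measurable borel" unfolding v_def by measurable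
    have v: "AE x in lborel. v x = u2 x"
      using AE_cball_ball[of c r]
    proof eventually_elim
      case (elim x)
      have "u2 x = 0" if "x \<notin> cball c r"
      proof -
        have "dist p (x + (p - c)) = dist c x" by (simp add: dist_norm)
        then have "x + (p - c) \<notin> cball p \<rho>" using that \<rho>r by simp
        then show ?thesis by (simp add: u2_def u1_def)
      qed
      then show ?case using elim by (auto simp: v_def indicator_def)
    qed
    have vu: "mixed s v = mixed s u"
      unfolding mixed_cong_AE[OF v] mixed_cong_AE[OF u1, symmetric] u2_def by (rule mixed_translate) measurable
    have "(\<integral>\<^sup>+x. ennreal ((v x)\<^sup>2) \<partial>lborel) = (\<integral>\<^sup>+x. ennreal ((u2 x)\<^sup>2) \<partial>lborel)"
      using v by (intro nn_integral_cong_AE) (auto elim!: eventually_mono)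
    also have "\<dots> = (\<integral>\<^sup>+x. ennreal ((u1 x)\<^sup>2) \<partial>lborel)"
      unfolding u2_def by (rule nn_integral_lborel_add) measurable
    also have "\<dots> = (\<integral>\<^sup>+x. ennreal ((u x)\<^sup>2) \<partial>lborel)"
      using u1 by (intro nn_integral_cong_AE) (auto elim!: eventually_mono)
    finally have v1: "(\<integral>\<^sup>+x. ennreal ((v x)\<^sup>2) \<partial>lborel) = 1" by (simp add: uD(5))
    have "lambda_L (ball c r) s \<le> mixed s v"
    proof (rule ball_eigenvalue_le[OF assms(1) _ _ v1])
      show "v x = 0" if "x \<notin> ball c r" for x using that by (simp add: v_def)
      show "mixed s v < \<infinity>" unfolding vu using uL by (rule order_le_less_trans) simp
    qed measurable
    then show ?thesis using uL vu by simp
  qed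
  have L_le: "ennreal L \<le> lambda_L \<Omega> s"
    unfolding lambda_L_def
  proof (rule INF_greatest, clarify)
    fix u :: "'a \<Rightarrow> real" and G
    assume XU: "XU_pair \<Omega> u G" and nz: "\<not> (AE x in lebesgue. u x = 0)"
    obtain w where w: "w \<in> admissible m R" and "\<And>x. x \<notin> \<Omega> \<Longrightarrow> w x = 0"
      and le: "mixed s w \<le> energy \<Omega> s u G / ennreal (\<integral>x. indicator \<Omega> x * (u x)\<^sup>2 \<partial>lebesgue)"
      by (rule domain_competitor[OF assms(1,3,5,6) \<Omega>R eq_refl[OF m] XU nz]) blast
    show "ennreal L \<le> energy \<Omega> s (fst (u, G)) (snd (u, G)) / ennreal (\<integral>x. indicator \<Omega> x * (fst (u, G) x)\<^sup>2 \<partial>lebesgue)"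
      unfolding fst_conv snd_conv using lower[OF w] le by (rule order_trans)
  qed
  have rigid: "\<exists>c' r'. \<Omega> = ball c' r'" if "lambda_L \<Omega> s = lambda_L (ball c r) s"
  proof -
    \<comment> \<open>Equality closes the chain of the two eigenvalues and \<open>L\<close>, so a
      minimizing sequence for \<open>\<Omega>\<close> is minimizing in the whole admissible
      class.\<close>
    have \<Lambda>\<Omega>: "lambda_L \<Omega> s = ennreal L" using that ball_le_L L_le by simp
    obtain P where P: "\<forall>n. P n \<in> {(u, G). XU_pair \<Omega> u G \<and> \<not> (AE x in lebesgue. u x = 0)} \<and>
        energy \<Omega> s (fst (P n)) (snd (P n)) / ennreal (\<integral>x. indicator \<Omega> x * (fst (P n) x)\<^sup>2 \<partial>lebesgue) \<le> ennreal (L + (1/2)^n)"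
      using INF_approx_seq[OF \<Lambda>\<Omega>[unfolded lambda_L_def] L(2)] by (rule exE)
    have "\<exists>w :: 'a \<Rightarrow> real. w \<in> admissible m R \<and> (\<forall>x. x \<notin> \<Omega> \<longrightarrow> w x = 0) \<and> mixed s w \<le> ennreal (L + (1/2)^n)" for n
    proof -
      have XU: "XU_pair \<Omega> (fst (P n)) (snd (P n))" and nz: "\<not> (AE x in lebesgue. fst (P n) x = 0)"
        using P[rule_format, of n] by (auto simp: case_prod_beta)
      obtain w where w: "w \<in> admissible m R" "\<And>x. x \<notin> \<Omega> \<Longrightarrow> w x = 0"
        "mixed s w \<le> energy \<Omega> s (fst (P n)) (snd (P n)) / ennreal (\<integral>x. indicator \<Omega> x * (fst (P n) x)\<^sup>2 \<partial>lebesgue)"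
        by (rule domain_competitor[OF assms(1,3,5,6) \<Omega>R eq_refl[OF m] XU nz]) blast
      show ?thesis using w(1,2) order_trans[OF w(3) P[rule_format, of n, THEN conjunct2]] by (intro exI[of _ w]) simp
    qed
    then obtain W where W: "\<And>n. W n \<in> admissible m R" "\<And>n x. x \<notin> \<Omega> \<Longrightarrow> W n x = 0" "\<And>n. mixed s (W n) \<le> ennreal (L + (1/2)^n)"
      by metis
    \<comment> \<open>Taking \<open>\<Omega>\<close> as the set \<open>W\<close> keeps the vanishing
      outside \<open>\<Omega>\<close>, a property that the minimizer \<open>u\<close> above need not
      have.\<close>
    obtain v where v: "v \<in> admissible m R" "mixed s v \<le> ennreal L" "\<And>x. x \<notin> \<Omega> \<Longrightarrow> v x = 0"
      using admissible_limit[OF assms(1) W(1) L(2) W(3) \<Omega>m W(2)] by blast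
    note vD = admissibleD[OF v(1)]
    have [measurable]: "v \<in> borel_measurable borel" by (rule vD)
    have vfin: "mixed s v < \<infinity>" using v(2) by (rule order_le_less_trans) simp
    have vmin: "mixed s v \<le> mixed s w" if "w \<in> admissible m R" for w :: "'a \<Rightarrow> real"
      using v(2) lower[OF that] by (rule order_trans)
    obtain p \<rho> where \<rho>: "\<rho> \<ge> 0" "AE x in lborel. x \<in> ball p \<rho> \<longrightarrow> v x > 0" "AE x in lborel. x \<notin> cball p \<rho> \<longrightarrow> v x = 0"
      using minimizer_positivity_ball[OF assms(1) v(1) vfin vmin] by blast
    have "r \<le> \<rho>"
      using ball_eq[of 0] by (intro minimizer_radius[OF assms(1) v(1) vfin vmin \<rho>(1,3) r rR]) auto
    have in\<Omega>: "AE x in lborel. x \<in> ball p r \<longrightarrow> x \<in> \<Omega>"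
      using \<rho>(2) by (rule eventually_mono) (use v(3) \<open>r \<le> \<rho>\<close> in force)
    \<comment> \<open>\<open>\<Omega>\<close> contains the ball up to a null set and has the same
      finite volume, so nothing of positive measure remains.\<close>
    have "emeasure lborel (\<Omega> - ball p r) = 0"
    proof -
      have "emeasure lborel (\<Omega> \<inter> ball p r) = emeasure lborel (ball p r)"
        using in\<Omega> by (intro emeasure_eq_AE) (auto elim!: eventually_mono)
      then have 1: "emeasure lborel (\<Omega> \<inter> ball p r) = ennreal m" by (simp add: ball_eq)
      have "emeasure lborel (\<Omega> - ball p r) + emeasure lborel (\<Omega> \<inter> ball p r) = emeasure lborel \<Omega>"
        by (subst plus_emeasure) (auto intro!: arg_cong[where f="emeasure lborel"])
      then have "ennreal m + emeasure lborel (\<Omega> - ball p r) = ennreal m + 0" using 1 m by (simp add: add.commute)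
      then show ?thesis unfolding ennreal_add_left_cancel by simp
    qed
    then have "AE x in lborel. x \<notin> \<Omega> - ball p r" by (intro AE_not_in) (auto simp: null_sets_def)
    with in\<Omega> have "AE x in lborel. x \<in> \<Omega> \<longleftrightarrow> x \<in> ball p r" by eventually_elim auto
    then have "\<Omega> = ball p r" by (rule C1_domain_eq_ball[OF assms(3,6) r])
    then show ?thesis by blast
  qed
  show "lambda_L \<Omega> s \<ge> lambda_L (ball c r) s \<and>
      (lambda_L \<Omega> s = lambda_L (ball c r) s \<longrightarrow> (\<exists>c' r'. \<Omega> = ball c' r'))"
    using order_trans[OF ball_le_L L_le] rigid by blast
qed

end
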